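(* The map $M\mapsto VP_M(\underline t)\in\mathbb R[t_S : S\in 2^{[n]}]$, assigning to each loopless matroid $M$ on a ground set $[n]=\{1,\ldots,n\}$ ($n\ge 1$) its volume polynomial, is a matroid valuation. That is, for every loopless matroid $M$ on $[n]$ and every matroid subdivision $\mathcal S:\Delta(M)=\bigcup_i\Delta(M_i)$ of its matroid polytope, $$VP_M = \sum_{Q\in\operatorname{Int}(\mathcal S)} (-1)^{\dim\Delta(M)-\dim Q}\, VP_{M_Q}\quad\text{in } \mathbb R[t_S : S\in 2^{[n]}].$$
   Context: Volume polynomial: For a loopless matroid $M$ of rank $d+1$ on $E$ (loopless: $\emptyset$ is a flat), $\mathscr L_M$ is the lattice of flats and $\overline{\mathscr L_M} := \mathscr L_M\setminus\{\emptyset,E\}$. The Chow ring of $M$ is the graded ring $$A^\bullet(M) := \mathbb R[x_F : F\in \overline{\mathscr L_M}]/(\mathcal I_M+\mathcal J_M),$$ where $\mathcal I_M = (x_Fx_{F'} : F,F' \text{ incomparable})$ and $\mathcal J_M = (\sum_{F\ni i}x_F - \sum_{G\ni j}x_G : i,j\in E)$, sums over flats in $\overline{\mathscr L_M}$. By a known theorem of Adiprasito–Huh–Katz there is a unique linear isomorphism $\deg_M: A^d(M)\to\mathbb R$ with $\deg_M(x_{G_1}\cdots x_{G_d})=1$ for every maximal chain $G_1\subsetneq\cdots\subsetneq G_d$ in $\overline{\mathscr L_M}$. The volume polynomial is $VP_M := \deg_M(\sum_{F\in\overline{\mathscr L_M}} x_Ft_F)^d\in\mathbb R[t_F : F\in\overline{\mathscr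 L_M}]$ (with $\deg_M$ extended linearly over the polynomial ring in the $t_F$); for $E=[n]$ it is regarded as an element of $\mathbb R[t_S : S\in 2^{[n]}]$. Matroid polytopes and subdivisions: For a matroid $M$ on $[n]$ with set of bases $\mathcal B$, its matroid polytope is $\Delta(M):=\operatorname{Conv}(e_B : B\in\mathcal B)\subset\mathbb R^n$, $e_S:=\sum_{i\in S}e_i$. Every nonempty face of a matroid polytope is a matroid polytope; for a matroid polytope $Q$, $M_Q$ denotes the matroid with $\Delta(M_Q)=Q$. A matroid subdivision $\mathcal S$ of $\Delta(M)$ is a polyhedral subdivision $\Delta(M)=\bigcup_i\Delta(M_i)$ in which each $\Delta(M_i)$ is a matroid polytope. $\operatorname{Int}(\mathcal S)$ is the set of all nonempty faces (of any dimension) of the $\Delta(M_i)$'s that are not contained in the (relative) boundary of $\Delta(M)$. If $M$ is loopless, then $M_Q$ is loopless for every $Q\in\operatorname{Int}(\mathcal S)$. *)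

theory Defs
  imports "HOL-Analysis.Analysis" "HOL-Algebra.QuotRing" "HOL-Library.Poly_Mapping"
begin

text \<open>
  A matroid is given by its set of bases.  The ground set is a whole finite type, so that a type
  \<open>'n\<close> with \<open>CARD('n) = n\<close> plays the role of \<open>[n]\<close>; types being nonempty, \<open>n \<ge> 1\<close> holds.
\<close>

definition matroid :: "'n::finite set set \<Rightarrow> bool" where
  "matroid M \<longleftrightarrow> M \<noteq> {} \<and>
     (\<forall>A\<in>M. \<forall>B\<in>M. \<forall>x\<in>A - B. \<exists>y\<in>B - A. insert y (A - {x}) \<in> M)"

definition rank_of :: "'n::finite set set \<Rightarrow> 'n set \<Rightarrow> nat" where
  "rank_of M S = Max ((\<lambda>B. card (S \<inter> B)) ` M)"

definition flat :: "'n::finite set set \<Rightarrow> 'n set \<Rightarrow> bool" where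
  "flat M F \<longleftrightarrow> (\<forall>i. i \<notin> F \<longrightarrow> rank_of M F < rank_of M (insert i F))"

definition loopless :: "'n::finite set set \<Rightarrow> bool" where
  "loopless M \<longleftrightarrow> flat M {}"

definition proper_flats :: "'n::finite set set \<Rightarrow> 'n set set" where
  "proper_flats M = {F. flat M F} - {{}, UNIV}"

text \<open>The number \<open>d\<close> for a matroid of rank \<open>d + 1\<close>.\<close>

definition top_degree :: "'n::finite set set \<Rightarrow> nat" where
  "top_degree M = rank_of M UNIV - 1"


subsection \<open>Polynomials\<close>

text \<open>
  Polynomials in the variables \<open>'v\<close>: finitely supported coefficient functions on the exponent
  vectors \<open>'v \<Rightarrow>\<^sub>0 nat\<close>, with the convolution product of \<open>HOL-Library.Poly_Mapping\<close>.
\<close>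

type_synonym ('v, 'a) mpoly = "('v \<Rightarrow>\<^sub>0 nat) \<Rightarrow>\<^sub>0 'a"

definition const :: "'a::zero \<Rightarrow> ('v, 'a) mpoly" where
  "const c = Poly_Mapping.single 0 c"

definition var :: "'v \<Rightarrow> ('v, 'a::zero_neq_one) mpoly" where
  "var v = Poly_Mapping.single (Poly_Mapping.single v 1) 1"

definition polys_in :: "'v set \<Rightarrow> ('v, 'a::zero) mpoly set" where
  "polys_in V = {p. \<forall>m\<in>Poly_Mapping.keys p. Poly_Mapping.keys m \<subseteq> V}"

definition homogeneous :: "nat \<Rightarrow> ('v, 'a::zero) mpoly \<Rightarrow> bool" where
  "homogeneous k p \<longleftrightarrow>
     (\<forall>m\<in>Poly_Mapping.keys p. (\<Sum>v\<in>Poly_Mapping.keys m. Poly_Mapping.lookup m v) = k)"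

definition poly_ring :: "'v set \<Rightarrow> ('v, real) mpoly ring" where
  "poly_ring V =
     \<lparr>carrier = polys_in V, monoid.mult = (*), one = 1, ring.zero = 0, add = (+)\<rparr>"


subsection \<open>The Chow ring, its degree map, and the volume polynomial\<close>

definition flat_ring :: "'n::finite set set \<Rightarrow> ('n set, real) mpoly ring" where
  "flat_ring M = poly_ring (proper_flats M)"

definition incomparable_ideal :: "'n::finite set set \<Rightarrow> ('n set, real) mpoly set" where
  "incomparable_ideal M = genideal (flat_ring M)
     {var F * var F' | F F'. F \<in> proper_flats M \<and> F' \<in> proper_flats M \<and>
        \<not> F \<subseteq> F' \<and> \<not> F' \<subseteq> F}"

definition linear_ideal :: "'n::finite set set \<Rightarrow> ('n set, real) mpoly set" where
  "linear_ideal M = genideal (flat_ring M)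
     {(\<Sum>F | F \<in> proper_flats M \<and> i \<in> F. var F) - (\<Sum>G | G \<in> proper_flats M \<and> j \<in> G. var G) | i j.
        True}"

definition chow_ideal :: "'n::finite set set \<Rightarrow> ('n set, real) mpoly set" where
  "chow_ideal M = set_add (flat_ring M) (incomparable_ideal M) (linear_ideal M)"

definition chow_ring :: "'n::finite set set \<Rightarrow> ('n set, real) mpoly set ring" where
  "chow_ring M = FactRing (flat_ring M) (chow_ideal M)"

definition chow_class :: "'n::finite set set \<Rightarrow> ('n set, real) mpoly \<Rightarrow> ('n set, real) mpoly set" where
  "chow_class M p = a_r_coset (flat_ring M) (chow_ideal M) p"

definition chow_graded :: "'n::finite set set \<Rightarrow> nat \<Rightarrow> ('n set, real) mpoly set set" where
  "chow_graded M k = chow_class M ` {p \<in> carrier (flat_ring M). homogeneous k p}"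

text \<open>
  Scalar multiplication by \<open>c\<close> in the Chow ring is multiplication by the class of the
  constant \<open>c\<close>.  The function is fixed to \<open>undefined\<close> off the top graded piece, so that it is
  unique as a total function.
\<close>

definition is_degree_map ::
  "'n::finite set set \<Rightarrow> (('n set, real) mpoly set \<Rightarrow> real) \<Rightarrow> bool" where
  "is_degree_map M \<phi> \<longleftrightarrow>
     \<phi> \<in> extensional (chow_graded M (top_degree M)) \<and>
     (\<forall>a\<in>chow_graded M (top_degree M). \<forall>b\<in>chow_graded M (top_degree M).
        \<phi> (add (chow_ring M) a b) = \<phi> a + \<phi> b) \<and>
     (\<forall>c. \<forall>a\<in>chow_graded M (top_degree M).
        \<phi> (monoid.mult (chow_ring M) (chow_class M (const c)) a) = c * \<phi> a) \<and>
     bij_betw \<phi> (chow_graded M (top_degree M)) UNIV \<and>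
     (\<forall>C. subset.maxchain (proper_flats M) C \<longrightarrow> \<phi> (chow_class M (\<Prod>G\<in>C. var G)) = 1)"

definition chow_degree :: "'n::finite set set \<Rightarrow> ('n set, real) mpoly set \<Rightarrow> real" where
  "chow_degree M = (THE \<phi>. is_degree_map M \<phi>)"

text \<open>
  The power is taken in the ring of polynomials in the variables \<open>t\<close> whose coefficients are
  themselves polynomials in the variables \<open>x\<close>; then the degree map is applied to (the class of)
  each coefficient.
\<close>

definition volume_polynomial :: "'n::finite set set \<Rightarrow> ('n set, real) mpoly" where
  "volume_polynomial M =
     Poly_Mapping.map (\<lambda>p. chow_degree M (chow_class M p))
       ((\<Sum>F\<in>proper_flats M. const (var F) * var F) ^ top_degree M)"


subsection \<open>Matroid polytopes and matroid subdivisions\<close>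

definition indicator_vec :: "'n::finite set \<Rightarrow> real ^ 'n" where
  "indicator_vec S = (\<Sum>i\<in>S. axis i 1)"

definition matroid_polytope :: "'n::finite set set \<Rightarrow> (real ^ 'n) set" where
  "matroid_polytope M = convex hull (indicator_vec ` M)"

definition matroid_of_polytope :: "(real ^ 'n::finite) set \<Rightarrow> 'n set set" where
  "matroid_of_polytope Q = (THE M. matroid M \<and> matroid_polytope M = Q)"

definition polyhedral_subdivision :: "'a::euclidean_space set \<Rightarrow> 'a set set \<Rightarrow> bool" where
  "polyhedral_subdivision P \<S> \<longleftrightarrow>
     finite \<S> \<and> (\<forall>Q\<in>\<S>. polytope Q) \<and> P = \<Union>\<S> \<and>
     (\<forall>Q\<in>\<S>. \<forall>R\<in>\<S>. (Q \<inter> R) face_of Q \<and> (Q \<inter> R) face_of R)"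

definition matroid_subdivision :: "'n::finite set set \<Rightarrow> (real ^ 'n) set set \<Rightarrow> bool" where
  "matroid_subdivision M \<S> \<longleftrightarrow>
     polyhedral_subdivision (matroid_polytope M) \<S> \<and>
     (\<forall>Q\<in>\<S>. \<exists>N. matroid N \<and> Q = matroid_polytope N)"

definition interior_faces :: "'a::euclidean_space set \<Rightarrow> 'a set set \<Rightarrow> 'a set set" where
  "interior_faces P \<S> =
     {Q. Q \<noteq> {} \<and> (\<exists>R\<in>\<S>. Q face_of R) \<and> \<not> Q \<subseteq> rel_frontier P}"

end

theory Submission
  imports Defs
begin

text \<open>
  By Backman, Eur and Simpson, the degree of a monomial in the simplicial generators \<open>h_T\<close> of the
  Chow ring of \<open>M\<close> is 1 if the matroid polytope of \<open>M\<close> meets a compact convex set that depends only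
  on the monomial, and 0 otherwise. We take this as the definition of a functional on polynomials in
  the \<open>h_T\<close>, substitute for each \<open>x_F\<close> its expression in the \<open>h_T\<close>, and check by moving mass between
  coordinates that the relations of the Chow ring go to zero. The top graded piece is spanned by a
  power of the hyperplane class \<open>\<alpha>\<close>, to which every maximal chain is equal, so the functional is the
  degree map. Every coefficient of the volume polynomial thus is a fixed linear combination of
  indicators of the condition that the matroid polytope meets a given compact convex set. Such an
  indicator is a valuation: the relative interior of a subdivided polytope is the disjoint union of
  the relative interiors of the interior faces, and after thickening the compact set to an open one
  the identity follows from the additivity of the Euler characteristic \<open>(-1)^dim\<close> of relatively open
  bounded convex sets.
\<close>

subsection \<open>Bases, rank and flats\<close>

text \<open>\<open>chow_degree\<close> is a definite description, so existence and uniqueness of the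
  degree map have to be proved along the way. The spanning argument bounds the dimension of the top
  graded piece by one; that \<alpha>^d is nonzero there comes only from the functional, which is 0
  on the Chow ideal and 1 on \<alpha>^d. A functional vanishes on an ideal only if it vanishes on
  all multiples of the generators. Hence the work with the radical of the functional, the largest
  ideal inside its kernel: each relation becomes a statement about sums of simplices that has to
  survive adding arbitrary further summands. The variables x_F are unsuited to comparing matroids:
  the flats change when one passes to a face of the polytope, and monomials in the x_F can have
  negative degree. The h_T exist for every set T, their monomials have degree 0 or 1, and the
  matroid enters the functional through its polytope alone, which is what a subdivision
  controls.\<close>

lemma matroid_exchange:
  assumes "matroid M" "A \<in> M" "B \<in> M" "x \<in> A - B"
  obtains y where "y \<in> B - A" "insert y (A - {x}) \<in> M"
  using assms unfolding matroid_def by blast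

lemma card_exchange:
  fixes A :: "'n::finite set"
  assumes "x \<in> A" "y \<notin> A"
  shows "card (insert y (A - {x})) = card A"
  using assms by (metis Diff_iff card.remove card_insert_disjoint finite finite_Diff)

text \<open>Exchanging an element of \<open>A - B\<close> for one of \<open>B - A\<close> keeps the
  size and brings \<open>A\<close> closer to \<open>B\<close>. Once \<open>A\<close> lies inside
  \<open>B\<close>, an exchange starting from \<open>B\<close> would have nothing to bring in, so
  the two agree.\<close>

lemma card_bases_eq:
  fixes M :: "'n::finite set set"
  assumes M: "matroid M" and "A \<in> M" "B \<in> M"
  shows "card A = card B"
  using \<open>A \<in> M\<close>
proof (induction "card (A - B)" arbitrary: A rule: less_induct)
  case less
  show ?case
  proof (cases "A \<subseteq> B")
    case True
    have "B - A = {}"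
      using matroid_exchange[OF M \<open>B \<in> M\<close> \<open>A \<in> M\<close>] True by (metis Diff_eq_empty_iff all_not_in_conv)
    then show ?thesis using True by (metis Diff_eq_empty_iff subset_antisym)
  next
    case False
    then obtain x where x: "x \<in> A - B" by blast
    obtain y where y: "y \<in> B - A" "insert y (A - {x}) \<in> M"
      using matroid_exchange[OF M less.prems \<open>B \<in> M\<close> x] .
    have "insert y (A - {x}) - B = (A - B) - {x}" using y by auto
    then have "card (insert y (A - {x}) - B) < card (A - B)"
      using x by (metis card_Diff1_less finite)
    then have "card (insert y (A - {x})) = card B" using less.hyps y(2) by blast
    then show ?thesis using x y card_exchange[of x A y] by simp
  qed
qed

definition indep_in :: "'n set set \<Rightarrow> 'n set \<Rightarrow> bool" where
  "indep_in M I \<longleftrightarrow> (\<exists>B\<in>M. I \<subseteq> B)"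

text \<open>Start from any basis containing \<open>I\<close> and exchange, one at a time, its
  elements outside \<open>I \<union> B\<close> for elements of \<open>B\<close>.\<close>

lemma indep_extend_basis:
  fixes M :: "'n::finite set set"
  assumes M: "matroid M" and I: "indep_in M I" and B: "B \<in> M"
  obtains D where "D \<in> M" "I \<subseteq> D" "D \<subseteq> I \<union> B"
proof -
  have "\<exists>D. D \<in> M \<and> I \<subseteq> D \<and> D \<subseteq> I \<union> B" if "C \<in> M" "I \<subseteq> C" for C
    using that
  proof (induction "card (C - (I \<union> B))" arbitrary: C rule: less_induct)
    case less
    show ?case
    proof (cases "C \<subseteq> I \<union> B")
      case True
      then show ?thesis using less by blast
    next
      case False
      then obtain x where x: "x \<in> C" "x \<notin> I" "x \<notin> B" by blast
      then obtain y where y: "y \<in> B - C" "insert y (C - {x}) \<in> M"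
        using matroid_exchange[OF M less.prems(1) B, of x] by blast
      have "insert y (C - {x}) - (I \<union> B) = (C - (I \<union> B)) - {x}" using y by auto
      then have "card (insert y (C - {x}) - (I \<union> B)) < card (C - (I \<union> B))"
        using x by (metis Diff_iff Un_iff card_Diff1_less finite)
      then show ?thesis using less.hyps y(2) less.prems(2) x(2) by blast
    qed
  qed
  then show thesis using I that unfolding indep_in_def by blast
qed

lemma rank_of_le:
  fixes M :: "'n::finite set set"
  shows "B \<in> M \<Longrightarrow> card (S \<inter> B) \<le> rank_of M S"
  unfolding rank_of_def by (intro Max_ge) auto

lemma rank_of_attained:
  fixes M :: "'n::finite set set"
  assumes "matroid M"
  obtains B where "B \<in> M" "card (S \<inter> B) = rank_of M S"
proof -
  have "rank_of M S \<in> (\<lambda>B. card (S \<inter> B)) ` M"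
    unfolding rank_of_def using assms by (intro Max_in) (auto simp: matroid_def)
  then show thesis using that by auto
qed

lemma rank_of_mono:
  fixes M :: "'n::finite set set"
  assumes "matroid M" "S \<subseteq> T"
  shows "rank_of M S \<le> rank_of M T"
proof -
  obtain B where B: "B \<in> M" "card (S \<inter> B) = rank_of M S"
    using rank_of_attained[OF assms(1)] .
  have "card (S \<inter> B) \<le> card (T \<inter> B)" using assms(2) by (intro card_mono) auto
  then show ?thesis using rank_of_le[OF B(1), of T] B(2) by simp
qed

lemma rank_of_insert_le:
  fixes M :: "'n::finite set set"
  assumes "matroid M"
  shows "rank_of M (insert i S) \<le> Suc (rank_of M S)"
proof -
  obtain B where B: "B \<in> M" "card (insert i S \<inter> B) = rank_of M (insert i S)"
    using rank_of_attained[OF assms] .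
  have "card (insert i S \<inter> B) \<le> card (insert i (S \<inter> B))" by (intro card_mono) auto
  also have "\<dots> \<le> Suc (card (S \<inter> B))" by (simp add: card_insert_if)
  finally show ?thesis using rank_of_le[OF B(1), of S] B(2) by linarith
qed

lemma rank_of_indep_le:
  fixes M :: "'n::finite set set"
  assumes "indep_in M I" "I \<subseteq> S"
  shows "card I \<le> rank_of M S"
proof -
  obtain B where "B \<in> M" "I \<subseteq> B" using assms unfolding indep_in_def by blast
  then show ?thesis using rank_of_le[of B M S] card_mono[of "S \<inter> B" I] assms(2) by force
qed

lemma rank_of_UNIV:
  fixes M :: "'n::finite set set"
  assumes "matroid M" "B \<in> M"
  shows "rank_of M UNIV = card B"
  using rank_of_attained[OF assms(1), of UNIV] card_bases_eq[OF assms(1) _ assms(2)]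
  by (metis Int_UNIV_left)

text \<open>Extend \<open>I\<close> inside \<open>I \<union> B\<close>, where the basis
  \<open>B\<close> meets \<open>S\<close> in as many elements as possible. As \<open>I\<close> lies
  in \<open>S\<close>, the result has no more elements outside \<open>S\<close> than
  \<open>B\<close> has, hence no fewer inside.\<close>

lemma indep_extend_rank:
  fixes M :: "'n::finite set set"
  assumes M: "matroid M" and I: "indep_in M I" "I \<subseteq> S"
  obtains D where "D \<in> M" "I \<subseteq> D" "card (S \<inter> D) = rank_of M S"
proof -
  obtain B where B: "B \<in> M" "card (S \<inter> B) = rank_of M S" using rank_of_attained[OF M] .
  obtain D where D: "D \<in> M" "I \<subseteq> D" "D \<subseteq> I \<union> B" using indep_extend_basis[OF M I(1) B(1)] .
  have "card (D - S) \<le> card (B - S)" using D(3) I(2) by (intro card_mono) auto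
  moreover have "card D = card (S \<inter> D) + card (D - S)" "card B = card (S \<inter> B) + card (B - S)"
    by (metis Int_commute card_Diff_subset_Int finite add_diff_inverse_nat card_mono inf_le1 not_less)+
  moreover have "card D = card B" using card_bases_eq[OF M D(1) B(1)] .
  ultimately have "card (S \<inter> D) \<ge> rank_of M S" using B(2) by linarith
  then have "card (S \<inter> D) = rank_of M S" using rank_of_le[OF D(1), of S] by simp
  then show thesis using that D by blast
qed

text \<open>A one-element form of submodularity. A maximal independent subset of \<open>S\<close> is
  grown to one of \<open>T\<close> and then to one of \<open>insert i T\<close>. If the last step
  gained rank, it would contain \<open>i\<close>, and \<open>i\<close> with the part in
  \<open>S\<close> would be independent and too large for \<open>insert i S\<close>.\<close>

lemma rank_of_insert_mono:
  fixes M :: "'n::finite set set"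
  assumes M: "matroid M" and eq: "rank_of M (insert i S) = rank_of M S" and "S \<subseteq> T"
  shows "rank_of M (insert i T) = rank_of M T"
proof (rule ccontr)
  assume "rank_of M (insert i T) \<noteq> rank_of M T"
  then have gt: "rank_of M T < rank_of M (insert i T)"
    using rank_of_mono[OF M subset_insertI] by (metis le_neq_implies_less)
  obtain B where B: "B \<in> M" "card (S \<inter> B) = rank_of M S" using rank_of_attained[OF M] .
  have "indep_in M (S \<inter> B)" using B(1) unfolding indep_in_def by blast
  then obtain D where D: "D \<in> M" "S \<inter> B \<subseteq> D" "card (T \<inter> D) = rank_of M T"
    using indep_extend_rank[OF M, of "S \<inter> B" T] \<open>S \<subseteq> T\<close> by blast
  have "indep_in M (T \<inter> D)" using D(1) unfolding indep_in_def by blast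
  then obtain D' where D': "D' \<in> M" "T \<inter> D \<subseteq> D'" "card (insert i T \<inter> D') = rank_of M (insert i T)"
    using indep_extend_rank[OF M, of "T \<inter> D" "insert i T"] by blast
  have "card (T \<inter> D') \<le> card (T \<inter> D)" using rank_of_le[OF D'(1), of T] D(3) by simp
  then have "i \<in> D'" "i \<notin> T"
    using D'(3) gt D(3) by (metis Int_insert_left leD, metis insert_absorb leD gt order_refl)
  have "i \<notin> S" using \<open>i \<notin> T\<close> \<open>S \<subseteq> T\<close> by blast
  have "insert i (S \<inter> B) \<subseteq> D'" using \<open>i \<in> D'\<close> D'(2) D(2) \<open>S \<subseteq> T\<close> by blast
  then have "card (insert i (S \<inter> B)) \<le> rank_of M (insert i S)"
    using D'(1) by (intro rank_of_indep_le) (auto simp: indep_in_def)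
  then show False using B(2) eq \<open>i \<notin> S\<close> by simp
qed

section \<open>Closure, flats and stronger exchange properties\<close>

definition closure_in :: "'n::finite set set \<Rightarrow> 'n set \<Rightarrow> 'n set" where
  "closure_in M S = {i. rank_of M (insert i S) = rank_of M S}"

lemma closure_in_extensive: "S \<subseteq> closure_in M S"
  unfolding closure_in_def by (auto simp: insert_absorb)

lemma rank_of_closure_in:
  fixes M :: "'n::finite set set"
  assumes M: "matroid M"
  shows "rank_of M (closure_in M S) = rank_of M S"
proof -
  have "rank_of M (S \<union> T) = rank_of M S" if "T \<subseteq> closure_in M S" for T
    using finite[of T] that
  proof (induction T rule: finite_induct)
    case (insert i T)
    then have "rank_of M (insert i S) = rank_of M S" by (auto simp: closure_in_def)
    then have "rank_of M (insert i (S \<union> T)) = rank_of M (S \<union> T)"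
      by (rule rank_of_insert_mono[OF M]) blast
    then show ?case using insert by simp
  qed simp
  from this[of "closure_in M S"] show ?thesis
    using closure_in_extensive[of S M] by (simp add: sup.absorb2)
qed

lemma flat_closure_in:
  fixes M :: "'n::finite set set"
  assumes M: "matroid M"
  shows "flat M (closure_in M S)"
  unfolding flat_def
proof (intro allI impI)
  fix i assume "i \<notin> closure_in M S"
  then have "rank_of M S < rank_of M (insert i S)"
    using rank_of_mono[OF M subset_insertI[of S i]] unfolding closure_in_def by simp
  also have "\<dots> \<le> rank_of M (insert i (closure_in M S))"
    using closure_in_extensive[of S M] by (intro rank_of_mono[OF M]) auto
  finally show "rank_of M (closure_in M S) < rank_of M (insert i (closure_in M S))"
    by (simp add: rank_of_closure_in[OF M])
qed

text \<open>\<open>G\<close> lies in the closure of \<open>S\<close>, which every flat above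
  \<open>S\<close> contains. Applied in both directions, this identifies two flats of equal rank
  that are spanned by the same set.\<close>

lemma flat_superset_same_rank:
  fixes M :: "'n::finite set set"
  assumes M: "matroid M" and F: "flat M F" "S \<subseteq> F" and G: "S \<subseteq> G" "rank_of M G = rank_of M S"
  shows "G \<subseteq> F"
proof
  fix g assume "g \<in> G"
  then have "rank_of M (insert g S) \<le> rank_of M S"
    using G by (metis insert_subset rank_of_mono[OF M])
  then have "rank_of M (insert g S) = rank_of M S"
    using rank_of_mono[OF M subset_insertI[of S g]] by simp
  then have "rank_of M (insert g F) = rank_of M F" by (rule rank_of_insert_mono[OF M]) fact
  then show "g \<in> F" using F(1) unfolding flat_def by (metis less_irrefl)
qed

lemma flat_rank_less:
  fixes M :: "'n::finite set set"
  assumes M: "matroid M" and F: "flat M F" and "F \<subset> G"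
  shows "rank_of M F < rank_of M G"
proof -
  obtain i where "i \<in> G" "i \<notin> F" using \<open>F \<subset> G\<close> by blast
  then have "rank_of M F < rank_of M (insert i F)" using F unfolding flat_def by blast
  also have "\<dots> \<le> rank_of M G" using \<open>F \<subset> G\<close> \<open>i \<in> G\<close> by (intro rank_of_mono[OF M]) auto
  finally show ?thesis .
qed

lemma flat_rank_insert:
  fixes M :: "'n::finite set set"
  assumes M: "matroid M" and F: "flat M F" and "i \<notin> F"
  shows "rank_of M (insert i F) = Suc (rank_of M F)"
  using flat_rank_less[OF M F, of "insert i F"] rank_of_insert_le[OF M, of i F] assms(3) by force

text \<open>A maximal independent subset of \<open>A\<close> is completed from \<open>B\<close> to a
  basis \<open>D\<close>; it misses \<open>i\<close>, which depends on \<open>A\<close>. Completing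
  \<open>B - {i}\<close> from \<open>D\<close> then brings in an element of \<open>D\<close> outside
  \<open>B\<close>, and all such elements lie in \<open>A\<close>.\<close>

lemma exchange_into_spanning_set:
  fixes M :: "'n::finite set set"
  assumes M: "matroid M" and B: "B \<in> M" "i \<in> B" and A: "i \<notin> A" "i \<in> closure_in M A"
  obtains j where "j \<in> A" "j \<notin> B" "insert j (B - {i}) \<in> M"
proof -
  obtain C where C: "C \<in> M" "card (A \<inter> C) = rank_of M A" using rank_of_attained[OF M] .
  have "indep_in M (A \<inter> C)" using C(1) unfolding indep_in_def by blast
  then obtain D where D: "D \<in> M" "A \<inter> C \<subseteq> D" "D \<subseteq> (A \<inter> C) \<union> B"
    using indep_extend_basis[OF M _ B(1)] by blast
  have "i \<notin> D"
  proof
    assume "i \<in> D"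
    then have "card (insert i (A \<inter> C)) \<le> rank_of M (insert i A)"
      using D by (intro rank_of_indep_le) (auto simp: indep_in_def)
    moreover have "rank_of M (insert i A) = rank_of M A" using A(2) by (simp add: closure_in_def)
    ultimately show False using C(2) A(1) by simp
  qed
  have "indep_in M (B - {i})" using B(1) unfolding indep_in_def by blast
  then obtain E where E: "E \<in> M" "B - {i} \<subseteq> E" "E \<subseteq> (B - {i}) \<union> D"
    using indep_extend_basis[OF M _ D(1)] by blast
  have "card E = card B" using card_bases_eq[OF M E(1) B(1)] .
  then have "card E = Suc (card (B - {i}))" using B(2) by (metis card_Suc_Diff1 finite)
  then have "card (E - (B - {i})) = 1" using E(2) by (simp add: card_Diff_subset)
  then obtain j where j: "E - (B - {i}) = {j}" by (auto simp: card_1_singleton_iff)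
  then have "E = insert j (B - {i})" using E(2) by blast
  moreover have "j \<in> D" "j \<notin> B - {i}" using j E(3) by auto
  then have "j \<in> A" "j \<notin> B" using \<open>i \<notin> D\<close> D(3) by auto
  ultimately show thesis using that E(1) by blast
qed

text \<open>\<open>Y\<close> together with \<open>x\<close> is the fundamental circuit of
  \<open>x\<close> over \<open>B\<close>, so \<open>x\<close> depends on \<open>Y\<close>, and
  exchanging \<open>x\<close> out of \<open>A\<close> into \<open>Y\<close> gives an element that
  works on both sides. If \<open>x\<close> did not depend on \<open>Y\<close>, then
  \<open>insert x Y\<close> would extend within \<open>B\<close> to a basis omitting exactly one
  element \<open>z\<close> of \<open>B\<close>; such a \<open>z\<close> belongs to \<open>Y\<close>,
  a contradiction.\<close>

lemma matroid_symmetric_exchange: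
  fixes M :: "'n::finite set set"
  assumes M: "matroid M" and A: "A \<in> M" and B: "B \<in> M" and x: "x \<in> A - B"
  obtains y where "y \<in> B - A" "insert y (A - {x}) \<in> M" "insert x (B - {y}) \<in> M"
proof -
  define Y where "Y = {y \<in> B. insert x (B - {y}) \<in> M}"
  have YB: "Y \<subseteq> B" unfolding Y_def by blast
  have "x \<in> closure_in M Y"
  proof (rule ccontr)
    assume "x \<notin> closure_in M Y"
    then have "rank_of M Y < rank_of M (insert x Y)"
      using rank_of_mono[OF M subset_insertI[of Y x]] unfolding closure_in_def by simp
    moreover have "card Y \<le> rank_of M Y"
      using YB B by (intro rank_of_indep_le) (auto simp: indep_in_def)
    moreover obtain C where C: "C \<in> M" "card (insert x Y \<inter> C) = rank_of M (insert x Y)"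
      using rank_of_attained[OF M] .
    moreover have "card (insert x Y) = Suc (card Y)" using YB x by (subst card_insert_disjoint) auto
    ultimately have "card (insert x Y \<inter> C) \<ge> card (insert x Y)" by linarith
    then have "insert x Y \<subseteq> C" by (metis card_seteq finite inf_le1 inf_le2)
    then have "indep_in M (insert x Y)" using C(1) unfolding indep_in_def by blast
    then obtain D where D: "D \<in> M" "insert x Y \<subseteq> D" "D \<subseteq> insert x Y \<union> B"
      using indep_extend_basis[OF M _ B] by blast
    have "card (D - {x}) < card B"
      using card_bases_eq[OF M D(1) B] D(2) by (metis card_Diff1_less finite insert_subset)
    moreover have DB: "D - {x} \<subseteq> B" using D(3) YB by blast
    moreover have "B \<subseteq> D - {x}" if "B \<subseteq> D" using that x by blast
    ultimately obtain z where z: "z \<in> B" "z \<notin> D"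
      using card_mono[of "D - {x}" B] by (metis finite leD subsetI)
    have "Suc (card (D - {x})) = card B"
      using card_bases_eq[OF M D(1) B] D(2) by (metis card_Suc_Diff1 finite insert_subset)
    moreover have "D - {x} \<subseteq> B - {z}" using DB z by blast
    moreover have "Suc (card (B - {z})) = card B" using z by (metis card_Suc_Diff1 finite)
    ultimately have "D - {x} = B - {z}" by (intro card_subset_eq) auto
    then have "D = insert x (B - {z})" using D(2) by blast
    then have "z \<in> Y" using D(1) z(1) unfolding Y_def by simp
    then show False using D(2) z(2) by blast
  qed
  then obtain y where "y \<in> Y" "y \<notin> A" "insert y (A - {x}) \<in> M"
    using exchange_into_spanning_set[OF M A, of x Y] x YB by blast
  then show thesis using that unfolding Y_def by blast
qed

lemma rank_of_empty [simp]:
  fixes M :: "'n::finite set set"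
  assumes "matroid M"
  shows "rank_of M {} = 0"
  using rank_of_attained[OF assms, of "{}"] by auto

lemma loopless_iff:
  fixes M :: "'n::finite set set"
  assumes M: "matroid M"
  shows "loopless M \<longleftrightarrow> (\<forall>i. \<exists>B\<in>M. i \<in> B)"
proof -
  have "0 < rank_of M {i} \<longleftrightarrow> (\<exists>B\<in>M. i \<in> B)" for i
  proof
    assume "0 < rank_of M {i}"
    then show "\<exists>B\<in>M. i \<in> B"
      using rank_of_attained[OF M, of "{i}"] by (metis Int_insert_left_if0 card.empty inf_bot_left less_irrefl)
  next
    assume "\<exists>B\<in>M. i \<in> B"
    then obtain B where "B \<in> M" "i \<in> B" by blast
    then show "0 < rank_of M {i}" using rank_of_le[of B M "{i}"] by simp
  qed
  then show ?thesis unfolding loopless_def flat_def using M by simp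
qed

lemma rank_pos:
  fixes M :: "'n::finite set set"
  assumes M: "matroid M" "loopless M"
  shows "rank_of M UNIV = Suc (top_degree M)"
proof -
  have "rank_of M {} < rank_of M UNIV"
    using flat_rank_less[OF M(1), of "{}" UNIV] M(2) unfolding loopless_def by blast
  then show ?thesis unfolding top_degree_def by simp
qed

subsection \<open>The Euler characteristic on relatively open convex sets\<close>

definition convex_euler :: "'a::euclidean_space set \<Rightarrow> real" where
  "convex_euler U = (if U = {} then 0 else (-1) ^ nat (aff_dim U))"

text \<open>\<open>U\<close> is an open set cut with its affine hull, so a nonempty slice is the
  same open set cut with the affine space
  \<open>affine hull U \<inter> {x. b \<bullet> x = t}\<close>, which is therefore its affine
  hull.\<close>

lemma rel_open_slice:
  fixes U :: "'a::euclidean_space set"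
  assumes U: "rel_open U" and ne: "U \<inter> {x. b \<bullet> x = t} \<noteq> {}"
  shows "rel_open (U \<inter> {x. b \<bullet> x = t})"
    and "aff_dim (U \<inter> {x. b \<bullet> x = t}) =
      (if U \<subseteq> {x. b \<bullet> x = t} then aff_dim U else aff_dim U - 1)"
proof -
  let ?H = "{x. b \<bullet> x = t}"
  have "openin (top_of_set (affine hull U)) U" using U by (simp add: rel_open)
  then obtain T where T: "open T" "U = affine hull U \<inter> T" by (auto simp: openin_open)
  have aff: "affine (affine hull U \<inter> ?H)"
    by (intro affine_Int affine_affine_hull affine_hyperplane)
  have eq: "U \<inter> ?H = (affine hull U \<inter> ?H) \<inter> T" using T(2) by blast
  have hull: "affine hull (U \<inter> ?H) = affine hull U \<inter> ?H"
    unfolding eq by (subst affine_hull_affine_Int_open[OF aff T(1)]) (use ne eq aff in \<open>auto simp: hull_same\<close>)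
  show "rel_open (U \<inter> ?H)"
    unfolding rel_open hull openin_open using T(1) eq by blast
  have sub: "affine hull U \<subseteq> ?H \<longleftrightarrow> U \<subseteq> ?H"
    using hull_minimal[of U ?H affine] hull_subset[of U affine] affine_hyperplane[of b t] by blast
  have "aff_dim (U \<inter> ?H) = aff_dim (affine hull U \<inter> ?H)"
    using aff_dim_affine_hull[of "U \<inter> ?H"] by (simp only: hull)
  also have "\<dots> = (if affine hull U \<subseteq> ?H then aff_dim U else aff_dim U - 1)"
    using aff_dim_affine_Int_hyperplane[of "affine hull U" b t] ne hull_subset[of U affine]
    by (auto simp: aff_dim_affine_hull)
  finally show "aff_dim (U \<inter> ?H) = (if U \<subseteq> ?H then aff_dim U else aff_dim U - 1)"
    using sub by simp
qed

lemma rel_open_extend_segment: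
  fixes U :: "'a::euclidean_space set"
  assumes "convex U" "rel_open U" "y \<in> U" "z \<in> U"
  obtains e where "0 < e" "z + e *\<^sub>R (z - y) \<in> U"
proof -
  have "z \<in> rel_interior U" using assms by (simp add: rel_open_def)
  then obtain e where "e > 1" "(1 - e) *\<^sub>R y + e *\<^sub>R z \<in> U"
    using convex_rel_interior_iff[of U z] assms by blast
  moreover have "(1 - e) *\<^sub>R y + e *\<^sub>R z = z + (e - 1) *\<^sub>R (z - y)"
    by (simp add: algebra_simps)
  ultimately show thesis using that[of "e - 1"] by simp
qed

text \<open>The image of \<open>U\<close> under \<open>b\<close> is a bounded interval. Segments in
  a relatively open set can be prolonged beyond their end, so this interval has no largest and no
  smallest element.\<close>

lemma rel_open_projection:
  fixes U :: "'a::euclidean_space set"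
  assumes U: "convex U" "rel_open U" "bounded U" and ne: "U \<noteq> {}"
    and nt: "\<And>t. \<not> U \<subseteq> {x. b \<bullet> x = t}"
  obtains u v where "u < v" "\<And>t. U \<inter> {x. b \<bullet> x = t} \<noteq> {} \<longleftrightarrow> u < t \<and> t < v"
proof -
  define I where "I = (\<lambda>x. b \<bullet> x) ` U"
  have memI: "t \<in> I \<longleftrightarrow> U \<inter> {x. b \<bullet> x = t} \<noteq> {}" for t unfolding I_def by auto
  have "convex I" unfolding I_def
    by (intro convex_linear_image U(1)) (auto intro: bounded_linear.linear bounded_linear_inner_right)
  have "bounded I" unfolding I_def
    by (intro bounded_linear_image U(3) bounded_linear_inner_right)
  then have bd: "bdd_above I" "bdd_below I"
    by (auto intro: bounded_imp_bdd_above bounded_imp_bdd_below)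
  have "I \<noteq> {}" using ne by (simp add: I_def)
  have other: "\<exists>s\<in>I. s \<noteq> t" for t using nt[of t] unfolding I_def by blast
  have beyond: "\<exists>e>0. t + e * (t - s) \<in> I" if st: "s \<in> I" "t \<in> I" for s t
  proof -
    obtain y z where yz: "y \<in> U" "s = b \<bullet> y" "z \<in> U" "t = b \<bullet> z" using st unfolding I_def by auto
    obtain e where e: "0 < e" "z + e *\<^sub>R (z - y) \<in> U"
      using rel_open_extend_segment[OF U(1,2) yz(1,3)] .
    then have "b \<bullet> (z + e *\<^sub>R (z - y)) \<in> I" unfolding I_def by blast
    then show ?thesis using e(1) yz by (auto simp: inner_simps)
  qed
  have nomax: "\<exists>s\<in>I. s > t" and nomin: "\<exists>s\<in>I. s < t" if "t \<in> I" for t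
  proof -
    obtain s where s: "s \<in> I" "s \<noteq> t" using other by blast
    obtain e where e: "e > 0" "t + e * (t - s) \<in> I" using beyond[OF s(1) \<open>t \<in> I\<close>] by blast
    have "s < t \<longleftrightarrow> t + e * (t - s) > t" using e(1) by (simp add: zero_less_mult_iff)
    moreover have "s > t \<longleftrightarrow> t + e * (t - s) < t" using e(1) by (simp add: mult_less_0_iff)
    ultimately show "\<exists>s\<in>I. s > t" "\<exists>s\<in>I. s < t" using s e(2) by (metis linorder_neqE)+
  qed
  have mem: "t \<in> I \<longleftrightarrow> Inf I < t \<and> t < Sup I" for t
  proof
    assume t: "t \<in> I"
    then show "Inf I < t \<and> t < Sup I"
      using nomax[OF t] nomin[OF t] cInf_lower[OF _ bd(2)] cSup_upper[OF _ bd(1)]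
      by (meson le_less_trans less_le_trans)
  next
    assume t: "Inf I < t \<and> t < Sup I"
    obtain x where x: "x \<in> I" "x < t" using t cInf_lessD[OF \<open>I \<noteq> {}\<close>] by blast
    obtain y where y: "y \<in> I" "t < y" using t less_cSupD[OF \<open>I \<noteq> {}\<close>] by blast
    have "is_interval I" using \<open>convex I\<close> by (simp add: is_interval_convex_1)
    then show "t \<in> I" using x y unfolding is_interval_1 by (meson less_imp_le)
  qed
  show thesis
  proof
    show "Inf I < Sup I" using mem \<open>I \<noteq> {}\<close> by (meson ex_in_conv less_trans)
    show "U \<inter> {x. b \<bullet> x = t} \<noteq> {} \<longleftrightarrow> Inf I < t \<and> t < Sup I" for t
      using mem memI by simp
  qed
qed

text \<open>
  The slices of \<open>U\<close> by the hyperplanes \<open>b \<bullet> x = t\<close> have constant Euler characteristic on the two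
  sides of finitely many breakpoints; summing the jumps from \<open>t\<close> to a slightly larger
  \<open>t + \<delta>\<close> over these breakpoints recovers the Euler characteristic of \<open>U\<close>.
\<close>

lemma convex_euler_slices:
  fixes U :: "'a::euclidean_space set"
  assumes U: "convex U" "rel_open U" "bounded U"
  obtains T0 where "finite T0"
    "\<And>T \<delta>. finite T \<Longrightarrow> T0 \<subseteq> T \<Longrightarrow> 0 < \<delta> \<Longrightarrow> (\<And>s t. s \<in> T \<Longrightarrow> t \<in> T \<Longrightarrow> s < t \<Longrightarrow> s + \<delta> < t) \<Longrightarrow>
      convex_euler U = (\<Sum>t\<in>T. convex_euler (U \<inter> {x. b \<bullet> x = t}) -
        convex_euler (U \<inter> {x. b \<bullet> x = t + \<delta>}))"
proof (cases "U = {}")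
  case True
  then show thesis using that[of "{}"] by (simp add: convex_euler_def)
next
  case ne: False
  show thesis
  proof (cases "\<exists>t. U \<subseteq> {x. b \<bullet> x = t}")
    case True
    then obtain t0 where t0: "U \<subseteq> {x. b \<bullet> x = t0}" by blast
    have slice: "U \<inter> {x. b \<bullet> x = t} = (if t = t0 then U else {})" for t using t0 by auto
    show thesis
    proof (rule that[of "{t0}"])
      fix T :: "real set" and \<delta> :: real
      assume T: "finite T" "{t0} \<subseteq> T" "0 < \<delta>"
        and gap: "\<And>s t. s \<in> T \<Longrightarrow> t \<in> T \<Longrightarrow> s < t \<Longrightarrow> s + \<delta> < t"
      have "t + \<delta> \<noteq> t0" if "t \<in> T" for t
        using gap[of t t0] that T by (cases "t < t0") auto
      then have "(\<Sum>t\<in>T. convex_euler (U \<inter> {x. b \<bullet> x = t}) - convex_euler (U \<inter> {x. b \<bullet> x = t + \<delta>}))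
          = (\<Sum>t\<in>T. if t = t0 then convex_euler U else 0)"
        by (intro sum.cong refl) (auto simp: slice convex_euler_def)
      then show "convex_euler U = (\<Sum>t\<in>T. convex_euler (U \<inter> {x. b \<bullet> x = t}) -
          convex_euler (U \<inter> {x. b \<bullet> x = t + \<delta>}))" using T by simp
    qed simp
  next
    case False
    then obtain u v where uv: "u < v" "\<And>t. U \<inter> {x. b \<bullet> x = t} \<noteq> {} \<longleftrightarrow> u < t \<and> t < v"
      using rel_open_projection[OF U ne] by metis
    have "aff_dim (U \<inter> {x. b \<bullet> x = t}) = aff_dim U - 1" if "u < t" "t < v" for t
      using rel_open_slice(2)[OF U(2)] uv(2)[of t] that False by simp
    moreover have pos: "aff_dim (U \<inter> {x. b \<bullet> x = t}) \<ge> 0" if "u < t" "t < v" for t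
      using that uv(2)[of t] by (metis aff_dim_negative_iff linorder_not_le)
    ultimately have nd: "nat (aff_dim U) = Suc (nat (aff_dim (U \<inter> {x. b \<bullet> x = t})))" if "u < t" "t < v" for t
      using that by (metis Suc_nat_eq_nat_zadd1 add.commute diff_add_cancel)
    have slice: "convex_euler (U \<inter> {x. b \<bullet> x = t}) = (if u < t \<and> t < v then - convex_euler U else 0)" for t
      using uv(2)[of t] nd[of t] ne by (auto simp: convex_euler_def)
    show thesis
    proof (rule that[of "{u, v}"])
      fix T :: "real set" and \<delta> :: real
      assume T: "finite T" "{u, v} \<subseteq> T" "0 < \<delta>"
        and gap: "\<And>s t. s \<in> T \<Longrightarrow> t \<in> T \<Longrightarrow> s < t \<Longrightarrow> s + \<delta> < t"
      \<comment> \<open>So only \<open>u\<close> contributes a jump: its own slice is empty, while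
        the slice at \<open>u + \<delta>\<close> has Euler characteristic
        \<open>- convex_euler U\<close>. At \<open>v\<close> both slices are empty, and at any other
        breakpoint both have the same value.\<close>
      have "u < t + \<delta> \<longleftrightarrow> u \<le> t" "t + \<delta> < v \<longleftrightarrow> t < v" if "t \<in> T" for t
        using gap[of t u] gap[of t v] that T by (cases "t < u"; cases "t < v"; auto)+
      then have "(\<Sum>t\<in>T. convex_euler (U \<inter> {x. b \<bullet> x = t}) - convex_euler (U \<inter> {x. b \<bullet> x = t + \<delta>}))
          = (\<Sum>t\<in>T. if t = u then convex_euler U else 0)"
        using uv(1) by (intro sum.cong refl) (auto simp: slice)
      then show "convex_euler U = (\<Sum>t\<in>T. convex_euler (U \<inter> {x. b \<bullet> x = t}) -
          convex_euler (U \<inter> {x. b \<bullet> x = t + \<delta>}))" using T by simp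
    qed simp
  qed
qed

lemma finite_gap:
  fixes T :: "real set"
  assumes "finite T"
  obtains \<delta> where "0 < \<delta>" "\<And>s t. s \<in> T \<Longrightarrow> t \<in> T \<Longrightarrow> s < t \<Longrightarrow> s + \<delta> < t"
proof -
  define G where "G = insert 1 ((\<lambda>(s, t). t - s) ` {(s, t). s \<in> T \<and> t \<in> T \<and> s < t})"
  have "finite {(s, t). s \<in> T \<and> t \<in> T \<and> s < t}"
    by (rule finite_subset[of _ "T \<times> T"]) (use assms in auto)
  then have fin: "finite G" unfolding G_def by simp
  have pos: "0 < Min G" using fin by (subst Min_gr_iff) (auto simp: G_def)
  show thesis
  proof (rule that[of "Min G / 2"])
    fix s t assume "s \<in> T" "t \<in> T" "s < t"
    then have "Min G \<le> t - s" using fin by (intro Min_le) (auto simp: G_def)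
    then show "s + Min G / 2 < t" using pos by simp
  qed (use pos in simp)
qed

text \<open>Induction on the set \<open>D\<close> of coordinates that may vary; the others are
  frozen at the values \<open>c\<close>. A linear relation between indicators restricts to every
  slice, a slice freezes one more coordinate, and the slices determine the Euler characteristics.
  With nothing left to vary, each set is empty or one common point.\<close>

lemma convex_euler_valuation_aux:
  fixes U :: "'i \<Rightarrow> 'a::euclidean_space set"
  assumes "finite D" "D \<subseteq> Basis" "finite I"
    and "\<And>i. i \<in> I \<Longrightarrow> convex (U i) \<and> rel_open (U i) \<and> bounded (U i)"
    and "\<And>x. (\<Sum>i\<in>I. a i * indicator (U i) x) = 0"
    and "\<And>i x b. i \<in> I \<Longrightarrow> x \<in> U i \<Longrightarrow> b \<in> Basis - D \<Longrightarrow> b \<bullet> x = c b"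
  shows "(\<Sum>i\<in>I. a i * convex_euler (U i)) = 0"
  using assms
proof (induction D arbitrary: U c rule: finite_induct)
  case empty
  define p :: 'a where "p = (\<Sum>b\<in>Basis. c b *\<^sub>R b)"
  have "x = p" if "i \<in> I" "x \<in> U i" for i x
  proof (rule euclidean_eqI)
    fix b :: 'a assume "b \<in> Basis"
    then show "x \<bullet> b = p \<bullet> b"
      using empty.prems(5)[OF that, of b] by (simp add: p_def inner_commute[of x b])
  qed
  then have "U i = {} \<or> U i = {p}" if "i \<in> I" for i using that by blast
  then have "convex_euler (U i) = indicator (U i) p" if "i \<in> I" for i
    using that by (fastforce simp: convex_euler_def)
  then show ?case using empty.prems(4)[of p] by simp
next
  case (insert b D)
  note U = insert.prems(3)
  define splits where "splits i T0 \<longleftrightarrow> finite T0 \<and> (\<forall>T \<delta>. finite T \<longrightarrow> T0 \<subseteq> T \<longrightarrow> 0 < \<delta> \<longrightarrow>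
      (\<forall>s t. s \<in> T \<longrightarrow> t \<in> T \<longrightarrow> s < t \<longrightarrow> s + \<delta> < t) \<longrightarrow>
      convex_euler (U i) = (\<Sum>t\<in>T. convex_euler (U i \<inter> {x. b \<bullet> x = t}) -
        convex_euler (U i \<inter> {x. b \<bullet> x = t + \<delta>})))" for i T0
  have "\<exists>T0. splits i T0" if "i \<in> I" for i
  proof -
    have *: "convex (U i)" "rel_open (U i)" "bounded (U i)" using U that by auto
    show ?thesis unfolding splits_def
      by (rule convex_euler_slices[OF *, of b], rule exI, rule conjI, assumption) simp
  qed
  then obtain T0 where T0: "\<And>i. i \<in> I \<Longrightarrow> splits i (T0 i)" by metis
  \<comment> \<open>One set of breakpoints and one \<open>\<delta>\<close> for all
    \<open>U i\<close>, so that the slice formulas can be added up over \<open>i\<close> term by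
    term.\<close>
  define T where "T = (\<Union>i\<in>I. T0 i)"
  have finT: "finite T" unfolding T_def using T0 insert.prems(2) unfolding splits_def by blast
  obtain \<delta> where \<delta>: "0 < \<delta>" "\<And>s t. s \<in> T \<Longrightarrow> t \<in> T \<Longrightarrow> s < t \<Longrightarrow> s + \<delta> < t"
    using finite_gap[OF finT] by blast
  have slice: "(\<Sum>i\<in>I. a i * convex_euler (U i \<inter> {x. b \<bullet> x = t})) = 0" for t
  proof (rule insert.IH[where c = "c(b := t)"])
    show "D \<subseteq> Basis" "finite I" using insert.prems by auto
    show "convex (U i \<inter> {x. b \<bullet> x = t}) \<and> rel_open (U i \<inter> {x. b \<bullet> x = t}) \<and>
        bounded (U i \<inter> {x. b \<bullet> x = t})" if "i \<in> I" for i
    proof (intro conjI)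
      show "convex (U i \<inter> {x. b \<bullet> x = t})" using U[OF that] by (intro convex_Int convex_hyperplane) auto
      show "bounded (U i \<inter> {x. b \<bullet> x = t})" using U[OF that] by (intro bounded_Int) auto
      show "rel_open (U i \<inter> {x. b \<bullet> x = t})"
        using rel_open_slice(1)[of "U i" b t] U[OF that]
        by (cases "U i \<inter> {x. b \<bullet> x = t} = {}") (simp_all add: rel_open_def)
    qed
    show "(\<Sum>i\<in>I. a i * indicator (U i \<inter> {x. b \<bullet> x = t}) x) = 0" for x
      using insert.prems(4)[of x] by (cases "b \<bullet> x = t") (simp_all add: indicator_def)
    show "b' \<bullet> x = (c(b := t)) b'" if "i \<in> I" "x \<in> U i \<inter> {x. b \<bullet> x = t}" "b' \<in> Basis - D" for i x b'
      using that insert.prems(5)[of i x b'] by auto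
  qed
  have "(\<Sum>i\<in>I. a i * convex_euler (U i)) = (\<Sum>i\<in>I. a i * (\<Sum>t\<in>T. convex_euler (U i \<inter> {x. b \<bullet> x = t}) -
        convex_euler (U i \<inter> {x. b \<bullet> x = t + \<delta>})))"
  proof (intro sum.cong refl arg_cong2[where f = "(*)"])
    fix i assume "i \<in> I"
    then have "T0 i \<subseteq> T" by (auto simp: T_def)
    then show "convex_euler (U i) = (\<Sum>t\<in>T. convex_euler (U i \<inter> {x. b \<bullet> x = t}) -
        convex_euler (U i \<inter> {x. b \<bullet> x = t + \<delta>}))"
      using T0[OF \<open>i \<in> I\<close>] finT \<delta> unfolding splits_def by simp
  qed
  also have "\<dots> = (\<Sum>t\<in>T. (\<Sum>i\<in>I. a i * convex_euler (U i \<inter> {x. b \<bullet> x = t})) -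
      (\<Sum>i\<in>I. a i * convex_euler (U i \<inter> {x. b \<bullet> x = t + \<delta>})))"
    by (simp add: sum_distrib_left right_diff_distrib sum_subtractf[symmetric] sum.swap[of _ T])
  also have "\<dots> = 0" by (simp add: slice)
  finally show ?case .
qed

lemma convex_euler_valuation:
  fixes U :: "'i \<Rightarrow> 'a::euclidean_space set"
  assumes "finite I"
    and "\<And>i. i \<in> I \<Longrightarrow> convex (U i) \<and> rel_open (U i) \<and> bounded (U i)"
    and "\<And>x. (\<Sum>i\<in>I. a i * indicator (U i) x) = 0"
  shows "(\<Sum>i\<in>I. a i * convex_euler (U i)) = 0"
  by (rule convex_euler_valuation_aux[of Basis I U a]) (use assms in auto)

subsection \<open>Polyhedral subdivisions\<close>

text \<open>The smallest face containing \<open>x\<close> works: if \<open>x\<close> were on its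
  relative frontier, a facet of it would be a smaller face containing \<open>x\<close>.\<close>

lemma polytope_point_in_face_rel_interior:
  fixes R :: "'a::euclidean_space set"
  assumes R: "polytope R" and x: "x \<in> R"
  obtains F where "F face_of R" "x \<in> rel_interior F"
proof -
  define F where "F = \<Inter>{T. T face_of R \<and> x \<in> T}"
  have FR: "F face_of R" unfolding F_def
    using x face_of_refl[OF polytope_imp_convex[OF R]] by (intro face_of_Inter) auto
  have xF: "x \<in> F" unfolding F_def by blast
  have poly: "polytope F" using face_of_polytope_polytope[OF R FR] .
  have "x \<in> rel_interior F"
  proof (rule ccontr)
    assume "x \<notin> rel_interior F"
    then have "x \<in> rel_frontier F" using xF closure_subset by (auto simp: rel_frontier_def)
    then obtain G where G: "G facet_of F" "x \<in> G"
      using rel_frontier_of_polyhedron[OF polytope_imp_polyhedron[OF poly]] by blast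
    have GF: "G face_of F" using G(1) by (rule facet_of_imp_face_of)
    have "F \<subseteq> G" using face_of_trans[OF GF FR] G(2) unfolding F_def by blast
    then have "G = F" using face_of_imp_subset[OF GF] by blast
    then show False using G(1) facet_of_irrefl by blast
  qed
  then show thesis using that FR by blast
qed

lemma finite_interior_faces:
  assumes "polyhedral_subdivision P \<S>"
  shows "finite (interior_faces P \<S>)"
proof (rule finite_subset)
  show "interior_faces P \<S> \<subseteq> (\<Union>R\<in>\<S>. {Q. Q face_of R})" by (auto simp: interior_faces_def)
  show "finite (\<Union>R\<in>\<S>. {Q. Q face_of R})"
    using assms unfolding polyhedral_subdivision_def by (auto intro: finite_polytope_faces)
qed

lemma interior_faces_polytope:
  assumes "polyhedral_subdivision P \<S>" "Q \<in> interior_faces P \<S>"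
  shows "polytope Q" "Q \<subseteq> P" "Q \<noteq> {}"
  using assms face_of_polytope_polytope face_of_imp_subset
  unfolding polyhedral_subdivision_def interior_faces_def by blast+

text \<open>The relative interior of \<open>Q\<close> meets the face \<open>R \<inter> R'\<close> of
  \<open>R\<close>, so all of \<open>Q\<close> lies in it. Hence \<open>Q\<close> is a face of
  \<open>R'\<close> as well, and faces of one polytope with meeting relative interiors
  coincide.\<close>

lemma interior_faces_rel_interior_disjoint:
  assumes sub: "polyhedral_subdivision P \<S>"
    and Q: "Q \<in> interior_faces P \<S>" "Q' \<in> interior_faces P \<S>"
    and x: "x \<in> rel_interior Q" "x \<in> rel_interior Q'"
  shows "Q = Q'"
proof -
  obtain R R' where R: "R \<in> \<S>" "Q face_of R" "R' \<in> \<S>" "Q' face_of R'"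
    using Q unfolding interior_faces_def by blast
  have RR: "R \<inter> R' face_of R" "R \<inter> R' face_of R'"
    using sub R unfolding polyhedral_subdivision_def by blast+
  have "x \<in> R \<inter> R'"
    using x R face_of_imp_subset rel_interior_subset by blast
  then have "Q \<subseteq> R \<inter> R'"
    using subset_of_face_of[OF RR(1) face_of_imp_subset[OF R(2)]] x(1) by blast
  then have "Q face_of R \<inter> R'" using face_of_subset[OF R(2)] by blast
  then have "Q face_of R'" using face_of_trans[OF _ RR(2)] by blast
  then show ?thesis using face_of_eq[OF _ R(4)] x by blast
qed

text \<open>A point of the relative interior of \<open>P\<close> lies in the relative interior of a
  face of some cell, and this face cannot be contained in the relative frontier. Conversely, a
  convex subset of \<open>P\<close> not contained in the relative frontier has its relative interior
  inside that of \<open>P\<close>.\<close>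

lemma rel_interior_subdivision:
  assumes sub: "polyhedral_subdivision P \<S>" and P: "convex P" "closed P"
  shows "rel_interior P = (\<Union>Q\<in>interior_faces P \<S>. rel_interior Q)"
proof (intro equalityI subsetI)
  fix x assume x: "x \<in> rel_interior P"
  then have "x \<in> P" using rel_interior_subset by blast
  then obtain R where R: "R \<in> \<S>" "x \<in> R" "polytope R"
    using sub unfolding polyhedral_subdivision_def by blast
  obtain F where F: "F face_of R" "x \<in> rel_interior F"
    using polytope_point_in_face_rel_interior[OF R(3,2)] .
  have "x \<in> F" using F(2) rel_interior_subset by blast
  then have "\<not> F \<subseteq> rel_frontier P" using x by (auto simp: rel_frontier_def)
  then have "F \<in> interior_faces P \<S>" using F R \<open>x \<in> F\<close> by (auto simp: interior_faces_def)
  then show "x \<in> (\<Union>Q\<in>interior_faces P \<S>. rel_interior Q)" using F(2) by blast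
next
  fix x assume "x \<in> (\<Union>Q\<in>interior_faces P \<S>. rel_interior Q)"
  then obtain Q where Q: "Q \<in> interior_faces P \<S>" "x \<in> rel_interior Q" by blast
  have "\<not> Q \<subseteq> rel_frontier P" using Q(1) unfolding interior_faces_def by blast
  then have "rel_interior Q \<subseteq> rel_interior P"
    using subset_rel_interior_convex[of Q P] interior_faces_polytope[OF sub Q(1)] P
      polytope_imp_convex by (metis closure_closed)
  then show "x \<in> rel_interior P" using Q(2) by blast
qed

text \<open>The finitely many \<open>Q\<close> that miss \<open>K\<close> have positive distance
  from it, so a sufficiently small open neighbourhood of \<open>K\<close> misses them too.\<close>

lemma compact_open_neighbourhood_same_hits:
  fixes K :: "'a::euclidean_space set"
  assumes "finite \<F>" "\<And>Q. Q \<in> \<F> \<Longrightarrow> compact Q" and K: "compact K" "convex K"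
  obtains V where "open V" "convex V" "\<And>Q. Q \<in> \<F> \<Longrightarrow> Q \<inter> V \<noteq> {} \<longleftrightarrow> Q \<inter> K \<noteq> {}"
proof -
  have "\<exists>\<epsilon>>0. \<forall>Q\<in>\<F>. Q \<inter> K = {} \<longrightarrow> (\<forall>x\<in>Q. \<forall>y\<in>K. \<epsilon> \<le> dist x y)"
    using assms(1,2)
  proof (induction \<F> rule: finite_induct)
    case empty
    then show ?case by (auto intro: exI[of _ 1])
  next
    case (insert Q \<F>)
    obtain e where e: "e > 0" "\<forall>Q\<in>\<F>. Q \<inter> K = {} \<longrightarrow> (\<forall>x\<in>Q. \<forall>y\<in>K. e \<le> dist x y)"
      using insert by blast
    have "\<exists>e'>0. Q \<inter> K = {} \<longrightarrow> (\<forall>x\<in>Q. \<forall>y\<in>K. e' \<le> dist x y)"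
      using separate_compact_closed[of Q K] insert.prems compact_imp_closed[OF K(1)] zero_less_one
      by (metis insertI1)
    then obtain e' where e': "e' > 0" "Q \<inter> K = {} \<longrightarrow> (\<forall>x\<in>Q. \<forall>y\<in>K. e' \<le> dist x y)"
      by blast
    show ?case
      by (rule exI[of _ "min e e'"]) (use e e' in \<open>auto simp: min_le_iff_disj\<close>)
  qed
  then obtain \<epsilon> where \<epsilon>: "\<epsilon> > 0" "\<And>Q x y. Q \<in> \<F> \<Longrightarrow> Q \<inter> K = {} \<Longrightarrow> x \<in> Q \<Longrightarrow> y \<in> K \<Longrightarrow> \<epsilon> \<le> dist x y"
    by metis
  define V where "V = (\<Union>x\<in>K. \<Union>y\<in>ball 0 \<epsilon>. {x + y})"
  show thesis
  proof
    show "open V" unfolding V_def by (rule open_sums) simp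
    show "convex V" unfolding V_def by (intro convex_sums K convex_ball)
    show "Q \<inter> V \<noteq> {} \<longleftrightarrow> Q \<inter> K \<noteq> {}" if Q: "Q \<in> \<F>" for Q
    proof
      assume "Q \<inter> K \<noteq> {}"
      then obtain x where "x \<in> Q" "x \<in> K" by blast
      moreover have "x + 0 \<in> V" using \<open>x \<in> K\<close> \<epsilon>(1) unfolding V_def by (metis UN_I centre_in_ball singletonI)
      ultimately show "Q \<inter> V \<noteq> {}" by auto
    next
      assume "Q \<inter> V \<noteq> {}"
      then obtain x y where xy: "x \<in> K" "norm y < \<epsilon>" "x + y \<in> Q" unfolding V_def by auto
      then have "dist (x + y) x < \<epsilon>" by (simp add: dist_norm)
      then show "Q \<inter> K \<noteq> {}" using \<epsilon>(2)[OF Q _ xy(3,1)] by fastforce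
    qed
  qed
qed

text \<open>The reason for thickening: a compact set may touch \<open>Q\<close> only in its relative
  boundary, whereas an open set meeting \<open>Q\<close>, hence the closure of
  \<open>rel_interior Q\<close>, meets \<open>rel_interior Q\<close> itself, and in a piece of full
  dimension.\<close>

lemma rel_interior_Int_open:
  fixes Q :: "'a::euclidean_space set"
  assumes Q: "convex Q" and V: "open V" "convex V"
  shows "convex (rel_interior Q \<inter> V)" "rel_open (rel_interior Q \<inter> V)"
    "rel_interior Q \<inter> V = {} \<longleftrightarrow> Q \<inter> V = {}"
    "Q \<inter> V \<noteq> {} \<Longrightarrow> aff_dim (rel_interior Q \<inter> V) = aff_dim Q"
proof -
  show "convex (rel_interior Q \<inter> V)" by (intro convex_Int convex_rel_interior Q V)
  have op: "openin (top_of_set (affine hull Q)) (rel_interior Q \<inter> V)"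
    using openin_rel_interior V(1) by (rule openin_Int_open)
  show eq: "rel_interior Q \<inter> V = {} \<longleftrightarrow> Q \<inter> V = {}"
    using open_Int_closure_eq_empty[OF V(1), of "rel_interior Q"] open_Int_closure_eq_empty[OF V(1), of Q]
      convex_closure_rel_interior[OF Q] by (metis Int_commute)
  show "rel_open (rel_interior Q \<inter> V)"
  proof (cases "rel_interior Q \<inter> V = {}")
    case True
    then show ?thesis by (simp add: rel_open_def)
  next
    case False
    then have "affine hull (rel_interior Q \<inter> V) = affine hull Q" by (rule affine_hull_openin[OF op])
    then show ?thesis using op by (simp add: rel_open)
  qed
  show "aff_dim (rel_interior Q \<inter> V) = aff_dim Q" if "Q \<inter> V \<noteq> {}"
    using aff_dim_openin[OF op affine_affine_hull] that eq by simp
qed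

lemma subdivision_hits_compact_convex:
  assumes sub: "polyhedral_subdivision P \<S>" and P: "polytope P" and K: "compact K" "convex K"
  shows "(if P \<inter> K \<noteq> {} then 1 else (0::real)) =
    (\<Sum>Q\<in>interior_faces P \<S>. (-1) ^ nat (aff_dim P - aff_dim Q) * (if Q \<inter> K \<noteq> {} then 1 else 0))"
proof -
  let ?\<F> = "interior_faces P \<S>"
  have fin: "finite ?\<F>" by (rule finite_interior_faces[OF sub])
  have poly: "polytope Q" if "Q \<in> insert P ?\<F>" for Q
    using that P interior_faces_polytope[OF sub] by blast
  obtain V where V: "open V" "convex V" "\<And>Q. Q \<in> insert P ?\<F> \<Longrightarrow> Q \<inter> V \<noteq> {} \<longleftrightarrow> Q \<inter> K \<noteq> {}"
    using compact_open_neighbourhood_same_hits[of "insert P ?\<F>" K] fin poly polytope_imp_compact K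
    by (metis finite_insert)
  \<comment> \<open>The index \<open>None\<close> stands for \<open>P\<close>, with weight -1, and
    \<open>Some Q\<close> for the interior face \<open>Q\<close>, with weight 1, so that the
    decomposition of the relative interior becomes a linear relation with sum zero.\<close>
  define U where "U j = (case j of None \<Rightarrow> rel_interior P \<inter> V | Some Q \<Rightarrow> rel_interior Q \<inter> V)" for j
  define a :: "'a set option \<Rightarrow> real" where "a j = (case j of None \<Rightarrow> -1 | Some _ \<Rightarrow> 1)" for j
  have sum_split: "(\<Sum>j\<in>insert None (Some ` ?\<F>). a j * f j) = - f None + (\<Sum>Q\<in>?\<F>. f (Some Q))" for f
    using fin by (simp add: a_def sum.reindex)
  have "(\<Sum>j\<in>insert None (Some ` ?\<F>). a j * convex_euler (U j)) = 0"
  proof (rule convex_euler_valuation)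
    show "finite (insert None (Some ` ?\<F>))" using fin by simp
    show "convex (U j) \<and> rel_open (U j) \<and> bounded (U j)" if j: "j \<in> insert None (Some ` ?\<F>)" for j
    proof -
      from j have "j = None \<or> (\<exists>Q\<in>?\<F>. j = Some Q)" by blast
      then have "\<exists>Q\<in>insert P ?\<F>. U j = rel_interior Q \<inter> V"
      proof
        assume "j = None"
        then show ?thesis by (intro bexI[of _ P]) (simp_all add: U_def)
      next
        assume "\<exists>Q\<in>?\<F>. j = Some Q"
        then obtain Q where "Q \<in> ?\<F>" "j = Some Q" by blast
        then show ?thesis by (intro bexI[of _ Q]) (simp_all add: U_def)
      qed
      then obtain Q where Q: "Q \<in> insert P ?\<F>" "U j = rel_interior Q \<inter> V" by blast
      have "bounded (rel_interior Q)"
        using polytope_imp_bounded[OF poly[OF Q(1)]] rel_interior_subset by (rule bounded_subset)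
      then have "bounded (U j)" unfolding Q(2) by (rule bounded_subset) blast
      then show ?thesis
        using rel_interior_Int_open(1,2)[OF polytope_imp_convex[OF poly[OF Q(1)]] V(1,2)] Q(2) by simp
    qed
    show "(\<Sum>j\<in>insert None (Some ` ?\<F>). a j * indicator (U j) x) = 0" for x
    proof -
      have "(\<Sum>Q\<in>?\<F>. indicator (rel_interior Q) x) = (indicator (\<Union>Q\<in>?\<F>. rel_interior Q) x :: real)"
        by (rule indicator_UN_disjoint[symmetric, OF fin])
          (use interior_faces_rel_interior_disjoint[OF sub] in \<open>auto simp: disjoint_family_on_def\<close>)
      also have "\<dots> = indicator (rel_interior P) x"
        using rel_interior_subdivision[OF sub polytope_imp_convex[OF P] polytope_imp_closed[OF P]] by simp
      finally have "(\<Sum>Q\<in>?\<F>. indicator (rel_interior Q) x * indicator V x) =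
          (indicator (rel_interior P) x * indicator V x :: real)"
        by (simp add: sum_distrib_right[symmetric])
      then show ?thesis by (simp add: sum_split U_def indicator_inter_arith)
    qed
  qed
  then have main: "convex_euler (rel_interior P \<inter> V) = (\<Sum>Q\<in>?\<F>. convex_euler (rel_interior Q \<inter> V))"
    by (simp add: sum_split U_def)
  have eu: "convex_euler (rel_interior Q \<inter> V) = (-1) ^ nat (aff_dim Q) * (if Q \<inter> K \<noteq> {} then 1 else 0)"
    if Q: "Q \<in> insert P ?\<F>" for Q
  proof -
    note ri = rel_interior_Int_open(3,4)[OF polytope_imp_convex[OF poly[OF Q]] V(1,2)]
    show ?thesis
    proof (cases "Q \<inter> K = {}")
      case True
      then have "rel_interior Q \<inter> V = {}" using V(3)[OF Q] ri(1) by simp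
      then show ?thesis using True by (simp add: convex_euler_def)
    next
      case False
      then have "Q \<inter> V \<noteq> {}" using V(3)[OF Q] by simp
      then show ?thesis using False ri unfolding convex_euler_def by simp
    qed
  qed
  \<comment> \<open>Both sides of \<open>main\<close> carry signs given by dimensions; multiplying
    by the sign of \<open>P\<close> clears the left side and leaves the codimension signs on the
    right.\<close>
  have "(if P \<inter> K \<noteq> {} then 1 else (0::real)) =
      (-1) ^ nat (aff_dim P) * ((-1) ^ nat (aff_dim P) * (if P \<inter> K \<noteq> {} then 1 else 0))"
    by (simp add: mult.assoc[symmetric] power_mult_distrib[symmetric])
  also have "\<dots> = (\<Sum>Q\<in>?\<F>. (-1) ^ nat (aff_dim P) * ((-1) ^ nat (aff_dim Q) * (if Q \<inter> K \<noteq> {} then 1 else 0)))"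
    using main eu by (simp add: sum_distrib_left)
  also have "\<dots> = (\<Sum>Q\<in>?\<F>. (-1) ^ nat (aff_dim P - aff_dim Q) * (if Q \<inter> K \<noteq> {} then 1 else 0))"
  proof (rule sum.cong[OF refl])
    fix Q assume Q: "Q \<in> ?\<F>"
    have "0 \<le> aff_dim Q" using interior_faces_polytope(3)[OF sub Q] by (metis aff_dim_negative_iff linorder_not_le)
    moreover have "aff_dim Q \<le> aff_dim P" using interior_faces_polytope(2)[OF sub Q] by (rule aff_dim_subset)
    ultimately have "nat (aff_dim P) = nat (aff_dim P - aff_dim Q) + nat (aff_dim Q)" by simp
    then have "(-1) ^ nat (aff_dim P) * (-1) ^ nat (aff_dim Q) =
        (-1) ^ nat (aff_dim P - aff_dim Q) * ((-1) ^ nat (aff_dim Q) * (-1) ^ nat (aff_dim Q) :: real)"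
      by (simp only: power_add mult.assoc)
    also have "\<dots> = (-1) ^ nat (aff_dim P - aff_dim Q)" by (simp add: power_mult_distrib[symmetric])
    finally show "(-1) ^ nat (aff_dim P) * ((-1) ^ nat (aff_dim Q) * (if Q \<inter> K \<noteq> {} then 1 else (0::real))) =
        (-1) ^ nat (aff_dim P - aff_dim Q) * (if Q \<inter> K \<noteq> {} then 1 else 0)"
      by (simp add: mult.assoc[symmetric])
  qed
  finally show ?thesis .
qed

subsection \<open>Matroid polytopes\<close>

lemma indicator_vec_nth [simp]: "indicator_vec S $ i = (if i \<in> S then 1 else 0)"
proof -
  have "indicator_vec S $ i = (\<Sum>j\<in>S. if j = i then 1 else 0)"
    unfolding indicator_vec_def by (simp add: axis_def eq_commute)
  then show ?thesis by simp
qed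

text \<open>On the unit cube \<open>f\<close> is the l1 distance to \<open>indicator_vec S\<close>,
  yet it is an affine function. It is at least 1 at every other 0/1 vector, hence on the hull of
  such vectors, and 0 at \<open>indicator_vec S\<close>.\<close>

lemma indicator_vec_in_hull:
  assumes "indicator_vec S \<in> matroid_polytope M"
  shows "S \<in> M"
proof (rule ccontr)
  assume "S \<notin> M"
  define f :: "real ^ 'a \<Rightarrow> real" where "f x = (\<Sum>i\<in>UNIV. if i \<in> S then 1 - x $ i else x $ i)" for x
  have pos: "f (indicator_vec B) \<ge> 1" if B: "B \<in> M" for B
  proof -
    have "B \<noteq> S" using B \<open>S \<notin> M\<close> by blast
    then obtain i where i: "(i \<in> S) \<noteq> (i \<in> B)" by blast
    have "(if i \<in> S then 1 - (indicator_vec B :: real^'a) $ i else indicator_vec B $ i) \<le> f (indicator_vec B)"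
      unfolding f_def by (rule member_le_sum) auto
    then show ?thesis using i by (auto split: if_splits)
  qed
  have "convex {x. f x \<ge> 1}"
  proof -
    have eq: "f x = (\<chi> i. if i \<in> S then -1 else 1) \<bullet> x + real (card S)" for x
    proof -
      have "f x = (\<Sum>i\<in>UNIV. (if i \<in> S then -1 else 1) * x $ i + (if i \<in> S then 1 else 0))"
        unfolding f_def by (intro sum.cong) auto
      then show ?thesis by (simp add: sum.distrib inner_vec_def sum.If_cases)
    qed
    have "{x. f x \<ge> 1} = {x. (\<chi> i. if i \<in> S then -1 else 1) \<bullet> x \<ge> 1 - real (card S)}"
      unfolding eq by auto
    then show ?thesis using convex_halfspace_ge by metis
  qed
  then have "matroid_polytope M \<subseteq> {x. f x \<ge> 1}"
    unfolding matroid_polytope_def using pos by (intro hull_minimal) auto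
  moreover have "f (indicator_vec S) = 0" unfolding f_def by (simp add: sum.neutral)
  ultimately show False using assms by auto
qed

lemma matroid_polytope_inj:
  "matroid_polytope M = matroid_polytope N \<Longrightarrow> M = N"
  using indicator_vec_in_hull hull_inc unfolding matroid_polytope_def by (metis image_eqI subsetI subset_antisym)

lemma matroid_of_polytope_eq:
  assumes "matroid M"
  shows "matroid_of_polytope (matroid_polytope M) = M"
  unfolding matroid_of_polytope_def by (rule the_equality) (simp_all add: assms matroid_polytope_inj)

lemma indicator_vec_mem: "B \<in> M \<Longrightarrow> indicator_vec B \<in> matroid_polytope M"
  unfolding matroid_polytope_def by (intro hull_inc) auto

lemma polytope_matroid_polytope: "polytope (matroid_polytope M)"
  unfolding matroid_polytope_def polytope_def by (rule exI[of _ "indicator_vec ` M"]) simp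

text \<open>A symmetric exchange between two bases does not change the midpoint of their indicator
  vectors. A face containing both old vertices contains this midpoint, and therefore also the two
  new vertices.\<close>

lemma face_of_matroid_polytope:
  assumes N: "matroid N" and Q: "Q face_of matroid_polytope N" "Q \<noteq> {}"
  obtains M where "matroid M" "Q = matroid_polytope M" "M \<subseteq> N"
proof -
  have "compact (indicator_vec ` N :: (real ^ 'a) set)" by (simp add: finite_imp_compact)
  then obtain S' where S': "S' \<subseteq> indicator_vec ` N" "Q = convex hull S'"
    using face_of_convex_hull_subset Q(1) unfolding matroid_polytope_def by metis
  define M where "M = {B \<in> N. indicator_vec B \<in> S'}"
  have "S' = indicator_vec ` M" using S'(1) unfolding M_def by blast
  then have QM: "Q = matroid_polytope M" using S'(2) by (simp add: matroid_polytope_def)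
  have "M \<noteq> {}" using Q(2) QM by (auto simp: matroid_polytope_def)
  have "matroid M" unfolding matroid_def
  proof (intro conjI ballI)
    fix A B x assume AB: "A \<in> M" "B \<in> M" "x \<in> A - B"
    then have "A \<in> N" "B \<in> N" by (auto simp: M_def)
    then obtain y where y: "y \<in> B - A" "insert y (A - {x}) \<in> N" "insert x (B - {y}) \<in> N"
      using matroid_symmetric_exchange[OF N _ _ AB(3)] by blast
    let ?A = "insert y (A - {x})" and ?B = "insert x (B - {y})"
    have eq: "midpoint (indicator_vec ?A) (indicator_vec ?B) = (midpoint (indicator_vec A) (indicator_vec B) :: real^'a)"
      using AB(3) y(1) by (auto simp: midpoint_def vec_eq_iff)
    have "convex Q" using QM by (simp add: matroid_polytope_def)
    moreover have "indicator_vec A \<in> Q" "indicator_vec B \<in> Q"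
      using AB indicator_vec_mem QM by blast+
    ultimately have mid: "midpoint (indicator_vec ?A) (indicator_vec ?B) \<in> Q"
      unfolding eq by (meson closed_segment_subset midpoint_in_closed_segment subsetD)
    have "indicator_vec ?A \<in> Q"
    proof (cases "indicator_vec ?A = (indicator_vec ?B :: real^'a)")
      case True
      then show ?thesis using mid by (simp add: midpoint_def)
    next
      case False
      then have "midpoint (indicator_vec ?A) (indicator_vec ?B) \<in> open_segment (indicator_vec ?A) (indicator_vec ?B :: real^'a)"
        by simp
      then show ?thesis using Q(1) mid indicator_vec_mem[OF y(2)] indicator_vec_mem[OF y(3)]
        unfolding face_of_def by blast
    qed
    then have "?A \<in> M" using indicator_vec_in_hull QM by blast
    then show "\<exists>y\<in>B - A. insert y (A - {x}) \<in> M" using y(1) by blast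
  qed fact
  then show thesis using that QM M_def by blast
qed

lemma matroid_polytope_nth_bounds:
  assumes "x \<in> matroid_polytope M"
  shows "0 \<le> x $ i" "x $ i \<le> 1"
proof -
  have "matroid_polytope M \<subseteq> {x. axis i 1 \<bullet> x \<ge> 0} \<inter> {x. axis i 1 \<bullet> x \<le> 1}"
    unfolding matroid_polytope_def
    by (intro hull_minimal convex_Int convex_halfspace_ge convex_halfspace_le) (auto simp: inner_axis')
  then show "0 \<le> x $ i" "x $ i \<le> 1" using assms by (auto simp: inner_axis')
qed

lemma matroid_polytope_sum:
  assumes "\<And>B. B \<in> M \<Longrightarrow> card B = r" "x \<in> matroid_polytope M"
  shows "(\<Sum>i\<in>UNIV. x $ i) = real r"
proof -
  have eq: "(\<Sum>i\<in>UNIV. x $ i) = 1 \<bullet> x" for x :: "real ^ 'a" by (simp add: inner_vec_def)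
  have "matroid_polytope M \<subseteq> {x. 1 \<bullet> x = real r}"
    unfolding matroid_polytope_def using assms(1)
    by (intro hull_minimal convex_hyperplane) (auto simp: eq[symmetric] sum.If_cases)
  then show ?thesis using assms(2) eq by auto
qed

text \<open>A loop \<open>i\<close> of \<open>N\<close> would put \<open>Q\<close> into the face
  \<open>x $ i = 0\<close> of the polytope of \<open>M\<close>. This face is proper because
  \<open>M\<close> has no loops, so \<open>Q\<close> would lie in the relative frontier. The ranks
  agree since bases of \<open>N\<close> are bases of \<open>M\<close>.\<close>

lemma interior_face_matroid:
  assumes M: "matroid M" "loopless M" and sub: "matroid_subdivision M \<S>"
    and Q: "Q \<in> interior_faces (matroid_polytope M) \<S>"
  obtains N where "matroid N" "loopless N" "Q = matroid_polytope N" "matroid_of_polytope Q = N"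
    "top_degree N = top_degree M"
proof -
  have poly: "polyhedral_subdivision (matroid_polytope M) \<S>"
    using sub unfolding matroid_subdivision_def by blast
  obtain R where R: "R \<in> \<S>" "Q face_of R" using Q unfolding interior_faces_def by blast
  obtain N' where N': "matroid N'" "R = matroid_polytope N'" using sub R unfolding matroid_subdivision_def by blast
  have Qne: "Q \<noteq> {}" "\<not> Q \<subseteq> rel_frontier (matroid_polytope M)" using Q unfolding interior_faces_def by auto
  obtain N where N: "matroid N" "Q = matroid_polytope N"
    using face_of_matroid_polytope[OF N'(1)] R(2) N'(2) Qne(1) by metis
  have QP: "Q \<subseteq> matroid_polytope M" using interior_faces_polytope(2)[OF poly Q] .
  have NM: "N \<subseteq> M" using N(2) QP indicator_vec_mem indicator_vec_in_hull by blast
  have "loopless N" unfolding loopless_iff[OF N(1)]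
  proof (rule ccontr)
    assume "\<not> (\<forall>i. \<exists>B\<in>N. i \<in> B)"
    then obtain i where i: "\<And>B. B \<in> N \<Longrightarrow> i \<notin> B" by blast
    let ?F = "matroid_polytope M \<inter> {x. axis i 1 \<bullet> x = 0}"
    have "?F face_of matroid_polytope M"
      by (rule face_of_Int_supporting_hyperplane_ge)
        (use matroid_polytope_nth_bounds in \<open>auto simp: inner_axis' matroid_polytope_def\<close>)
    moreover obtain B where "B \<in> M" "i \<in> B" using M loopless_iff[OF M(1)] by blast
    then have "indicator_vec B \<in> matroid_polytope M" "indicator_vec B \<notin> ?F"
      using indicator_vec_mem[of B M] by (simp_all add: inner_axis')
    then have "?F \<noteq> matroid_polytope M" by blast
    ultimately have "?F \<subseteq> rel_frontier (matroid_polytope M)" by (rule face_of_subset_rel_frontier)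
    moreover have "matroid_polytope N \<subseteq> {x. axis i 1 \<bullet> x = 0}"
      unfolding matroid_polytope_def[of N]
      by (intro hull_minimal convex_hyperplane) (use i in \<open>auto simp: inner_axis'\<close>)
    ultimately show False using Qne(2) QP N(2) by blast
  qed
  moreover have "matroid_of_polytope Q = N" using matroid_of_polytope_eq N by blast
  moreover have "top_degree N = top_degree M"
  proof -
    obtain B where "B \<in> N" using N(1) unfolding matroid_def by (meson ex_in_conv)
    then have "rank_of N UNIV = rank_of M UNIV"
      using rank_of_UNIV[OF N(1)] rank_of_UNIV[OF M(1)] NM by (metis subsetD)
    then show ?thesis by (simp add: top_degree_def)
  qed
  ultimately show thesis using that N by blast
qed

subsection \<open>Functionals and substitutions on polynomials\<close>

abbreviation lookup where "lookup \<equiv> Poly_Mapping.lookup"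
abbreviation keys where "keys \<equiv> Poly_Mapping.keys"
abbreviation single where "single \<equiv> Poly_Mapping.single"

definition monomial :: "('v \<Rightarrow>\<^sub>0 nat) \<Rightarrow> ('v, real) mpoly" where
  "monomial m = single m 1"

lemma monomial_add: "monomial (m + k) = monomial m * monomial k"
  by (simp add: monomial_def mult_single)

lemma monomial_0 [simp]: "monomial 0 = 1"
  by (simp add: monomial_def)

lemma var_eq_monomial: "var v = monomial (single v 1)"
  by (simp add: var_def monomial_def)

lemma const_mult_monomial: "const c * monomial m = single m c"
  by (simp add: const_def monomial_def mult_single)

lemma const_0 [simp]: "const 0 = 0" and const_1 [simp]: "const 1 = 1"
  by (simp_all add: const_def)

lemma const_mult: "const (a * b) = const a * (const b :: ('v, 'a::comm_semiring_1) mpoly)"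
  by (simp add: const_def mult_single)

lemma lookup_const_mult: "lookup (const c * p) m = c * lookup p m"
  by (simp add: const_def mult_map_scale_conv_mult[symmetric] Poly_Mapping.map.rep_eq when_def)

lemma poly_mapping_eq_sum_single:
  fixes p :: "'a \<Rightarrow>\<^sub>0 'b::comm_monoid_add"
  shows "p = (\<Sum>m\<in>keys p. single m (lookup p m))"
proof (rule poly_mapping_eqI)
  fix k
  have "lookup (\<Sum>m\<in>keys p. single m (lookup p m)) k = (\<Sum>m\<in>keys p. if m = k then lookup p m else 0)"
    by (simp add: lookup_sum lookup_single when_def)
  then show "lookup p k = lookup (\<Sum>m\<in>keys p. single m (lookup p m)) k" by (simp add: in_keys_iff)
qed

lemma mpoly_sum_monomials:
  "p = (\<Sum>m\<in>keys p. const (lookup p m) * monomial m)"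
  using poly_mapping_eq_sum_single[of p] by (simp add: const_mult_monomial)

lemma mpoly_induct [case_names single add]:
  assumes single: "\<And>m c. P (single m c :: ('v, real) mpoly)" and add: "\<And>p q. P p \<Longrightarrow> P q \<Longrightarrow> P (p + q)"
  shows "P p"
proof -
  have "P (\<Sum>m\<in>A. const (lookup p m) * monomial m)" if "finite A" for A
    using that
  proof (induction A rule: finite_induct)
    case empty
    then show ?case using single[of 0 0] by simp
  next
    case (insert m A)
    then show ?case using single add by (simp add: const_mult_monomial)
  qed
  then show ?thesis using mpoly_sum_monomials[of p] by (metis finite_keys)
qed

lemma monomial_split:
  assumes "F \<in> keys m"
  shows "m = (m - single F 1) + single F (1::nat)"
  by (rule poly_mapping_eqI) (use assms in \<open>auto simp: lookup_add lookup_minus lookup_single when_def in_keys_iff\<close>)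

lemma monomial_squarefree:
  fixes m :: "'v \<Rightarrow>\<^sub>0 nat"
  assumes "\<And>F. F \<in> keys m \<Longrightarrow> lookup m F = 1"
  shows "monomial m = (\<Prod>F\<in>keys m. var F)"
proof -
  have "monomial (\<Sum>F\<in>A. single F 1) = (\<Prod>F\<in>A. var F)" for A :: "'v set"
    by (induction A rule: infinite_finite_induct) (simp_all add: monomial_add var_eq_monomial)
  moreover have "m = (\<Sum>F\<in>keys m. single F 1)"
    by (rule poly_mapping_eqI) (use assms in \<open>auto simp: lookup_sum lookup_single when_def in_keys_iff\<close>)
  ultimately show ?thesis by metis
qed

section \<open>Linear functionals given on monomials, and their radicals\<close>

definition monomial_functional :: "(('v \<Rightarrow>\<^sub>0 nat) \<Rightarrow> real) \<Rightarrow> ('v, real) mpoly \<Rightarrow> real" where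
  "monomial_functional f p = (\<Sum>m\<in>keys p. lookup p m * f m)"

lemma monomial_functional_superset:
  assumes "finite A" "keys p \<subseteq> A"
  shows "monomial_functional f p = (\<Sum>m\<in>A. lookup p m * f m)"
  unfolding monomial_functional_def
  by (rule sum.mono_neutral_left) (use assms in \<open>auto simp: in_keys_iff\<close>)

lemma monomial_functional_0 [simp]: "monomial_functional f 0 = 0"
  by (simp add: monomial_functional_def)

lemma monomial_functional_add:
  "monomial_functional f (p + q) = monomial_functional f p + monomial_functional f q"
proof -
  let ?A = "keys p \<union> keys q"
  have "keys (p + q) \<subseteq> ?A" by (rule Poly_Mapping.keys_add)
  then show ?thesis
    using monomial_functional_superset[of ?A "p + q" f] monomial_functional_superset[of ?A p f]
      monomial_functional_superset[of ?A q f]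
    by (simp add: lookup_add sum.distrib distrib_right)
qed

lemma monomial_functional_single [simp]: "monomial_functional f (single m c) = c * f m"
  by (simp add: monomial_functional_def)

lemma monomial_functional_monomial [simp]: "monomial_functional f (monomial m) = f m"
  by (simp add: monomial_def)

lemma monomial_functional_const_mult: "monomial_functional f (const c * p) = c * monomial_functional f p"
proof -
  have "keys (const c * p) \<subseteq> keys p" by (auto simp: in_keys_iff lookup_const_mult)
  then show ?thesis
    using monomial_functional_superset[of "keys p" "const c * p" f]
    by (simp add: monomial_functional_def lookup_const_mult sum_distrib_left mult.assoc)
qed

lemma monomial_functional_uminus: "monomial_functional f (- p) = - monomial_functional f p"
  using monomial_functional_add[of f p "- p"] by simp

lemma monomial_functional_diff:
  "monomial_functional f (p - q) = monomial_functional f p - monomial_functional f q"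
  using monomial_functional_add[of f p "- q"] by (simp add: monomial_functional_uminus)

lemma monomial_functional_family_sum:
  assumes "\<And>m. f m = (\<Sum>i\<in>I. a i * g i m)"
  shows "monomial_functional f p = (\<Sum>i\<in>I. a i * monomial_functional (g i) p)"
proof -
  have "monomial_functional f p = (\<Sum>m\<in>keys p. \<Sum>i\<in>I. a i * (lookup p m * g i m))"
    by (simp add: monomial_functional_def assms sum_distrib_left mult.left_commute)
  also have "\<dots> = (\<Sum>i\<in>I. \<Sum>m\<in>keys p. a i * (lookup p m * g i m))" by (rule sum.swap)
  finally show ?thesis by (simp add: monomial_functional_def sum_distrib_left)
qed

text \<open>The radical of the bilinear form sending \<open>p\<close> and \<open>q\<close> to the
  value of the functional at \<open>p * q\<close>. Unlike the kernel of the functional it is an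
  ideal, so the relations of the Chow ring need checking on generators only.\<close>

definition radical_ideal :: "(('v \<Rightarrow>\<^sub>0 nat) \<Rightarrow> real) \<Rightarrow> ('v, real) mpoly set" where
  "radical_ideal f = {p. \<forall>q. monomial_functional f (q * p) = 0}"

lemma radical_idealI:
  assumes "\<And>m. monomial_functional f (monomial m * p) = 0"
  shows "p \<in> radical_ideal f"
proof -
  have "monomial_functional f (q * p) = 0" for q
  proof (induction q rule: mpoly_induct)
    case (single m c)
    then show ?case
      using assms[of m] by (simp add: const_mult_monomial[symmetric] mult.assoc monomial_functional_const_mult)
  qed (simp add: distrib_right monomial_functional_add)
  then show ?thesis by (simp add: radical_ideal_def)
qed

lemma radical_ideal_vanishes: "p \<in> radical_ideal f \<Longrightarrow> monomial_functional f p = 0"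
  unfolding radical_ideal_def by (metis (mono_tags) mem_Collect_eq mult_1)

lemma radical_ideal_0 [simp]: "0 \<in> radical_ideal f"
  by (simp add: radical_ideal_def)

lemma radical_ideal_add: "p \<in> radical_ideal f \<Longrightarrow> q \<in> radical_ideal f \<Longrightarrow> p + q \<in> radical_ideal f"
  by (simp add: radical_ideal_def distrib_left monomial_functional_add)

lemma radical_ideal_mult: "p \<in> radical_ideal f \<Longrightarrow> r * p \<in> radical_ideal f"
  by (simp add: radical_ideal_def mult.assoc[symmetric])

lemma radical_ideal_uminus: "p \<in> radical_ideal f \<Longrightarrow> - p \<in> radical_ideal f"
  using radical_ideal_mult[of p f "-1"] by simp

lemma radical_ideal_diff: "p \<in> radical_ideal f \<Longrightarrow> q \<in> radical_ideal f \<Longrightarrow> p - q \<in> radical_ideal f"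
  using radical_ideal_add[of p f "- q"] radical_ideal_uminus[of q f] by simp

lemma radical_ideal_sum: "(\<And>x. x \<in> A \<Longrightarrow> g x \<in> radical_ideal f) \<Longrightarrow> sum g A \<in> radical_ideal f"
  by (induction A rule: infinite_finite_induct) (auto intro: radical_ideal_add)

section \<open>Substitution of polynomials for the variables\<close>

definition monomial_subst :: "('v::finite \<Rightarrow> ('w, real) mpoly) \<Rightarrow> ('v \<Rightarrow>\<^sub>0 nat) \<Rightarrow> ('w, real) mpoly" where
  "monomial_subst X m = (\<Prod>v\<in>UNIV. X v ^ lookup m v)"

definition poly_subst :: "('v::finite \<Rightarrow> ('w, real) mpoly) \<Rightarrow> ('v, real) mpoly \<Rightarrow> ('w, real) mpoly" where
  "poly_subst X p = (\<Sum>m\<in>keys p. const (lookup p m) * monomial_subst X m)"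

lemma const_add: "const (a + b) = const a + (const b :: ('v, real) mpoly)"
  by (simp add: const_def single_add)

lemma poly_subst_superset:
  assumes "finite A" "keys p \<subseteq> A"
  shows "poly_subst X p = (\<Sum>m\<in>A. const (lookup p m) * monomial_subst X m)"
  unfolding poly_subst_def
  by (rule sum.mono_neutral_left) (use assms in \<open>auto simp: in_keys_iff\<close>)

lemma poly_subst_0 [simp]: "poly_subst X 0 = 0"
  by (simp add: poly_subst_def)

lemma poly_subst_single: "poly_subst X (single m c) = const c * monomial_subst X m"
  by (cases "c = 0") (simp_all add: poly_subst_def)

lemma poly_subst_add: "poly_subst X (p + q) = poly_subst X p + poly_subst X q"
proof -
  let ?A = "keys p \<union> keys q"
  have "keys (p + q) \<subseteq> ?A" by (rule Poly_Mapping.keys_add)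
  then show ?thesis
    using poly_subst_superset[of ?A "p + q" X] poly_subst_superset[of ?A p X]
      poly_subst_superset[of ?A q X]
    by (simp add: lookup_add const_add sum.distrib distrib_right)
qed

lemma poly_subst_uminus: "poly_subst X (- p) = - poly_subst X p"
  using poly_subst_add[of X p "- p"] by (simp add: eq_neg_iff_add_eq_0 add.commute)

lemma poly_subst_diff: "poly_subst X (p - q) = poly_subst X p - poly_subst X q"
  using poly_subst_add[of X p "- q"] by (simp add: poly_subst_uminus)

lemma poly_subst_sum: "poly_subst X (sum g A) = (\<Sum>x\<in>A. poly_subst X (g x))"
  by (induction A rule: infinite_finite_induct) (simp_all add: poly_subst_add)

lemma monomial_subst_add: "monomial_subst X (m + k) = monomial_subst X m * monomial_subst X k"
  by (simp add: monomial_subst_def lookup_add power_add prod.distrib)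

lemma poly_subst_mult: "poly_subst X (p * q) = poly_subst X p * poly_subst X q"
proof (induction p rule: mpoly_induct)
  case (single m c)
  show ?case
  proof (induction q rule: mpoly_induct)
    case (single k d)
    show ?case by (simp add: mult_single poly_subst_single const_mult monomial_subst_add ac_simps)
  qed (simp add: distrib_left poly_subst_add)
qed (simp add: distrib_right poly_subst_add)

lemma poly_subst_const: "poly_subst X (const c) = const c"
  by (simp add: const_def[of c] poly_subst_single monomial_subst_def)

lemma poly_subst_1 [simp]: "poly_subst X 1 = 1"
  using poly_subst_const[of X 1] by simp

lemma poly_subst_power: "poly_subst X (p ^ k) = poly_subst X p ^ k"
  by (induction k) (simp_all add: poly_subst_mult)

lemma poly_subst_var: "poly_subst X (var v) = X v"
proof -
  have "monomial_subst X (single v 1) = (\<Prod>w\<in>UNIV. if w = v then X w else 1)"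
    unfolding monomial_subst_def by (intro prod.cong) (auto simp: lookup_single when_def)
  then show ?thesis by (simp add: var_def poly_subst_single)
qed

lemma sum_Pow_alternating:
  assumes "finite A" "A \<noteq> {}"
  shows "(\<Sum>U\<in>Pow A. (-1) ^ card U) = (0::'a::comm_ring_1)"
proof -
  obtain a where a: "a \<in> A" using assms by blast
  define B where "B = A - {a}"
  have B: "A = insert a B" "a \<notin> B" "finite B" using a assms by (auto simp: B_def)
  have "(\<Sum>U\<in>insert a ` Pow B. (-1) ^ card U) = (\<Sum>U\<in>Pow B. (-1) ^ card (insert a U) :: 'a)"
    by (rule sum.reindex_cong[where l = "insert a"]) (use B in \<open>auto simp: inj_on_def\<close>)
  also have "\<dots> = (\<Sum>U\<in>Pow B. - ((-1) ^ card U))"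
  proof (rule sum.cong[OF refl])
    fix U assume "U \<in> Pow B"
    then have "a \<notin> U" "finite U" using B finite_subset by auto
    then show "(-1) ^ card (insert a U) = - ((-1) ^ card U :: 'a)" by simp
  qed
  finally have "(\<Sum>U\<in>insert a ` Pow B. (-1) ^ card U) = - (\<Sum>U\<in>Pow B. (-1) ^ card U :: 'a)"
    by (simp add: sum_negf)
  moreover have "Pow B \<inter> insert a ` Pow B = {}" using B(2) by blast
  ultimately show ?thesis
    unfolding B(1) Pow_insert using B(3) by (simp add: sum.union_disjoint)
qed

text \<open>
  The change of variables between the generators \<open>x_F\<close> of the Chow ring and the simplicial
  generators \<open>h_T = - (\<Sum>F \<supseteq> T. x_F)\<close> of Backman, Eur and Simpson, where \<open>x_E\<close> stands for
  \<open>- \<alpha>\<close>: Moebius inversion on the Boolean lattice.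
\<close>

definition simplicial_form :: "'n::finite set \<Rightarrow> ('n set, real) mpoly" where
  "simplicial_form S = - (\<Sum>T | S \<subseteq> T. (-1) ^ card (T - S) * var T)"

text \<open>The coefficient of \<open>var T\<close> is an alternating sum over the sets between
  \<open>{i}\<close> and \<open>T\<close>, which vanishes unless the two are equal. Up to non-flats
  and the full set, the left side is the image of the linear form at \<open>i\<close> in the Chow
  relations.\<close>

lemma sum_simplicial_form:
  fixes i :: "'n::finite"
  shows "(\<Sum>S | i \<in> S. simplicial_form S) = - var {i}"
proof -
  have inner: "(\<Sum>S | i \<in> S \<and> S \<subseteq> T. (-1) ^ card (T - S)) = (if T = {i} then 1 else (0 :: ('n set, real) mpoly))"
    if "i \<in> T" for T :: "'n set"
  proof -
    have "(\<Sum>S | i \<in> S \<and> S \<subseteq> T. (-1) ^ card (T - S)) = (\<Sum>U\<in>Pow (T - {i}). (-1) ^ card U :: ('n set, real) mpoly)"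
      by (rule sum.reindex_bij_witness[of _ "\<lambda>U. T - U" "\<lambda>S. T - S"]) (use that in auto)
    also have "\<dots> = (if T = {i} then 1 else 0)"
    proof (cases "T = {i}")
      case False
      then have "T - {i} \<noteq> {}" using that by blast
      then show ?thesis using False sum_Pow_alternating[of "T - {i}"] by simp
    qed simp
    finally show ?thesis .
  qed
  have "(\<Sum>S | i \<in> S. simplicial_form S) = - (\<Sum>S | i \<in> S. \<Sum>T | S \<subseteq> T. (-1) ^ card (T - S) * var T)"
    by (simp add: simplicial_form_def sum_negf)
  also have "(\<Sum>S | i \<in> S. \<Sum>T | S \<subseteq> T. (-1) ^ card (T - S) * var T) =
      (\<Sum>T | i \<in> T. \<Sum>S | i \<in> S \<and> S \<subseteq> T. (-1) ^ card (T - S) * (var T :: ('n set, real) mpoly))"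
    unfolding sum.Sigma[OF finite ballI[OF finite]]
    by (rule sum.reindex_bij_witness[of _ "\<lambda>(T, S). (S, T)" "\<lambda>(S, T). (T, S)"]) auto
  also have "\<dots> = (\<Sum>T | i \<in> T. if T = {i} then var T else 0)"
    by (intro sum.cong refl) (simp add: sum_distrib_right[symmetric] inner)
  also have "\<dots> = var {i}" by (simp add: sum.delta)
  finally show ?thesis .
qed

lemma simplicial_form_UNIV: "simplicial_form UNIV = - var UNIV"
  by (simp add: simplicial_form_def top.extremum_unique Collect_conv_if)

text \<open>The sets with and without \<open>i\<close> are matched up and have opposite signs. This
  reduces membership in a radical to the differences \<open>var A - var (insert i A)\<close>, i.e.
  to comparing two simplices that differ in one vertex.\<close>

lemma simplicial_form_pairs:
  assumes "i \<notin> S"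
  shows "simplicial_form S = - (\<Sum>A | S \<subseteq> A \<and> i \<notin> A. (-1) ^ card (A - S) * (var A - var (insert i A)))"
proof -
  have "(\<Sum>T | S \<subseteq> T. (-1) ^ card (T - S) * var T) =
      (\<Sum>T | S \<subseteq> T \<and> i \<notin> T. (-1) ^ card (T - S) * var T) +
      (\<Sum>T | S \<subseteq> T \<and> i \<in> T. (-1) ^ card (T - S) * (var T :: ('a set, real) mpoly))"
    by (subst sum.union_disjoint[symmetric]) (auto intro!: sum.cong)
  also have "(\<Sum>T | S \<subseteq> T \<and> i \<in> T. (-1) ^ card (T - S) * (var T :: ('a set, real) mpoly)) =
      (\<Sum>A | S \<subseteq> A \<and> i \<notin> A. - ((-1) ^ card (A - S) * var (insert i A)))"
  proof (rule sum.reindex_bij_witness[of _ "insert i" "\<lambda>T. T - {i}"])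
    fix T assume T: "T \<in> {T. S \<subseteq> T \<and> i \<in> T}"
    then have "T - S = insert i (T - {i} - S)" using assms by auto
    then have "card (T - S) = Suc (card (T - {i} - S))" by simp
    then show "- ((-1) ^ card (T - {i} - S) * var (insert i (T - {i}))) =
        (-1) ^ card (T - S) * (var T :: ('a set, real) mpoly)"
      using T by (simp add: insert_absorb)
  qed (use assms in auto)
  finally show ?thesis
    by (simp add: simplicial_form_def sum_negf sum_subtractf right_diff_distrib)
qed

lemma simplicial_form_in_radical:
  assumes "i \<notin> S" "\<And>A. S \<subseteq> A \<Longrightarrow> i \<notin> A \<Longrightarrow> var A - var (insert i A) \<in> radical_ideal f"
  shows "simplicial_form S \<in> radical_ideal f"
  unfolding simplicial_form_pairs[OF assms(1)]
  by (intro radical_ideal_uminus radical_ideal_sum radical_ideal_mult) (use assms(2) in auto)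

lemma simplicial_form_mult_in_radical:
  assumes "i \<notin> S" "j \<notin> T"
    "\<And>A B. S \<subseteq> A \<Longrightarrow> i \<notin> A \<Longrightarrow> T \<subseteq> B \<Longrightarrow> j \<notin> B \<Longrightarrow>
      (var A - var (insert i A)) * (var B - var (insert j B)) \<in> radical_ideal f"
  shows "simplicial_form S * simplicial_form T \<in> radical_ideal f"
proof -
  have "(-1) ^ card (A - S) * (var A - var (insert i A)) * ((-1) ^ card (B - T) * (var B - var (insert j B)))
      \<in> radical_ideal f" if "S \<subseteq> A" "i \<notin> A" "T \<subseteq> B" "j \<notin> B" for A B
    using radical_ideal_mult[OF assms(3)[OF that], of "(-1) ^ card (A - S) * (-1) ^ card (B - T)"]
    by (simp add: ac_simps)
  then show ?thesis
    unfolding simplicial_form_pairs[OF assms(1)] simplicial_form_pairs[OF assms(2)] minus_mult_minus sum_product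
    by (intro radical_ideal_sum) auto
qed

subsection \<open>Minkowski sums of simplices\<close>

definition scaled_simplex :: "real \<Rightarrow> 'n::finite set \<Rightarrow> (real ^ 'n) set" where
  "scaled_simplex c A = {v. (\<forall>i. 0 \<le> v $ i) \<and> (\<forall>i. i \<notin> A \<longrightarrow> v $ i = 0) \<and> (\<Sum>i\<in>UNIV. v $ i) = c}"

lemma scaled_simplex_mono: "A \<subseteq> B \<Longrightarrow> scaled_simplex c A \<subseteq> scaled_simplex c B"
  unfolding scaled_simplex_def by blast

lemma scaled_simplex_add:
  "v \<in> scaled_simplex c A \<Longrightarrow> w \<in> scaled_simplex d A \<Longrightarrow> v + w \<in> scaled_simplex (c + d) A"
  by (auto simp: scaled_simplex_def sum.distrib)

lemma scaled_simplex_scaleR: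
  "v \<in> scaled_simplex c A \<Longrightarrow> 0 \<le> s \<Longrightarrow> s *\<^sub>R v \<in> scaled_simplex (s * c) A"
  by (auto simp: scaled_simplex_def sum_distrib_left)

lemma zero_in_scaled_simplex [simp]: "0 \<in> scaled_simplex 0 A"
  by (simp add: scaled_simplex_def)

lemma axis_in_scaled_simplex: "j \<in> A \<Longrightarrow> axis j 1 \<in> scaled_simplex 1 A"
  by (auto simp: scaled_simplex_def axis_def)

lemma convex_scaled_simplex: "convex (scaled_simplex c A)"
proof (rule convexI)
  fix v w :: "real ^ 'a" and s t :: real
  assume vw: "v \<in> scaled_simplex c A" "w \<in> scaled_simplex c A" and st: "0 \<le> s" "0 \<le> t" "s + t = 1"
  have "s *\<^sub>R v + t *\<^sub>R w \<in> scaled_simplex (s * c + t * c) A"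
    using vw st by (intro scaled_simplex_add scaled_simplex_scaleR)
  then show "s *\<^sub>R v + t *\<^sub>R w \<in> scaled_simplex c A"
    using st by (simp add: distrib_right[symmetric])
qed

lemma compact_scaled_simplex: "compact (scaled_simplex c A)"
proof -
  have "closed (scaled_simplex c A)"
    unfolding scaled_simplex_def
    by (intro closed_Collect_conj closed_Collect_all closed_Collect_imp closed_Collect_le closed_Collect_eq
        open_Collect_const continuous_intros)
  moreover have "scaled_simplex c A \<subseteq> cbox 0 (\<chi> i. c)"
  proof
    fix v assume v: "v \<in> scaled_simplex c A"
    have "v $ i \<le> c" for i
      using member_le_sum[of i UNIV "\<lambda>i. v $ i"] v by (auto simp: scaled_simplex_def)
    then show "v \<in> cbox 0 (\<chi> i. c)" using v by (auto simp: mem_box_cart scaled_simplex_def)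
  qed
  then have "bounded (scaled_simplex c A)" using bounded_cbox bounded_subset by blast
  ultimately show ?thesis by (simp add: compact_eq_bounded_closed)
qed

lemma scaled_simplex_shift:
  assumes a: "a \<in> scaled_simplex c A" and t: "0 \<le> t" "t \<le> a $ i" and j: "j \<in> A"
  shows "a + t *\<^sub>R (axis j 1 - axis i 1) \<in> scaled_simplex c A"
proof -
  have "(\<Sum>k\<in>UNIV. (a + t *\<^sub>R (axis j 1 - axis i 1)) $ k) = c"
    using a by (simp add: scaled_simplex_def sum.distrib sum_subtractf sum_distrib_left[symmetric] axis_def)
  moreover have "i \<in> A \<or> t = 0" using a t by (force simp: scaled_simplex_def)
  ultimately show ?thesis using a t j by (auto simp: scaled_simplex_def axis_def)
qed

lemma scaled_simplex_remove:
  assumes "a \<in> scaled_simplex c (insert i A)" "a $ i = 0"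
  shows "a \<in> scaled_simplex c A"
  using assms by (auto simp: scaled_simplex_def)

text \<open>\<open>lookup m T\<close> copies of the unit simplex on \<open>T\<close> add up to one
  scaled simplex. The vector with entries 1/n is the average of the unit vectors: the transversality
  condition asks, for each \<open>i\<close>, for a basis made of \<open>i\<close> and a transversal,
  and averaging their indicator vectors over \<open>i\<close> gives a point of this sum in the
  matroid polytope. Conversely, for such a point the entries over a union of k > 0 nonempty factors
  add up to more than k, so this union has rank greater than k.\<close>

definition simplex_sum :: "('n::finite set \<Rightarrow>\<^sub>0 nat) \<Rightarrow> (real ^ 'n) set" where
  "simplex_sum m = {(\<chi> i. 1 / real CARD('n)) + (\<Sum>T\<in>UNIV. a T) | a.
     \<forall>T. a T \<in> scaled_simplex (real (lookup m T)) T}"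

lemma sum_of_sets_convex_compact:
  fixes C :: "'i \<Rightarrow> 'a::euclidean_space set"
  assumes "finite F" "\<And>T. T \<in> F \<Longrightarrow> convex (C T) \<and> compact (C T)"
  shows "convex {\<Sum>T\<in>F. a T | a. \<forall>T\<in>F. a T \<in> C T} \<and> compact {\<Sum>T\<in>F. a T | a. \<forall>T\<in>F. a T \<in> C T}"
  using assms
proof (induction F rule: finite_induct)
  case (insert S F)
  let ?K = "{\<Sum>T\<in>F. a T | a. \<forall>T\<in>F. a T \<in> C T}"
  have eq: "{\<Sum>T\<in>insert S F. a T | a. \<forall>T\<in>insert S F. a T \<in> C T} = (\<Union>x\<in>C S. \<Union>y\<in>?K. {x + y})"
  proof (intro equalityI subsetI)
    fix z assume "z \<in> {\<Sum>T\<in>insert S F. a T | a. \<forall>T\<in>insert S F. a T \<in> C T}"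
    then show "z \<in> (\<Union>x\<in>C S. \<Union>y\<in>?K. {x + y})" using insert.hyps by auto
  next
    fix z assume "z \<in> (\<Union>x\<in>C S. \<Union>y\<in>?K. {x + y})"
    then obtain x a where xa: "x \<in> C S" "\<forall>T\<in>F. a T \<in> C T" "z = x + (\<Sum>T\<in>F. a T)" by auto
    have "(\<Sum>T\<in>F. (a(S := x)) T) = (\<Sum>T\<in>F. a T)" using insert.hyps by (intro sum.cong) auto
    then have "z = (\<Sum>T\<in>insert S F. (a(S := x)) T)" using xa(3) insert.hyps by simp
    moreover have "\<forall>T\<in>insert S F. (a(S := x)) T \<in> C T" using xa by simp
    ultimately show "z \<in> {\<Sum>T\<in>insert S F. a T | a. \<forall>T\<in>insert S F. a T \<in> C T}" by blast
  qed
  have "convex (C S) \<and> compact (C S)" "convex ?K \<and> compact ?K" using insert by auto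
  then show ?case unfolding eq using convex_sums compact_sums' by blast
qed simp

lemma simplex_sum_eq_translation:
  "simplex_sum m = (+) (\<chi> i. 1 / real CARD('n)) `
    {\<Sum>T\<in>UNIV. a T | a. \<forall>T\<in>UNIV. a T \<in> scaled_simplex (real (lookup m T)) (T :: 'n::finite set)}"
  unfolding simplex_sum_def by auto

lemma convex_simplex_sum: "convex (simplex_sum m)" and compact_simplex_sum: "compact (simplex_sum m)"
proof -
  have *: "convex {\<Sum>T\<in>UNIV. a T | a. \<forall>T\<in>UNIV. a T \<in> scaled_simplex (real (lookup m T)) T} \<and>
    compact {\<Sum>T\<in>UNIV. a T | a. \<forall>T\<in>UNIV. a T \<in> scaled_simplex (real (lookup m T)) T}"
    by (intro sum_of_sets_convex_compact) (auto simp: convex_scaled_simplex compact_scaled_simplex)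
  show "convex (simplex_sum m)" unfolding simplex_sum_eq_translation using * by (intro convex_translation) auto
  show "compact (simplex_sum m)" unfolding simplex_sum_eq_translation using * by (intro compact_translation) auto
qed

lemma simplex_sum_nth_ge:
  fixes x :: "real ^ 'n::finite"
  assumes "x \<in> simplex_sum m"
  shows "1 / real CARD('n) \<le> x $ i"
proof -
  obtain a where a: "x = (\<chi> i. 1 / real CARD('n)) + (\<Sum>T\<in>UNIV. a T)"
    "\<And>T. a T \<in> scaled_simplex (real (lookup m T)) T"
    using assms unfolding simplex_sum_def by blast
  have "0 \<le> (\<Sum>T\<in>UNIV. a T $ i)" using a(2) by (intro sum_nonneg) (auto simp: scaled_simplex_def)
  then show ?thesis by (simp add: a(1))
qed

lemma simplex_sum_add:
  "simplex_sum (m + single A 1) = {x + v | x v. x \<in> simplex_sum m \<and> v \<in> scaled_simplex 1 A}"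
proof (intro equalityI subsetI)
  fix z assume "z \<in> simplex_sum (m + single A 1)"
  then obtain a where a: "z = (\<chi> i. 1 / real CARD('a)) + (\<Sum>T\<in>UNIV. a T)"
    "\<And>T. a T \<in> scaled_simplex (real (lookup (m + single A 1) T)) T"
    unfolding simplex_sum_def by blast
  define c where "c = real (lookup m A)"
  have "0 \<le> c" by (simp add: c_def)
  have aA: "a A \<in> scaled_simplex (c + 1) A" using a(2)[of A] by (simp add: c_def lookup_add add.commute)
  \<comment> \<open>The mass \<open>c + 1\<close> on \<open>A\<close> is split in the proportion
    \<open>1 : c\<close>, one unit going to the new factor.\<close>
  define v where "v = (1 / (c + 1)) *\<^sub>R a A"
  define w where "w = (c / (c + 1)) *\<^sub>R a A"
  have "v \<in> scaled_simplex (1 / (c + 1) * (c + 1)) A" "w \<in> scaled_simplex (c / (c + 1) * (c + 1)) A"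
    unfolding v_def w_def using aA \<open>0 \<le> c\<close> by (intro scaled_simplex_scaleR; simp)+
  then have vw: "v \<in> scaled_simplex 1 A" "w \<in> scaled_simplex c A" using \<open>0 \<le> c\<close> by simp_all
  have "c / (c + 1) + 1 / (c + 1) = 1" using \<open>0 \<le> c\<close> by (simp add: add_divide_distrib[symmetric])
  then have "a A = w + v" by (simp only: v_def w_def scaleR_add_left[symmetric] scaleR_one)
  then have "(\<Sum>T\<in>UNIV. a T) = (\<Sum>T\<in>UNIV. (a(A := w)) T) + v"
    by (simp add: sum.remove[of UNIV A] )
  moreover have "(\<chi> i. 1 / real CARD('a)) + (\<Sum>T\<in>UNIV. (a(A := w)) T) \<in> simplex_sum m"
  proof -
    have "(a(A := w)) T \<in> scaled_simplex (real (lookup m T)) T" for T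
      using a(2)[of T] vw(2) by (cases "T = A") (simp_all add: c_def lookup_add lookup_single when_def)
    then show ?thesis unfolding simplex_sum_def by blast
  qed
  moreover have "z = (\<chi> i. 1 / real CARD('a)) + (\<Sum>T\<in>UNIV. (a(A := w)) T) + v"
    using calculation(1) a(1) by (simp only: add.assoc)
  ultimately show "z \<in> {x + v | x v. x \<in> simplex_sum m \<and> v \<in> scaled_simplex 1 A}"
    using vw(1) by blast
next
  fix z assume "z \<in> {x + v | x v. x \<in> simplex_sum m \<and> v \<in> scaled_simplex 1 A}"
  then obtain a v where z: "z = (\<chi> i. 1 / real CARD('a)) + (\<Sum>T\<in>UNIV. a T) + v"
    and a: "\<And>T. a T \<in> scaled_simplex (real (lookup m T)) T" and v: "v \<in> scaled_simplex 1 A"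
    unfolding simplex_sum_def by blast
  have "(a(A := a A + v)) T \<in> scaled_simplex (real (lookup (m + single A 1) T)) T" for T
    using a[of T] scaled_simplex_add[OF a[of A] v]
    by (cases "T = A") (simp_all add: lookup_add lookup_single when_def add.commute)
  moreover have "z = (\<chi> i. 1 / real CARD('a)) + (\<Sum>T\<in>UNIV. (a(A := a A + v)) T)"
    by (simp add: z sum.remove[of UNIV A] add.assoc add.commute)
  ultimately show "z \<in> simplex_sum (m + single A 1)" unfolding simplex_sum_def by blast
qed

text \<open>
  By the dragon Hall-Rado theorem of Backman, Eur and Simpson, the degree of a product of
  simplicial generators is 1 or 0 according to a transversality condition on the matroid; that
  condition says that the matroid polytope meets the corresponding sum of simplices, after
  translation by the vector with all entries \<open>1 / n\<close>.
\<close>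

definition hits :: "(real ^ 'n::finite) set \<Rightarrow> ('n set \<Rightarrow>\<^sub>0 nat) \<Rightarrow> real" where
  "hits P m = (if P \<inter> simplex_sum m \<noteq> {} then 1 else 0)"

lemma hits_add:
  "hits P (m + single A 1) = (if \<exists>x\<in>simplex_sum m. \<exists>v\<in>scaled_simplex 1 A. x + v \<in> P then 1 else 0)"
proof -
  have "P \<inter> simplex_sum (m + single A 1) \<noteq> {} \<longleftrightarrow> (\<exists>x\<in>simplex_sum m. \<exists>v\<in>scaled_simplex 1 A. x + v \<in> P)"
    unfolding simplex_sum_add by blast
  then show ?thesis by (simp add: hits_def)
qed

lemma hits_add2:
  "hits P (m + single A 1 + single B 1) =
    (if \<exists>x\<in>simplex_sum m. \<exists>v\<in>scaled_simplex 1 A. \<exists>w\<in>scaled_simplex 1 B. x + v + w \<in> P then 1 else 0)"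
proof -
  have "(\<exists>x\<in>simplex_sum (m + single A 1). \<exists>w\<in>scaled_simplex 1 B. x + w \<in> P) \<longleftrightarrow>
      (\<exists>x\<in>simplex_sum m. \<exists>v\<in>scaled_simplex 1 A. \<exists>w\<in>scaled_simplex 1 B. x + v + w \<in> P)"
    unfolding simplex_sum_add by blast
  then show ?thesis by (simp only: hits_add)
qed

text \<open>
  Moving mass at \<open>i\<close> in the first summand to \<open>j\<close> and the same mass at \<open>j\<close> in the second summand
  to \<open>i\<close> does not change the sum of the two.
\<close>

lemma incomparable_pair_in_radical:
  assumes P: "convex P" and A: "j \<in> A" "i \<notin> A" and B: "i \<in> B" "j \<notin> B"
  shows "(var A - var (insert i A)) * (var B - var (insert j B)) \<in> radical_ideal (hits P)"
proof (rule radical_idealI)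
  fix k
  define h where "h X Y \<longleftrightarrow> (\<exists>x\<in>simplex_sum k. \<exists>a\<in>scaled_simplex 1 X. \<exists>b\<in>scaled_simplex 1 Y. x + a + b \<in> P)"
    for X Y
  let ?A = "insert i A" and ?B = "insert j B"
  have mono: "h X Y \<Longrightarrow> X \<subseteq> X' \<Longrightarrow> Y \<subseteq> Y' \<Longrightarrow> h X' Y'" for X X' Y Y'
    unfolding h_def using scaled_simplex_mono by (meson subsetD)
  have swap: "h A ?B \<or> h ?A B" if "h ?A ?B"
  proof -
    obtain x a b where xab: "x \<in> simplex_sum k" "a \<in> scaled_simplex 1 ?A" "b \<in> scaled_simplex 1 ?B" "x + a + b \<in> P"
      using \<open>h ?A ?B\<close> unfolding h_def by blast
    \<comment> \<open>The largest amount that can be swapped; afterwards \<open>a'\<close> has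
      nothing at \<open>i\<close> or \<open>b'\<close> has nothing at \<open>j\<close>.\<close>
    define t where "t = min (a $ i) (b $ j)"
    have t: "0 \<le> t" "t \<le> a $ i" "t \<le> b $ j" using xab by (auto simp: t_def scaled_simplex_def)
    define a' where "a' = a + t *\<^sub>R (axis j 1 - axis i 1)"
    define b' where "b' = b + t *\<^sub>R (axis i 1 - axis j 1)"
    have a': "a' \<in> scaled_simplex 1 ?A" unfolding a'_def by (rule scaled_simplex_shift) (use xab t A in auto)
    have b': "b' \<in> scaled_simplex 1 ?B" unfolding b'_def by (rule scaled_simplex_shift) (use xab t B in auto)
    have "x + a' + b' \<in> P" using xab(4) by (simp add: a'_def b'_def algebra_simps)
    moreover have "a' $ i = 0 \<or> b' $ j = 0"
      using A by (auto simp: a'_def b'_def t_def axis_def min_def)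
    ultimately show ?thesis
      using a' b' xab(1) scaled_simplex_remove[of a' 1 i A] scaled_simplex_remove[of b' 1 j B] unfolding h_def by blast
  qed
  have mix: "h A B" if "h A ?B" "h ?A B"
  proof -
    obtain x a b where xab: "x \<in> simplex_sum k" "a \<in> scaled_simplex 1 A" "b \<in> scaled_simplex 1 ?B" "x + a + b \<in> P"
      using \<open>h A ?B\<close> unfolding h_def by blast
    obtain y c d where ycd: "y \<in> simplex_sum k" "c \<in> scaled_simplex 1 ?A" "d \<in> scaled_simplex 1 B" "y + c + d \<in> P"
      using \<open>h ?A B\<close> unfolding h_def by blast
    have nn: "0 \<le> c $ i" "0 \<le> b $ j" using xab ycd by (auto simp: scaled_simplex_def)
    show ?thesis
    proof (cases "b $ j = 0")
      case True
      then show ?thesis using xab scaled_simplex_remove unfolding h_def by blast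
    next
      case False
      \<comment> \<open>The weights equalise two masses: \<open>s * c $ i\<close>, which the mixture
        of \<open>a\<close> and \<open>c\<close> has at \<open>i\<close>, and
        \<open>r * b $ j\<close>, which the mixture of \<open>b\<close> and \<open>d\<close> has at
        \<open>j\<close>. One swap then clears both.\<close>
      define r where "r = c $ i / (c $ i + b $ j)"
      define s where "s = b $ j / (c $ i + b $ j)"
      have rs: "0 \<le> r" "0 \<le> s" "r + s = 1" using nn False by (auto simp: r_def s_def add_divide_distrib[symmetric])
      define t where "t = s * c $ i"
      have t: "0 \<le> t" "t = r * b $ j" using nn rs(2) by (auto simp: t_def r_def s_def)
      have z: "r *\<^sub>R x + s *\<^sub>R y \<in> simplex_sum k"
        using convex_simplex_sum[of k] xab(1) ycd(1) rs by (meson convexD)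
      have ai: "a $ i = 0" "d $ j = 0" using xab(2) ycd(3) A B by (auto simp: scaled_simplex_def)
      define e where "e = r *\<^sub>R a + s *\<^sub>R c + t *\<^sub>R (axis j 1 - axis i 1)"
      define f where "f = r *\<^sub>R b + s *\<^sub>R d + t *\<^sub>R (axis i 1 - axis j 1)"
      have "a \<in> scaled_simplex 1 ?A" "d \<in> scaled_simplex 1 ?B"
        using xab(2) ycd(3) scaled_simplex_mono[of A ?A] scaled_simplex_mono[of B ?B] by blast+
      then have conv: "r *\<^sub>R a + s *\<^sub>R c \<in> scaled_simplex 1 ?A" "r *\<^sub>R b + s *\<^sub>R d \<in> scaled_simplex 1 ?B"
        using convex_scaled_simplex xab(3) ycd(2) rs by (meson convexD)+
      have "e \<in> scaled_simplex 1 ?A" unfolding e_def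
        by (rule scaled_simplex_shift[OF conv(1)]) (use t ai A in \<open>auto simp: t_def\<close>)
      moreover have "e $ i = 0" using ai A by (auto simp: e_def t_def axis_def)
      ultimately have e: "e \<in> scaled_simplex 1 A" by (rule scaled_simplex_remove)
      have "f \<in> scaled_simplex 1 ?B" unfolding f_def
        by (rule scaled_simplex_shift[OF conv(2)]) (use t ai B in auto)
      moreover have "f $ j = 0" using ai A by (auto simp: f_def t(2) axis_def)
      ultimately have f: "f \<in> scaled_simplex 1 B" by (rule scaled_simplex_remove)
      have "r *\<^sub>R (x + a + b) + s *\<^sub>R (y + c + d) \<in> P" using P xab(4) ycd(4) rs by (meson convexD)
      also have "r *\<^sub>R (x + a + b) + s *\<^sub>R (y + c + d) = (r *\<^sub>R x + s *\<^sub>R y) + e + f"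
        by (simp add: e_def f_def algebra_simps)
      finally show ?thesis using z e f unfolding h_def by blast
    qed
  qed
  have val: "hits P (k + single X 1 + single Y 1) = (if h X Y then 1 else 0)" for X Y
    by (simp only: hits_add2 h_def)
  have mv: "monomial k * (var X * var Y) = monomial (k + single X 1 + single Y 1)" for X Y
    by (simp add: var_eq_monomial monomial_add mult.assoc)
  have "monomial k * ((var A - var ?A) * (var B - var ?B)) =
      monomial k * (var A * var B) - monomial k * (var A * var ?B) - monomial k * (var ?A * var B) +
      monomial k * (var ?A * var ?B)" by (simp add: algebra_simps)
  then have "monomial_functional (hits P) (monomial k * ((var A - var ?A) * (var B - var ?B))) =
      (if h A B then 1 else 0) - (if h A ?B then 1 else 0) - (if h ?A B then 1 else 0) + (if h ?A ?B then 1 else 0)"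
    unfolding mv by (simp only: monomial_functional_add monomial_functional_diff monomial_functional_monomial val)
  also have "\<dots> = 0"
  proof -
    \<comment> \<open>With \<open>swap\<close> and \<open>mix\<close>, \<open>h A B\<close> is the
      conjunction and \<open>h ?A ?B\<close> the disjunction of the two mixed conditions, and the
      indicators of a conjunction and a disjunction add up to the sum of the two indicators.\<close>
    have "h A B \<Longrightarrow> h A ?B" "h A B \<Longrightarrow> h ?A B" "h A ?B \<Longrightarrow> h ?A ?B" "h ?A B \<Longrightarrow> h ?A ?B"
      by (erule mono; rule subset_insertI order_refl)+
    then have "h A B \<longleftrightarrow> h A ?B \<and> h ?A B" "h ?A ?B \<longleftrightarrow> h A ?B \<or> h ?A B"
      using swap mix by iprover+
    then show ?thesis by (cases "h A ?B"; cases "h ?A B") simp_all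
  qed
  finally show "monomial_functional (hits P) (monomial k * ((var A - var ?A) * (var B - var ?B))) = 0" .
qed

text \<open>A simplex with the single vertex \<open>i\<close> adds a full unit at \<open>i\<close>
  to an entry that the translation by 1/n already makes positive, so the entry exceeds 1.\<close>

lemma var_singleton_in_radical:
  assumes "\<And>x. x \<in> P \<Longrightarrow> x $ i \<le> 1"
  shows "var {i} \<in> radical_ideal (hits P)"
proof (rule radical_idealI)
  fix k
  have False if x: "x \<in> simplex_sum k" and v: "v \<in> scaled_simplex 1 {i}" and P: "x + v \<in> P" for x v
  proof -
    have "(\<Sum>j\<in>UNIV. v $ j) = v $ i" using v by (subst sum.remove[of _ i]) (auto simp: scaled_simplex_def)
    then have "v $ i = 1" using v by (simp add: scaled_simplex_def)
    moreover have "0 < x $ i" using simplex_sum_nth_ge[OF x, of i] by (rule less_le_trans[rotated]) simp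
    ultimately show False using assms[OF P] by simp
  qed
  then have "hits P (k + single {i} 1) = 0" unfolding hits_add by auto
  then show "monomial_functional (hits P) (monomial k * var {i}) = 0"
    by (simp add: var_eq_monomial monomial_add[symmetric])
qed

text \<open>The points from which all mass at \<open>i\<close> can be moved into \<open>A\<close>
  form a convex set, so vertices suffice. At a basis containing \<open>i\<close> the move is an
  exchange of \<open>i\<close> for an element of \<open>A\<close>; at other bases there is nothing
  to move.\<close>

lemma matroid_polytope_move_mass:
  assumes M: "matroid M" and i: "i \<notin> A" "i \<in> closure_in M A" and p: "p \<in> matroid_polytope M"
  obtains w where "w \<in> scaled_simplex (p $ i) A" "p + (w - (p $ i) *\<^sub>R axis i 1) \<in> matroid_polytope M"
proof -
  let ?P = "matroid_polytope M"
  define G where "G = {p. \<exists>w\<in>scaled_simplex (p $ i) A. p + (w - (p $ i) *\<^sub>R axis i 1) \<in> ?P}"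
  have "convex ?P" by (simp add: matroid_polytope_def)
  have "convex G"
  proof (rule convexI)
    fix p q :: "real ^ 'a" and s t :: real
    assume "p \<in> G" "q \<in> G" and st: "0 \<le> s" "0 \<le> t" "s + t = 1"
    then obtain v w where v: "v \<in> scaled_simplex (p $ i) A" "p + (v - (p $ i) *\<^sub>R axis i 1) \<in> ?P"
      and w: "w \<in> scaled_simplex (q $ i) A" "q + (w - (q $ i) *\<^sub>R axis i 1) \<in> ?P"
      unfolding G_def by blast
    have "s *\<^sub>R v + t *\<^sub>R w \<in> scaled_simplex (s * p $ i + t * q $ i) A"
      using v w st by (intro scaled_simplex_add scaled_simplex_scaleR)
    then have "s *\<^sub>R v + t *\<^sub>R w \<in> scaled_simplex ((s *\<^sub>R p + t *\<^sub>R q) $ i) A" by simp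
    moreover have "s *\<^sub>R (p + (v - (p $ i) *\<^sub>R axis i 1)) + t *\<^sub>R (q + (w - (q $ i) *\<^sub>R axis i 1)) \<in> ?P"
      using \<open>convex ?P\<close> v(2) w(2) st by (meson convexD)
    moreover have "s *\<^sub>R (p + (v - (p $ i) *\<^sub>R axis i 1)) + t *\<^sub>R (q + (w - (q $ i) *\<^sub>R axis i 1)) =
        (s *\<^sub>R p + t *\<^sub>R q) + ((s *\<^sub>R v + t *\<^sub>R w) - ((s *\<^sub>R p + t *\<^sub>R q) $ i) *\<^sub>R axis i 1)"
      by (simp add: algebra_simps)
    ultimately show "s *\<^sub>R p + t *\<^sub>R q \<in> G" unfolding G_def by auto
  qed
  moreover have "indicator_vec B \<in> G" if B: "B \<in> M" for B
  proof (cases "i \<in> B")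
    case False
    then show ?thesis unfolding G_def using indicator_vec_mem[OF B] by (auto intro!: bexI[of _ 0])
  next
    case True
    obtain j where j: "j \<in> A" "j \<notin> B" "insert j (B - {i}) \<in> M"
      using exchange_into_spanning_set[OF M B True i] .
    have "indicator_vec B + (axis j 1 - axis i 1) = (indicator_vec (insert j (B - {i})) :: real ^ 'a)"
      using j True by (auto simp: vec_eq_iff axis_def)
    then show ?thesis unfolding G_def
      using indicator_vec_mem[OF j(3)] axis_in_scaled_simplex[OF j(1)] True
      by (auto intro!: bexI[of _ "axis j 1"])
  qed
  ultimately have "?P \<subseteq> G" unfolding matroid_polytope_def by (intro hull_minimal) auto
  then show thesis using p that unfolding G_def by blast
qed

text \<open>The simplices on \<open>A\<close> and \<open>insert i A\<close> give the same hits: the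
  mass that the larger one puts at \<open>i\<close> can be moved into \<open>A\<close> inside the
  polytope.\<close>

lemma closure_pair_in_radical:
  assumes M: "matroid M" and i: "i \<notin> A" "i \<in> closure_in M A"
  shows "var A - var (insert i A) \<in> radical_ideal (hits (matroid_polytope M))"
proof (rule radical_idealI)
  fix k
  let ?P = "matroid_polytope M"
  have "\<exists>x\<in>simplex_sum k. \<exists>v\<in>scaled_simplex 1 A. x + v \<in> ?P"
    if x: "x \<in> simplex_sum k" and v: "v \<in> scaled_simplex 1 (insert i A)" and P: "x + v \<in> ?P" for x v
  proof -
    define p where "p = x + v"
    have xi: "0 < x $ i" using simplex_sum_nth_ge[OF x, of i] by (rule less_le_trans[rotated]) simp
    have vi: "0 \<le> v $ i" using v by (simp add: scaled_simplex_def)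
    then have pi: "0 < p $ i" "v $ i \<le> p $ i" using xi by (auto simp: p_def)
    obtain w where w: "w \<in> scaled_simplex (p $ i) A" "p + (w - (p $ i) *\<^sub>R axis i 1) \<in> ?P"
      using matroid_polytope_move_mass[OF M i] P unfolding p_def by blast
    \<comment> \<open>The share of \<open>p $ i\<close> that comes from the simplex; the rest
      belongs to \<open>x\<close> and has to stay. Moving everything and taking a convex combination
      with \<open>p\<close> moves just this share. The division makes sense as \<open>x $ i\<close>,
      and so \<open>p $ i\<close>, is positive.\<close>
    define s where "s = v $ i / p $ i"
    have s: "0 \<le> s" "s \<le> 1" "s * p $ i = v $ i" using pi vi by (auto simp: s_def)
    have "(1 - s) *\<^sub>R p + s *\<^sub>R (p + (w - (p $ i) *\<^sub>R axis i 1)) \<in> ?P"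
      using P w(2) s unfolding p_def matroid_polytope_def
      by (intro convexD[OF convex_convex_hull]) auto
    also have "(1 - s) *\<^sub>R p + s *\<^sub>R (p + (w - (p $ i) *\<^sub>R axis i 1)) = x + ((v - (s * p $ i) *\<^sub>R axis i 1) + s *\<^sub>R w)"
      by (simp add: p_def algebra_simps)
    finally have inP: "x + ((v - (v $ i) *\<^sub>R axis i 1) + s *\<^sub>R w) \<in> ?P" by (simp only: s(3))
    have "(\<Sum>j\<in>UNIV. (v - (v $ i) *\<^sub>R axis i 1) $ j) = 1 - v $ i"
      using v by (simp add: scaled_simplex_def sum_subtractf sum_distrib_left[symmetric] axis_def)
    then have "v - (v $ i) *\<^sub>R axis i 1 \<in> scaled_simplex (1 - v $ i) A"
      using v by (auto simp: scaled_simplex_def axis_def)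
    moreover have "s *\<^sub>R w \<in> scaled_simplex (v $ i) A"
      using scaled_simplex_scaleR[OF w(1) s(1)] by (simp add: s(3))
    ultimately have "(v - (v $ i) *\<^sub>R axis i 1) + s *\<^sub>R w \<in> scaled_simplex (1 - v $ i + v $ i) A"
      by (rule scaled_simplex_add)
    then show ?thesis using x inP by (intro bexI) auto
  qed
  then have "hits ?P (k + single A 1) = hits ?P (k + single (insert i A) 1)"
    unfolding hits_add using scaled_simplex_mono[of A "insert i A" 1] by (auto simp: subset_iff)
  then show "monomial_functional (hits ?P) (monomial k * (var A - var (insert i A))) = 0"
    by (simp add: var_eq_monomial monomial_add[symmetric] right_diff_distrib monomial_functional_diff)
qed

text \<open>Average, over all \<open>i\<close>, a basis containing \<open>i\<close>: every entry is
  at least 1/n. Subtracting the translation vector leaves nonnegative entries with sum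
  \<open>(d + 1) - 1 = d\<close>, a point of \<open>d\<close> times the full simplex.\<close>

lemma hits_loopless:
  fixes M :: "'n::finite set set"
  assumes M: "matroid M" "loopless M"
  shows "hits (matroid_polytope M) (single UNIV (top_degree M)) = 1"
proof -
  let ?n = "real CARD('n)" and ?P = "matroid_polytope M"
  obtain B where B: "\<And>i. B i \<in> M" "\<And>i. i \<in> B i" using M loopless_iff[OF M(1)] by metis
  define p :: "real ^ 'n" where "p = (\<Sum>i\<in>UNIV. (1 / ?n) *\<^sub>R indicator_vec (B i))"
  have p: "p \<in> ?P" unfolding p_def
    by (rule convex_sum) (use B indicator_vec_mem in \<open>auto simp: matroid_polytope_def\<close>)
  have card: "card C = Suc (top_degree M)" if "C \<in> M" for C
    using rank_of_UNIV[OF M(1) that] rank_pos[OF M] by simp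
  have ge: "1 / ?n \<le> p $ i" for i
  proof -
    have "(1 / ?n) * indicator_vec (B i) $ i \<le> (\<Sum>j\<in>UNIV. (1 / ?n) * indicator_vec (B j) $ i)"
      by (rule member_le_sum) auto
    then show ?thesis using B(2)[of i] by (simp add: p_def)
  qed
  define v where "v = p - (\<chi> i. 1 / ?n)"
  have "(\<Sum>i\<in>UNIV. p $ i) = real (Suc (top_degree M))" using matroid_polytope_sum[OF card p] .
  then have "v \<in> scaled_simplex (real (top_degree M)) UNIV"
    using ge by (simp add: v_def scaled_simplex_def sum_subtractf)
  then have "(\<lambda>T. if T = UNIV then v else 0) T \<in> scaled_simplex (real (lookup (single UNIV (top_degree M)) T)) T" for T
    by (simp add: lookup_single when_def)
  moreover have "p = (\<chi> i. 1 / ?n) + (\<Sum>T\<in>(UNIV :: 'n set set). if T = UNIV then v else 0)"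
    by (simp add: v_def)
  ultimately have "p \<in> simplex_sum (single UNIV (top_degree M))" unfolding simplex_sum_def by blast
  then show ?thesis using p by (auto simp: hits_def)
qed

lemma hits_subdivision:
  assumes "matroid_subdivision M \<S>"
  shows "hits (matroid_polytope M) m = (\<Sum>Q\<in>interior_faces (matroid_polytope M) \<S>.
    (-1) ^ nat (aff_dim (matroid_polytope M) - aff_dim Q) * hits Q m)"
  using subdivision_hits_compact_convex[OF _ polytope_matroid_polytope compact_simplex_sum convex_simplex_sum] assms
  unfolding hits_def matroid_subdivision_def by blast

subsection \<open>The Chow ring\<close>

lemma zero_in_polys_in [simp]: "0 \<in> polys_in V"
  by (simp add: polys_in_def)

lemma single_in_polys_in: "keys m \<subseteq> V \<Longrightarrow> single m c \<in> polys_in V"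
  by (simp add: polys_in_def)

lemma const_in_polys_in [simp]: "const c \<in> polys_in V"
  unfolding const_def by (rule single_in_polys_in) simp

lemma one_in_polys_in [simp]: "(1 :: ('v, real) mpoly) \<in> polys_in V"
  using const_in_polys_in[of "1::real" V] by simp

lemma var_in_polys_in: "v \<in> V \<Longrightarrow> var v \<in> polys_in V"
  unfolding var_def by (rule single_in_polys_in) simp

lemma monomial_in_polys_in: "keys m \<subseteq> V \<Longrightarrow> monomial m \<in> polys_in V"
  unfolding monomial_def by (rule single_in_polys_in)

lemma polys_in_add: "p \<in> polys_in V \<Longrightarrow> q \<in> polys_in V \<Longrightarrow> p + q \<in> polys_in V"
  using Poly_Mapping.keys_add[of p q] unfolding polys_in_def by blast

lemma polys_in_uminus: "(p :: ('v, real) mpoly) \<in> polys_in V \<Longrightarrow> - p \<in> polys_in V"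
  by (simp add: polys_in_def in_keys_iff)

lemma polys_in_diff:
  "(p :: ('v, real) mpoly) \<in> polys_in V \<Longrightarrow> q \<in> polys_in V \<Longrightarrow> p - q \<in> polys_in V"
  using polys_in_add[of p V "- q"] polys_in_uminus[of q V] by simp

lemma polys_in_mult:
  assumes "(p :: ('v, real) mpoly) \<in> polys_in V" "q \<in> polys_in V"
  shows "p * q \<in> polys_in V"
  unfolding polys_in_def
proof (intro CollectI ballI)
  fix m assume "m \<in> keys (p * q)"
  then obtain a b where "a \<in> keys p" "b \<in> keys q" "m = a + b" using keys_mult by blast
  then show "keys m \<subseteq> V" using assms Poly_Mapping.keys_add[of a b] unfolding polys_in_def by blast
qed

lemma polys_in_power: "(p :: ('v, real) mpoly) \<in> polys_in V \<Longrightarrow> p ^ k \<in> polys_in V"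
  by (induction k) (simp_all add: polys_in_mult)

lemma polys_in_sum:
  "(\<And>x. x \<in> A \<Longrightarrow> (g x :: ('v, real) mpoly) \<in> polys_in V) \<Longrightarrow> sum g A \<in> polys_in V"
  by (induction A rule: infinite_finite_induct) (auto intro: polys_in_add)

lemma polys_in_prod:
  "(\<And>x. x \<in> A \<Longrightarrow> (g x :: ('v, real) mpoly) \<in> polys_in V) \<Longrightarrow> prod g A \<in> polys_in V"
  by (induction A rule: infinite_finite_induct) (auto intro: polys_in_mult)

lemma poly_ring_simps [simp]:
  "carrier (poly_ring V) = polys_in V" "monoid.mult (poly_ring V) = (*)" "one (poly_ring V) = 1"
  "ring.zero (poly_ring V) = 0" "add (poly_ring V) = (+)"
  by (simp_all add: poly_ring_def)

lemma cring_poly_ring: "cring (poly_ring V)"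
proof (rule cringI)
  show "abelian_group (poly_ring V)"
  proof (rule abelian_groupI)
    fix p assume "p \<in> carrier (poly_ring V)"
    then show "\<exists>q\<in>carrier (poly_ring V). add (poly_ring V) q p = ring.zero (poly_ring V)"
      by (auto intro!: bexI[of _ "- p"] polys_in_uminus)
  qed (auto simp: polys_in_add ac_simps)
  show "comm_monoid (poly_ring V)"
    by (rule comm_monoidI) (auto simp: polys_in_mult ac_simps)
qed (auto simp: distrib_right)

lemma ideal_poly_ringI:
  assumes "J \<subseteq> polys_in V" "0 \<in> J" "\<And>p q. p \<in> J \<Longrightarrow> q \<in> J \<Longrightarrow> p + q \<in> J"
    "\<And>r p. r \<in> polys_in V \<Longrightarrow> p \<in> J \<Longrightarrow> r * p \<in> J"
  shows "ideal J (poly_ring V)"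
proof (rule idealI)
  interpret cring "poly_ring V" by (rule cring_poly_ring)
  show "ring (poly_ring V)" by (rule ring_axioms)
  have neg: "inv\<^bsub>add_monoid (poly_ring V)\<^esub> p = - p" if "p \<in> polys_in V" for p
  proof -
    have "\<ominus>\<^bsub>poly_ring V\<^esub> p = - p"
      by (rule minus_equality) (use that polys_in_uminus in auto)
    then show ?thesis by (simp add: a_inv_def)
  qed
  show "subgroup J (add_monoid (poly_ring V))"
  proof (rule subgroup.intro)
    show "inv\<^bsub>add_monoid (poly_ring V)\<^esub> p \<in> J" if "p \<in> J" for p
    proof -
      have "(- 1) * p \<in> J" using that by (intro assms(4) polys_in_uminus) auto
      then show ?thesis using neg[of p] that assms(1) by auto
    qed
  qed (use assms in auto)
  show "p \<otimes>\<^bsub>poly_ring V\<^esub> r \<in> J" if "p \<in> J" "r \<in> carrier (poly_ring V)" for p r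
    using that assms(4)[of r p] by (simp add: mult.commute)
qed (use assms in auto)

lemma homogeneous_iff:
  fixes p :: "('v::finite, real) mpoly"
  shows "homogeneous k p \<longleftrightarrow> (\<forall>m\<in>keys p. (\<Sum>v\<in>UNIV. lookup m v) = k)"
proof -
  have "(\<Sum>v\<in>keys m. lookup m v) = (\<Sum>v\<in>UNIV. lookup m v)" for m :: "'v \<Rightarrow>\<^sub>0 nat"
    by (rule sum.mono_neutral_left) (auto simp: in_keys_iff)
  then show ?thesis by (simp add: homogeneous_def)
qed

lemma homogeneous_0 [simp]: "homogeneous k 0"
  by (simp add: homogeneous_def)

lemma homogeneous_add:
  fixes p :: "('v::finite, real) mpoly"
  shows "homogeneous k p \<Longrightarrow> homogeneous k q \<Longrightarrow> homogeneous k (p + q)"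
  using Poly_Mapping.keys_add[of p q] unfolding homogeneous_iff by blast

lemma homogeneous_mult:
  fixes p :: "('v::finite, real) mpoly"
  assumes "homogeneous a p" "homogeneous b q"
  shows "homogeneous (a + b) (p * q)"
  unfolding homogeneous_iff
proof
  fix m assume "m \<in> keys (p * q)"
  then obtain x y where "x \<in> keys p" "y \<in> keys q" "m = x + y" using keys_mult by blast
  then show "(\<Sum>v\<in>UNIV. lookup m v) = a + b"
    using assms unfolding homogeneous_iff by (simp add: lookup_add sum.distrib)
qed

lemma homogeneous_const [simp]: "homogeneous 0 (const c)"
  by (simp add: homogeneous_def const_def)

lemma homogeneous_1 [simp]: "homogeneous 0 (1 :: ('v::finite, real) mpoly)"
  using homogeneous_const[of "1::real"] by simp

lemma homogeneous_var [simp]: "homogeneous 1 (var v)"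
  by (simp add: homogeneous_def var_def)

lemma homogeneous_sum:
  fixes g :: "'i \<Rightarrow> ('v::finite, real) mpoly"
  shows "(\<And>x. x \<in> A \<Longrightarrow> homogeneous k (g x)) \<Longrightarrow> homogeneous k (sum g A)"
  by (induction A rule: infinite_finite_induct) (auto intro: homogeneous_add)

lemma homogeneous_power:
  fixes p :: "('v::finite, real) mpoly"
  shows "homogeneous a p \<Longrightarrow> homogeneous (k * a) (p ^ k)"
  by (induction k) (simp_all add: homogeneous_mult)

section \<open>The Chow ideal of a fixed loopless matroid\<close>

locale loopless_matroid =
  fixes M :: "'n::finite set set"
  assumes matroid: "matroid M" and loopless: "loopless M"
begin

abbreviation "V \<equiv> proper_flats M"
abbreviation "d \<equiv> top_degree M"
abbreviation "I \<equiv> chow_ideal M"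
abbreviation "rk \<equiv> rank_of M"

definition star_sum :: "'n \<Rightarrow> ('n set, real) mpoly" where
  "star_sum i = (\<Sum>F | F \<in> V \<and> i \<in> F. var F)"

lemma star_sum_in_polys: "star_sum i \<in> polys_in V"
  unfolding star_sum_def by (intro polys_in_sum var_in_polys_in) auto

lemma homogeneous_star_sum: "homogeneous 1 (star_sum i)"
  unfolding star_sum_def by (intro homogeneous_sum homogeneous_var)

lemma flat_properD: "F \<in> V \<Longrightarrow> flat M F" "F \<in> V \<Longrightarrow> F \<noteq> {}" "F \<in> V \<Longrightarrow> F \<noteq> UNIV"
  by (auto simp: proper_flats_def)

lemma rk_proper_flat:
  assumes "F \<in> V"
  shows "0 < rk F" "rk F \<le> d"
proof -
  have "rk {} < rk F"
    using flat_rank_less[OF matroid, of "{}" F] loopless flat_properD(2)[OF assms] unfolding loopless_def by blast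
  then show "0 < rk F" by simp
  have "rk F < rk UNIV"
    using flat_rank_less[OF matroid flat_properD(1)[OF assms], of UNIV] flat_properD(3)[OF assms] by blast
  then show "rk F \<le> d" using rank_pos[OF matroid loopless] by simp
qed

lemma flat_ring_eq: "flat_ring M = poly_ring V"
  by (simp add: flat_ring_def)

lemma incomparable_gens_in:
  "{var F * var F' | F F'. F \<in> V \<and> F' \<in> V \<and> \<not> F \<subseteq> F' \<and> \<not> F' \<subseteq> F} \<subseteq>
    (polys_in V :: ('n set, real) mpoly set)"
proof
  fix p :: "('n set, real) mpoly" assume "p \<in> {var F * var F' | F F'. F \<in> V \<and> F' \<in> V \<and> \<not> F \<subseteq> F' \<and> \<not> F' \<subseteq> F}"
  then obtain F F' where "p = var F * var F'" "F \<in> V" "F' \<in> V" by blast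
  then show "p \<in> polys_in V" by (simp add: polys_in_mult var_in_polys_in)
qed

lemma linear_gens_in: "{star_sum i - star_sum j | i j. True} \<subseteq> polys_in V"
  by (auto intro!: polys_in_diff star_sum_in_polys)

lemma linear_ideal_eq: "linear_ideal M = genideal (poly_ring V) {star_sum i - star_sum j | i j. True}"
  by (simp add: linear_ideal_def flat_ring_eq star_sum_def)

lemma ideal_incomparable: "ideal (incomparable_ideal M) (poly_ring V)"
proof -
  interpret cring "poly_ring V" by (rule cring_poly_ring)
  show ?thesis unfolding incomparable_ideal_def flat_ring_eq
    by (rule genideal_ideal) (simp only: poly_ring_simps incomparable_gens_in)
qed

lemma ideal_linear: "ideal (linear_ideal M) (poly_ring V)"
proof -
  interpret cring "poly_ring V" by (rule cring_poly_ring)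
  show ?thesis unfolding linear_ideal_eq by (rule genideal_ideal) (simp only: poly_ring_simps linear_gens_in)
qed

lemma chow_ideal_eq: "I = {p + q | p q. p \<in> incomparable_ideal M \<and> q \<in> linear_ideal M}"
  unfolding chow_ideal_def flat_ring_eq set_add_def' by auto

lemma ideal_chow: "ideal I (poly_ring V)"
proof -
  interpret cring "poly_ring V" by (rule cring_poly_ring)
  show ?thesis unfolding chow_ideal_def flat_ring_eq by (rule add_ideals[OF ideal_incomparable ideal_linear])
qed

lemma chow_ideal_0: "0 \<in> I"
  using additive_subgroup.zero_closed[OF ideal.axioms(1)[OF ideal_chow]] by simp

lemma chow_ideal_add: "p \<in> I \<Longrightarrow> q \<in> I \<Longrightarrow> p + q \<in> I"
  using additive_subgroup.a_closed[OF ideal.axioms(1)[OF ideal_chow]] by simp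

lemma chow_ideal_mult: "r \<in> polys_in V \<Longrightarrow> p \<in> I \<Longrightarrow> r * p \<in> I"
  using ideal.I_l_closed[OF ideal_chow] by simp

lemma chow_ideal_uminus: "p \<in> I \<Longrightarrow> - p \<in> I"
  using chow_ideal_mult[OF polys_in_uminus[OF one_in_polys_in], of p] by simp

lemma chow_ideal_diff: "p \<in> I \<Longrightarrow> q \<in> I \<Longrightarrow> p - q \<in> I"
  using chow_ideal_add[of p "- q"] chow_ideal_uminus[of q] by simp

lemma chow_ideal_sum: "(\<And>x. x \<in> A \<Longrightarrow> g x \<in> I) \<Longrightarrow> sum g A \<in> I"
  by (induction A rule: infinite_finite_induct) (auto intro: chow_ideal_add chow_ideal_0)

lemma incomparable_in_chow_ideal:
  assumes "F \<in> V" "G \<in> V" "\<not> F \<subseteq> G" "\<not> G \<subseteq> F"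
  shows "var F * var G \<in> I"
proof -
  interpret cring "poly_ring V" by (rule cring_poly_ring)
  have "{var F * var F' | F F'. F \<in> V \<and> F' \<in> V \<and> \<not> F \<subseteq> F' \<and> \<not> F' \<subseteq> F} \<subseteq> incomparable_ideal M"
    unfolding incomparable_ideal_def flat_ring_eq by (rule genideal_self) (simp only: poly_ring_simps incomparable_gens_in)
  then have "var F * var G \<in> incomparable_ideal M" using assms by blast
  moreover have "0 \<in> linear_ideal M"
    using additive_subgroup.zero_closed[OF ideal.axioms(1)[OF ideal_linear]] by simp
  ultimately show ?thesis unfolding chow_ideal_eq by force
qed

lemma star_sum_diff_in_chow_ideal: "star_sum i - star_sum j \<in> I"
proof -
  interpret cring "poly_ring V" by (rule cring_poly_ring)
  have "{star_sum i - star_sum j | i j. True} \<subseteq> linear_ideal M"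
    unfolding linear_ideal_eq by (rule genideal_self) (simp only: poly_ring_simps linear_gens_in)
  then have "star_sum i - star_sum j \<in> linear_ideal M" by blast
  moreover have "0 \<in> incomparable_ideal M"
    using additive_subgroup.zero_closed[OF ideal.axioms(1)[OF ideal_incomparable]] by simp
  ultimately show ?thesis unfolding chow_ideal_eq by force
qed

lemma chow_ideal_minimal:
  assumes J: "ideal J (poly_ring V)"
    and inc: "\<And>F G. F \<in> V \<Longrightarrow> G \<in> V \<Longrightarrow> \<not> F \<subseteq> G \<Longrightarrow> \<not> G \<subseteq> F \<Longrightarrow> var F * var G \<in> J"
    and lin: "\<And>i j. star_sum i - star_sum j \<in> J"
  shows "I \<subseteq> J"
proof -
  interpret cring "poly_ring V" by (rule cring_poly_ring)
  have "incomparable_ideal M \<subseteq> J" unfolding incomparable_ideal_def flat_ring_eq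
    by (rule genideal_minimal[OF J]) (use inc in auto)
  moreover have "linear_ideal M \<subseteq> J" unfolding linear_ideal_eq
    by (rule genideal_minimal[OF J]) (use lin in auto)
  moreover have "p + q \<in> J" if "p \<in> J" "q \<in> J" for p q
    using additive_subgroup.a_closed[OF ideal.axioms(1)[OF J]] that by simp
  ultimately show ?thesis unfolding chow_ideal_eq by blast
qed

text \<open>The hyperplane class; \<open>undefined\<close> is just some element of the ground set,
  and modulo the Chow ideal every choice gives the same.\<close>

definition alpha :: "('n set, real) mpoly" where
  "alpha = star_sum undefined"

lemma alpha_in_polys: "alpha \<in> polys_in V"
  by (simp add: alpha_def star_sum_in_polys)

lemma alpha_star_sum: "alpha - star_sum i \<in> I"
  by (simp add: alpha_def star_sum_diff_in_chow_ideal)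

text \<open>Write one factor \<open>alpha\<close> as the linear form at some \<open>i\<close>
  outside \<open>F\<close>. A flat containing \<open>i\<close> is incomparable to \<open>F\<close>
  or strictly above it, so every surviving term has a flat of larger rank; beyond rank
  \<open>d\<close> there is no proper flat.\<close>

lemma alpha_power_var_in_ideal:
  "F \<in> V \<Longrightarrow> d < m + rk F \<Longrightarrow> alpha ^ m * var F \<in> I"
proof (induction m arbitrary: F)
  case 0
  then show ?case using rk_proper_flat(2)[of F] by simp
next
  case (Suc m)
  note F = Suc.prems(1)
  obtain i where i: "i \<notin> F" using flat_properD(3)[OF F] by blast
  have am: "alpha ^ m \<in> polys_in V" "alpha ^ m * var F \<in> polys_in V"
    using alpha_in_polys F by (auto intro!: polys_in_mult polys_in_power var_in_polys_in)
  have "alpha ^ m * var F * var G \<in> I" if G: "G \<in> V" "i \<in> G" for G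
  proof (cases "F \<subseteq> G")
    case True
    then have "F \<subset> G" using i G(2) by blast
    then have "rk F < rk G" by (rule flat_rank_less[OF matroid flat_properD(1)[OF F]])
    then have "alpha ^ m * var G \<in> I" using Suc.IH[OF G(1)] Suc.prems(2) by simp
    then have "var F * (alpha ^ m * var G) \<in> I" by (rule chow_ideal_mult[OF var_in_polys_in[OF F]])
    then show ?thesis by (simp add: ac_simps)
  next
    case False
    then have "var F * var G \<in> I" using i G F by (intro incomparable_in_chow_ideal) auto
    then have "alpha ^ m * (var F * var G) \<in> I" by (rule chow_ideal_mult[OF am(1)])
    then show ?thesis by (simp add: ac_simps)
  qed
  then have "alpha ^ m * var F * star_sum i \<in> I"
    unfolding star_sum_def sum_distrib_left by (intro chow_ideal_sum) auto
  moreover have "alpha ^ m * var F * (alpha - star_sum i) \<in> I"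
    by (intro chow_ideal_mult am alpha_star_sum)
  ultimately have "alpha ^ m * var F * (alpha - star_sum i) + alpha ^ m * var F * star_sum i \<in> I"
    by (rule chow_ideal_add[rotated])
  then show ?case by (simp add: algebra_simps)
qed

lemma chain_rk_inj:
  assumes "C \<subseteq> V" "\<And>F G. F \<in> C \<Longrightarrow> G \<in> C \<Longrightarrow> F \<subseteq> G \<or> G \<subseteq> F" "F \<in> C" "G \<in> C" "rk F \<le> rk G"
  shows "F \<subseteq> G"
proof (rule ccontr)
  assume "\<not> F \<subseteq> G"
  then have "G \<subset> F" using assms(2)[OF assms(3,4)] by blast
  then have "rk G < rk F" using flat_rank_less[OF matroid] flat_properD(1) assms(1,4) by blast
  then show False using assms(5) by simp
qed

text \<open>The top flat \<open>G\<close> of the chain is traded for one factor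
  \<open>alpha\<close>. For \<open>i\<close> in \<open>G\<close> but not in the next lower flat
  \<open>U\<close>, the linear form at \<open>i\<close> times the rest of the monomial keeps only
  the term of \<open>G\<close>: a flat not above the rest of the chain is incomparable to a member
  of it, the only other candidate of rank \<open>k + 1\<close> is \<open>G\<close> itself, and
  higher ranks are killed by the remaining power of \<open>alpha\<close>.\<close>

lemma chain_monomial_eq_alpha_power:
  assumes "C \<subseteq> V" "\<And>F G. F \<in> C \<Longrightarrow> G \<in> C \<Longrightarrow> F \<subseteq> G \<or> G \<subseteq> F" "rk ` C = {1..k}" "k \<le> d"
  shows "alpha ^ (d - k) * (\<Prod>G\<in>C. var G) - alpha ^ d \<in> I"
  using assms
proof (induction k arbitrary: C)
  case 0
  then show ?case by (simp add: chow_ideal_0)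
next
  case (Suc k)
  note CV = Suc.prems(1) and chain = Suc.prems(2)
  have "Suc k \<in> rk ` C" using Suc.prems(3) by simp
  then obtain G where G: "G \<in> C" "rk G = Suc k" by auto
  then have GV: "G \<in> V" using CV by blast
  define C' where "C' = C - {G}"
  have C': "C' \<subseteq> V" "\<And>F G. F \<in> C' \<Longrightarrow> G \<in> C' \<Longrightarrow> F \<subseteq> G \<or> G \<subseteq> F" using CV chain unfolding C'_def by blast+
  have inj: "F = H" if "F \<in> C" "H \<in> C" "rk F = rk H" for F H
    using chain_rk_inj[OF CV chain] that by (metis order_refl subset_antisym)
  have rkC': "rk ` C' = {1..k}"
  proof -
    have "rk ` C' = rk ` C - {rk G}" unfolding C'_def using inj G(1) by blast
    then show ?thesis using Suc.prems(3) G(2) by auto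
  qed
  \<comment> \<open>For \<open>k = 0\<close> the chain below \<open>G\<close> is empty and the empty
    flat takes the place of its top; this is where looplessness is used.\<close>
  obtain U where U: "flat M U" "rk U = k" "\<And>H. H \<in> C' \<Longrightarrow> H \<subseteq> U" "U \<subset> G" "U = {} \<or> U \<in> C'"
  proof (cases "k = 0")
    case True
    then have "C' = {}" using rkC' by auto
    then show thesis
      using that[of "{}"] loopless matroid True flat_properD(2)[OF GV] unfolding loopless_def by auto
  next
    case False
    then have "k \<in> rk ` C'" using rkC' by simp
    then obtain H where H: "H \<in> C'" "rk H = k" by auto
    show thesis
    proof (rule that[of H])
      show "flat M H" using H C'(1) flat_properD by blast
      show "K \<subseteq> H" if "K \<in> C'" for K
      proof -
        have "rk K \<in> {1..k}" using rkC' that by blast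
        then show ?thesis using chain_rk_inj[OF C' that H(1)] H(2) by simp
      qed
      have "H \<subseteq> G" using chain_rk_inj[OF CV chain, of H G] H G unfolding C'_def by auto
      then show "H \<subset> G" using H unfolding C'_def by blast
    qed (use H in auto)
  qed
  obtain i where i: "i \<in> G" "i \<notin> U" using U(4) by blast
  define P where "P = alpha ^ (d - Suc k) * (\<Prod>H\<in>C'. var H)"
  have Pin: "P \<in> polys_in V" unfolding P_def
    using alpha_in_polys C'(1) by (auto intro!: polys_in_mult polys_in_power polys_in_prod var_in_polys_in)
  have dk: "alpha ^ (d - k) = alpha ^ (d - Suc k) * alpha"
    using Suc.prems(4) by (metis Suc_diff_le diff_Suc_Suc power_Suc2)
  have PG: "P * var G = alpha ^ (d - Suc k) * (\<Prod>H\<in>C. var H)"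
    unfolding P_def C'_def prod.remove[OF finite G(1), of var] by (simp add: ac_simps)
  have IH: "P * alpha - alpha ^ d \<in> I"
    using Suc.IH[OF C' rkC'] Suc.prems(4) by (simp add: P_def dk ac_simps)
  have other: "P * var H \<in> I" if H: "H \<in> V" "i \<in> H" "H \<noteq> G" for H
  proof (cases "\<exists>K\<in>C'. \<not> K \<subseteq> H")
    case True
    then obtain K where K: "K \<in> C'" "\<not> K \<subseteq> H" by blast
    then have "\<not> H \<subseteq> K" using U(3) i(2) H(2) by blast
    then have "var K * var H \<in> I" using K C'(1) H(1) by (intro incomparable_in_chow_ideal) auto
    moreover have "alpha ^ (d - Suc k) * (\<Prod>F\<in>C' - {K}. var F) \<in> polys_in V"
      using alpha_in_polys C'(1) by (auto intro!: polys_in_mult polys_in_power polys_in_prod var_in_polys_in)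
    ultimately have "alpha ^ (d - Suc k) * (\<Prod>F\<in>C' - {K}. var F) * (var K * var H) \<in> I"
      using chow_ideal_mult by blast
    then show ?thesis unfolding P_def prod.remove[OF finite K(1), of var] by (simp add: ac_simps)
  next
    case False
    then have UH: "U \<subset> H" using U(5) i(2) H(2) by blast
    then have "Suc k \<le> rk H" using flat_rank_less[OF matroid U(1) UH] U(2) by simp
    moreover have "rk H \<noteq> Suc k"
    proof
      assume eq: "rk H = Suc k"
      have "rk (insert i U) = Suc k" using flat_rank_insert[OF matroid U(1) i(2)] U(2) by simp
      then have "H \<subseteq> G" "G \<subseteq> H"
        using flat_superset_same_rank[OF matroid flat_properD(1)[OF GV], of "insert i U" H]
          flat_superset_same_rank[OF matroid flat_properD(1)[OF H(1)], of "insert i U" G]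
          UH U(4) i H(2) eq G(2) by auto
      then show False using H(3) by blast
    qed
    ultimately have "d < d - Suc k + rk H" using Suc.prems(4) by simp
    then have "alpha ^ (d - Suc k) * var H \<in> I" by (rule alpha_power_var_in_ideal[OF H(1)])
    then have "(\<Prod>F\<in>C'. var F) * (alpha ^ (d - Suc k) * var H) \<in> I"
      by (intro chow_ideal_mult[of "\<Prod>F\<in>C'. var F"] polys_in_prod) (use C'(1) in \<open>auto intro: var_in_polys_in\<close>)
    then show ?thesis unfolding P_def by (simp add: ac_simps)
  qed
  have "star_sum i = var G + (\<Sum>H | H \<in> V \<and> i \<in> H \<and> H \<noteq> G. var H)"
  proof -
    have "{F. F \<in> V \<and> i \<in> F} = insert G {H. H \<in> V \<and> i \<in> H \<and> H \<noteq> G}" using GV i by blast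
    then show ?thesis unfolding star_sum_def by simp
  qed
  then have "P * star_sum i - P * var G = (\<Sum>H | H \<in> V \<and> i \<in> H \<and> H \<noteq> G. P * var H)"
    by (simp add: distrib_left sum_distrib_left)
  moreover have "(\<Sum>H | H \<in> V \<and> i \<in> H \<and> H \<noteq> G. P * var H) \<in> I" by (rule chow_ideal_sum) (simp add: other)
  ultimately have "P * star_sum i - P * var G \<in> I" by simp
  moreover have "P * (alpha - star_sum i) \<in> I" by (intro chow_ideal_mult Pin alpha_star_sum)
  ultimately have "(P * alpha - alpha ^ d) - (P * (alpha - star_sum i) + (P * star_sum i - P * var G)) \<in> I"
    by (rule chow_ideal_diff[OF IH chow_ideal_add, rotated])
  then have "P * var G - alpha ^ d \<in> I" by (simp add: algebra_simps)
  then show ?case by (simp only: PG)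
qed

end

section \<open>Maximal chains and the top graded piece\<close>

context loopless_matroid
begin

text \<open>If rank \<open>k\<close> were missing, take the largest member \<open>U\<close> below
  the gap and the smallest member \<open>W\<close> above it, with the empty and the full set as
  defaults. Adding one element of \<open>W\<close> to \<open>U\<close> and closing up gives a flat
  of rank at most \<open>k\<close> strictly between them, which would extend the chain.\<close>

lemma maxchain_ranks:
  assumes "subset.maxchain V C"
  shows "C \<subseteq> V" "\<And>F G. F \<in> C \<Longrightarrow> G \<in> C \<Longrightarrow> F \<subseteq> G \<or> G \<subseteq> F" "rk ` C = {1..d}"
proof -
  have ch: "subset.chain V C" using assms by (simp add: subset.maxchain_def)
  then show CV: "C \<subseteq> V" and chain: "\<And>F G. F \<in> C \<Longrightarrow> G \<in> C \<Longrightarrow> F \<subseteq> G \<or> G \<subseteq> F"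
    unfolding subset_chain_def by blast+
  have "k \<in> rk ` C" if k: "k \<in> {1..d}" for k
  proof (rule ccontr)
    assume nk: "k \<notin> rk ` C"
    obtain U where U: "flat M U" "rk U < k" "U = {} \<or> U \<in> C" "\<And>H. H \<in> C \<Longrightarrow> rk H < k \<Longrightarrow> H \<subseteq> U"
    proof (cases "{H \<in> C. rk H < k} = {}")
      case True
      then show thesis using that[of "{}"] loopless matroid k unfolding loopless_def by auto
    next
      case False
      then obtain H where H: "H \<in> C" "rk H < k" "\<And>K. K \<in> C \<Longrightarrow> rk K < k \<Longrightarrow> rk K \<le> rk H"
        using obtains_MAX[of "{H \<in> C. rk H < k}" rk] Max_ge
        by (smt (verit, ccfv_threshold) finite finite_imageI imageI mem_Collect_eq)
      show thesis
        by (rule that[of H]) (use H CV flat_properD(1) chain_rk_inj[OF CV chain] in blast)+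
    qed
    obtain W where W: "flat M W" "k < rk W" "\<And>H. H \<in> C \<Longrightarrow> k < rk H \<Longrightarrow> W \<subseteq> H" "W = UNIV \<or> W \<in> C"
    proof (cases "{H \<in> C. k < rk H} = {}")
      case True
      have "flat M UNIV" by (simp add: flat_def)
      then show thesis using that[of UNIV] True k rank_pos[OF matroid loopless] by auto
    next
      case False
      then obtain H where H: "H \<in> C" "k < rk H" "\<And>K. K \<in> C \<Longrightarrow> k < rk K \<Longrightarrow> rk H \<le> rk K"
        using obtains_MIN[of "{H \<in> C. k < rk H}" rk] Min_le
        by (smt (verit, ccfv_threshold) finite finite_imageI imageI mem_Collect_eq)
      show thesis
        by (rule that[of H]) (use H CV flat_properD(1) chain_rk_inj[OF CV chain] in blast)+
    qed
    have "U \<subseteq> W"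
    proof (cases "U = {} \<or> W = UNIV")
      case False
      then have "U \<in> C" "W \<in> C" using U(3) W(4) by auto
      then show ?thesis using chain_rk_inj[OF CV chain, of U W] U(2) W(2) by simp
    qed auto
    moreover have "U \<noteq> W" using U(2) W(2) by auto
    ultimately obtain i where i: "i \<in> W" "i \<notin> U" by blast
    define X where "X = closure_in M (insert i U)"
    have X: "flat M X" "insert i U \<subseteq> X" "rk X = Suc (rk U)"
      unfolding X_def using flat_closure_in[OF matroid] closure_in_extensive[of "insert i U" M]
        rank_of_closure_in[OF matroid] flat_rank_insert[OF matroid U(1) i(2)] by simp_all
    have "X \<subseteq> W"
      by (rule flat_superset_same_rank[OF matroid W(1), of "insert i U"])
        (use X i \<open>U \<subseteq> W\<close> flat_rank_insert[OF matroid U(1) i(2)] in auto)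
    have "rk X \<le> k" using X(3) U(2) by simp
    have "X \<noteq> UNIV" using \<open>rk X \<le> k\<close> k rank_pos[OF matroid loopless] by auto
    then have XV: "X \<in> V" using X by (auto simp: proper_flats_def)
    have comp: "H \<subset> X \<or> X \<subset> H" if H: "H \<in> C" for H
    proof (cases "rk H < k")
      case True
      then have "H \<subseteq> U" using U(4) H by blast
      then show ?thesis using X(2) i(2) by blast
    next
      case False
      then have "k < rk H" using nk H by (metis imageI linorder_neqE_nat)
      then have "X \<subseteq> H" using W(3)[OF H] \<open>X \<subseteq> W\<close> by blast
      moreover have "X \<noteq> H" using \<open>k < rk H\<close> \<open>rk X \<le> k\<close> by auto
      ultimately show ?thesis by blast
    qed
    then have "X \<notin> C" by blast
    moreover have "subset.chain V (insert X C)"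
      unfolding subset_chain_def using CV XV chain comp by blast
    ultimately show False using assms unfolding subset.maxchain_def by blast
  qed
  moreover have "rk ` C \<subseteq> {1..d}" using CV rk_proper_flat by fastforce
  ultimately show "rk ` C = {1..d}" by blast
qed

lemma maxchain_monomial_eq_alpha_power:
  assumes "subset.maxchain V C"
  shows "(\<Prod>G\<in>C. var G) - alpha ^ d \<in> I"
  using chain_monomial_eq_alpha_power[OF maxchain_ranks[OF assms]] by simp

definition top_span :: "('n set, real) mpoly set" where
  "top_span = {p. \<exists>c. p - const c * alpha ^ d \<in> I}"

lemma top_span_ideal: "p \<in> I \<Longrightarrow> p \<in> top_span"
  unfolding top_span_def by (auto intro: exI[of _ 0])

lemma top_span_add:
  assumes "p \<in> top_span" "q \<in> top_span"
  shows "p + q \<in> top_span"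
proof -
  obtain a b where "p - const a * alpha ^ d \<in> I" "q - const b * alpha ^ d \<in> I"
    using assms unfolding top_span_def by blast
  then have "(p - const a * alpha ^ d) + (q - const b * alpha ^ d) \<in> I" by (rule chow_ideal_add)
  also have "(p - const a * alpha ^ d) + (q - const b * alpha ^ d) = p + q - const (a + b) * alpha ^ d"
    by (simp add: const_add algebra_simps)
  finally show ?thesis unfolding top_span_def by blast
qed

lemma top_span_const_mult:
  assumes "p \<in> top_span"
  shows "const c * p \<in> top_span"
proof -
  obtain a where "p - const a * alpha ^ d \<in> I" using assms unfolding top_span_def by blast
  then have "const c * (p - const a * alpha ^ d) \<in> I" by (rule chow_ideal_mult[OF const_in_polys_in])
  also have "const c * (p - const a * alpha ^ d) = const c * p - const (c * a) * alpha ^ d"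
    by (simp add: const_mult algebra_simps)
  finally show ?thesis unfolding top_span_def by blast
qed

lemma top_span_uminus: "p \<in> top_span \<Longrightarrow> - p \<in> top_span"
proof -
  assume "p \<in> top_span"
  then have "const (-1) * p \<in> top_span" by (rule top_span_const_mult)
  moreover have "const (-1) = (- 1 :: ('n set, real) mpoly)" by (simp add: const_def single_uminus)
  ultimately show ?thesis by simp
qed

lemma top_span_sum: "(\<And>x. x \<in> A \<Longrightarrow> g x \<in> top_span) \<Longrightarrow> sum g A \<in> top_span"
  by (induction A rule: infinite_finite_induct) (auto intro: top_span_add top_span_ideal chow_ideal_0)

text \<open>
  A repeated factor \<open>x_F\<close> of a chain monomial is traded, by the linear relation for suitable \<open>i\<close>
  and \<open>j\<close> on the two sides of \<open>F\<close> in the chain, for variables outside the monomial; so the support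
  grows until the monomial is squarefree.
\<close>

lemma monomial_in_top_span:
  assumes "keys m \<subseteq> V" "(\<Sum>F\<in>UNIV. lookup m F) = d"
  shows "monomial m \<in> top_span"
  using assms
proof (induction "card (V - keys m)" arbitrary: m rule: less_induct)
  case less
  note mV = less.prems(1) and deg = less.prems(2)
  show ?case
  proof (cases "\<forall>F\<in>keys m. \<forall>G\<in>keys m. F \<subseteq> G \<or> G \<subseteq> F")
    case False
    then obtain F G where FG: "F \<in> keys m" "G \<in> keys m" "\<not> F \<subseteq> G" "\<not> G \<subseteq> F" by blast
    define m1 where "m1 = m - single F 1"
    have m1: "m = m1 + single F 1" unfolding m1_def by (rule monomial_split[OF FG(1)])
    have "F \<noteq> G" using FG by blast
    then have "G \<in> keys m1" using FG(2) unfolding m1_def by (simp add: in_keys_iff lookup_minus lookup_single)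
    define m2 where "m2 = m1 - single G 1"
    have m2: "m1 = m2 + single G 1" unfolding m2_def by (rule monomial_split[OF \<open>G \<in> keys m1\<close>])
    have "keys m2 \<subseteq> keys m" unfolding m2_def m1_def by (auto simp: in_keys_iff lookup_minus)
    then have "monomial m2 \<in> polys_in V" using mV by (intro monomial_in_polys_in) blast
    moreover have "var F * var G \<in> I" using FG mV by (intro incomparable_in_chow_ideal) auto
    ultimately have "monomial m2 * (var F * var G) \<in> I" by (rule chow_ideal_mult)
    moreover have "monomial m = monomial m2 * (var F * var G)"
      unfolding m1 m2 by (simp add: monomial_add var_eq_monomial ac_simps)
    ultimately show ?thesis using top_span_ideal by simp
  next
    case True
    then have chain: "\<And>F G. F \<in> keys m \<Longrightarrow> G \<in> keys m \<Longrightarrow> F \<subseteq> G \<or> G \<subseteq> F" by blast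
    show ?thesis
    proof (cases "\<forall>F\<in>keys m. lookup m F = 1")
      case True
      then have sq: "monomial m = (\<Prod>F\<in>keys m. var F)" by (intro monomial_squarefree) blast
      have "(\<Sum>F\<in>UNIV. lookup m F) = (\<Sum>F\<in>keys m. lookup m F)"
        by (rule sum.mono_neutral_right) (auto simp: in_keys_iff)
      \<comment> \<open>A squarefree chain monomial of degree \<open>d\<close> involves
        \<open>d\<close> flats; their ranks are distinct and lie between 1 and \<open>d\<close>, so
        every rank occurs.\<close>
      then have card: "card (keys m) = d" using deg True by simp
      have "inj_on rk (keys m)"
        using chain_rk_inj[OF mV chain] by (intro inj_onI) (metis order_refl subset_antisym)
      then have "card (rk ` keys m) = d" using card by (simp add: card_image)
      moreover have "rk ` keys m \<subseteq> {1..d}" using mV rk_proper_flat by fastforce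
      ultimately have "rk ` keys m = {1..d}" by (intro card_subset_eq) auto
      then have "monomial m - alpha ^ d \<in> I"
        using chain_monomial_eq_alpha_power[OF mV chain, of d] sq by simp
      then show ?thesis unfolding top_span_def by (auto intro: exI[of _ 1])
    next
      case False
      then obtain F where F: "F \<in> keys m" "lookup m F \<noteq> 1" by blast
      then have F2: "2 \<le> lookup m F" by (simp add: in_keys_iff)
      have FV: "F \<in> V" using F(1) mV by blast
      \<comment> \<open>Since the support is a chain, avoiding the largest member below
        \<open>F\<close> is enough to avoid all members below it; likewise \<open>j\<close> is taken
        from the smallest member above \<open>F\<close>.\<close>
      obtain i where i: "i \<in> F" "\<And>H. H \<in> keys m \<Longrightarrow> H \<subset> F \<Longrightarrow> i \<notin> H"
      proof (cases "{H \<in> keys m. H \<subset> F} = {}")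
        case True
        then show thesis using that flat_properD(2)[OF FV] by blast
      next
        case False
        from finite_has_maximal[OF finite False] obtain K where
          K: "K \<in> keys m" "K \<subset> F" "\<forall>H\<in>{H \<in> keys m. H \<subset> F}. K \<subseteq> H \<longrightarrow> K = H" by blast
        obtain i where "i \<in> F" "i \<notin> K" using K(2) by blast
        moreover have "H \<subseteq> K" if "H \<in> keys m" "H \<subset> F" for H using that K chain[of H K] by blast
        ultimately show thesis by (intro that[of i]) (assumption, blast)
      qed
      obtain j where j: "j \<notin> F" "\<And>H. H \<in> keys m \<Longrightarrow> F \<subset> H \<Longrightarrow> j \<in> H"
      proof (cases "{H \<in> keys m. F \<subset> H} = {}")
        case True
        then show thesis using that flat_properD(3)[OF FV] by blast
      next
        case False
        from finite_has_minimal[OF finite False] obtain K where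
          K: "K \<in> keys m" "F \<subset> K" "\<forall>H\<in>{H \<in> keys m. F \<subset> H}. H \<subseteq> K \<longrightarrow> K = H" by blast
        obtain j where "j \<notin> F" "j \<in> K" using K(2) by blast
        moreover have "K \<subseteq> H" if "H \<in> keys m" "F \<subset> H" for H using that K chain[of H K] by blast
        ultimately show thesis by (intro that[of j]) (assumption, blast)
      qed
      define m' where "m' = m - single F 1"
      have m': "m = m' + single F 1" unfolding m'_def by (rule monomial_split[OF F(1)])
      have keys': "keys m' = keys m"
        using F2 by (auto simp: m'_def in_keys_iff lookup_minus lookup_single when_def)
      have new: "monomial m' * var G \<in> top_span" if G: "G \<in> V" "G \<notin> keys m" for G
      proof -
        have eq: "monomial m' * var G = monomial (m' + single G 1)" by (simp add: monomial_add var_eq_monomial)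
        have kk: "keys (m' + single G 1) = insert G (keys m)"
          unfolding keys'[symmetric] by (auto simp: in_keys_iff lookup_add lookup_single when_def split: if_splits)
        have "V - insert G (keys m) \<subset> V - keys m" using G by blast
        then have "card (V - keys (m' + single G 1)) < card (V - keys m)"
          unfolding kk by (intro psubset_card_mono) auto
        moreover have "(\<Sum>H\<in>UNIV. lookup (m' + single G 1) H) = d"
        proof -
          have one: "(\<Sum>H\<in>UNIV. lookup (single K (1::nat)) H) = 1" for K :: "'n set"
            by (simp add: lookup_single when_def)
          have "(\<Sum>H\<in>UNIV. lookup (m' + single K 1) H) = (\<Sum>H\<in>UNIV. lookup m' H) + 1" for K
            by (simp only: lookup_add sum.distrib one)
          from this[of G] this[of F] show ?thesis using deg m' by metis
        qed
        ultimately show ?thesis unfolding eq using less.hyps kk mV G(1) by simp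
      qed
      let ?A = "{G \<in> V. i \<in> G \<and> j \<notin> G \<and> G \<noteq> F}" and ?B = "{G \<in> V. j \<in> G \<and> i \<notin> G}"
      have star: "star_sum i - star_sum j = var F + sum var ?A - sum var ?B"
      proof -
        let ?D = "{G \<in> V. i \<in> G \<and> j \<in> G}"
        have "{G. G \<in> V \<and> i \<in> G} = insert F (?A \<union> ?D)" using FV i(1) j(1) by blast
        moreover have "F \<notin> ?A \<union> ?D" using j(1) by blast
        ultimately have "star_sum i = var F + sum var (?A \<union> ?D)" unfolding star_sum_def by simp
        also have "sum var (?A \<union> ?D) = sum var ?A + (sum var ?D :: ('n set, real) mpoly)"
          by (rule sum.union_disjoint) auto
        finally have si: "star_sum i = var F + (sum var ?A + sum var ?D)" .
        have "{G. G \<in> V \<and> j \<in> G} = ?B \<union> ?D" by blast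
        then have "star_sum j = sum var (?B \<union> ?D)" unfolding star_sum_def by simp
        also have "sum var (?B \<union> ?D) = sum var ?B + (sum var ?D :: ('n set, real) mpoly)"
          by (rule sum.union_disjoint) auto
        finally show ?thesis using si by simp
      qed
      have "monomial m' \<in> polys_in V" using keys' mV by (intro monomial_in_polys_in) simp
      then have "monomial m' * (star_sum i - star_sum j) \<in> I"
        by (rule chow_ideal_mult) (rule star_sum_diff_in_chow_ideal)
      then have 1: "monomial m' * (star_sum i - star_sum j) \<in> top_span" by (rule top_span_ideal)
      \<comment> \<open>A member of the support containing \<open>i\<close> is \<open>F\<close> or
        lies above it, and in the latter case contains \<open>j\<close>; one containing
        \<open>j\<close> lies above \<open>F\<close> and so contains \<open>i\<close>. Hence
        \<open>F\<close> is the only member that the two linear forms do not share.\<close>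
      have "G \<notin> keys m" if "G \<in> ?A" for G using that i(2)[of G] j(2)[of G] chain[OF F(1), of G] by blast
      then have 2: "(\<Sum>G\<in>?A. monomial m' * var G) \<in> top_span" by (intro top_span_sum new) auto
      have "G \<notin> keys m" if "G \<in> ?B" for G using that i(1) j(1) chain[OF F(1), of G] by blast
      then have 3: "(\<Sum>G\<in>?B. monomial m' * var G) \<in> top_span" by (intro top_span_sum new) auto
      have "monomial m = monomial m' * (star_sum i - star_sum j) + - (\<Sum>G\<in>?A. monomial m' * var G) +
          (\<Sum>G\<in>?B. monomial m' * var G)"
        unfolding star by (subst m') (simp add: monomial_add var_eq_monomial sum_distrib_left algebra_simps)
      then show ?thesis using 1 2 3 by (simp add: top_span_add top_span_uminus del: add_uminus_conv_diff)
    qed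
  qed
qed

lemma homogeneous_in_top_span:
  assumes "p \<in> polys_in V" "homogeneous d p"
  shows "p \<in> top_span"
proof -
  have "(\<Sum>m\<in>keys p. const (lookup p m) * monomial m) \<in> top_span"
    using assms unfolding polys_in_def homogeneous_iff
    by (intro top_span_sum top_span_const_mult monomial_in_top_span) auto
  then show ?thesis using mpoly_sum_monomials[of p] by simp
qed

section \<open>The functional vanishes on the relations of the Chow ring\<close>

abbreviation "P \<equiv> matroid_polytope M"

definition chow_functional :: "('n set, real) mpoly \<Rightarrow> real" where
  "chow_functional p = monomial_functional (hits P) (poly_subst simplicial_form p)"

text \<open>Some \<open>i\<close> outside \<open>S\<close> is in the closure of \<open>S\<close>,
  hence in the closure of every larger set, so each difference in the pairing along \<open>i\<close>
  lies in the radical.\<close>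

lemma simplicial_form_nonflat:
  assumes "\<not> flat M S"
  shows "simplicial_form S \<in> radical_ideal (hits P)"
proof -
  obtain i where i: "i \<notin> S" "\<not> rk S < rk (insert i S)" using assms unfolding flat_def by blast
  then have eq: "rk (insert i S) = rk S"
    using rank_of_mono[OF matroid subset_insertI[of S i]] by simp
  show ?thesis
    by (rule simplicial_form_in_radical[OF i(1)])
      (auto intro!: closure_pair_in_radical[OF matroid] simp: closure_in_def rank_of_insert_mono[OF matroid eq])
qed

lemma convex_P: "convex P"
  by (simp add: matroid_polytope_def)

lemma simplicial_form_incomparable:
  assumes "\<not> F \<subseteq> G" "\<not> G \<subseteq> F"
  shows "simplicial_form F * simplicial_form G \<in> radical_ideal (hits P)"
proof -
  obtain i j where ij: "j \<in> F" "j \<notin> G" "i \<in> G" "i \<notin> F" using assms by blast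
  show ?thesis
    by (rule simplicial_form_mult_in_radical[OF ij(4,2)])
      (use ij in \<open>auto intro!: incomparable_pair_in_radical[OF convex_P]\<close>)
qed

text \<open>The forms of all sets containing \<open>i\<close> add up to \<open>- var {i}\<close>,
  which lies in the radical, as do the forms of the non-flats. What is left is the linear form at
  \<open>i\<close> and the form \<open>- var UNIV\<close> of the full set; so the image does not
  depend on \<open>i\<close> modulo the radical.\<close>

lemma poly_subst_star_sum: "poly_subst simplicial_form (star_sum i) - var UNIV \<in> radical_ideal (hits P)"
proof -
  let ?N = "{S. i \<in> S \<and> \<not> flat M S}"
  have "flat M UNIV" by (simp add: flat_def)
  then have "{S. i \<in> S} = insert UNIV ({F. F \<in> V \<and> i \<in> F} \<union> ?N)" "UNIV \<notin> {F. F \<in> V \<and> i \<in> F} \<union> ?N"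
    by (auto simp: proper_flats_def)
  then have "(\<Sum>S | i \<in> S. simplicial_form S) = simplicial_form UNIV + (\<Sum>S\<in>{F. F \<in> V \<and> i \<in> F} \<union> ?N. simplicial_form S)"
    by simp
  also have "(\<Sum>S\<in>{F. F \<in> V \<and> i \<in> F} \<union> ?N. simplicial_form S) =
      (\<Sum>S | S \<in> V \<and> i \<in> S. simplicial_form S) + (\<Sum>S\<in>?N. simplicial_form S)"
    by (rule sum.union_disjoint) (auto simp: proper_flats_def)
  finally have "(\<Sum>S | S \<in> V \<and> i \<in> S. simplicial_form S) - var UNIV = - var {i} - (\<Sum>S\<in>?N. simplicial_form S)"
    by (simp add: sum_simplicial_form simplicial_form_UNIV algebra_simps)
  moreover have "var {i} \<in> radical_ideal (hits P)"
    by (rule var_singleton_in_radical) (rule matroid_polytope_nth_bounds)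
  moreover have "(\<Sum>S\<in>?N. simplicial_form S) \<in> radical_ideal (hits P)"
    by (intro radical_ideal_sum simplicial_form_nonflat) auto
  ultimately show ?thesis
    by (simp add: star_sum_def poly_subst_sum poly_subst_var radical_ideal_diff radical_ideal_uminus)
qed

lemma poly_subst_chow_ideal:
  assumes "p \<in> I"
  shows "poly_subst simplicial_form p \<in> radical_ideal (hits P)"
proof -
  define J where "J = {p \<in> polys_in V. poly_subst simplicial_form p \<in> radical_ideal (hits P)}"
  have "I \<subseteq> J"
  proof (rule chow_ideal_minimal)
    show "ideal J (poly_ring V)"
      by (rule ideal_poly_ringI)
        (auto simp: J_def poly_subst_add poly_subst_mult polys_in_add polys_in_mult
          intro: radical_ideal_add radical_ideal_mult)
    show "var F * var G \<in> J" if "F \<in> V" "G \<in> V" "\<not> F \<subseteq> G" "\<not> G \<subseteq> F" for F G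
      using that by (simp add: J_def poly_subst_mult poly_subst_var polys_in_mult var_in_polys_in simplicial_form_incomparable)
    show "star_sum i - star_sum j \<in> J" for i j
      using radical_ideal_diff[OF poly_subst_star_sum[of i] poly_subst_star_sum[of j]]
      by (simp add: J_def poly_subst_diff polys_in_diff star_sum_in_polys)
  qed
  then show ?thesis using assms unfolding J_def by blast
qed

lemma chow_functional_ideal: "p \<in> I \<Longrightarrow> chow_functional p = 0"
  unfolding chow_functional_def by (intro radical_ideal_vanishes poly_subst_chow_ideal)

lemma chow_functional_0 [simp]: "chow_functional 0 = 0"
  by (simp add: chow_functional_def)

lemma chow_functional_add: "chow_functional (p + q) = chow_functional p + chow_functional q"
  by (simp add: chow_functional_def poly_subst_add monomial_functional_add)

lemma chow_functional_diff: "chow_functional (p - q) = chow_functional p - chow_functional q"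
  by (simp add: chow_functional_def poly_subst_diff monomial_functional_diff)

lemma chow_functional_const_mult: "chow_functional (const c * p) = c * chow_functional p"
  by (simp add: chow_functional_def poly_subst_mult poly_subst_const monomial_functional_const_mult)

text \<open>Modulo the radical \<open>alpha\<close> becomes \<open>var UNIV\<close>, so the value is
  the hit of the \<open>d\<close>-fold full simplex. Here looplessness enters: it makes the top
  piece nonzero.\<close>

lemma chow_functional_alpha_power: "chow_functional (alpha ^ d) = 1"
proof -
  let ?a = "poly_subst simplicial_form alpha"
  have "?a ^ k - var UNIV ^ k \<in> radical_ideal (hits P)" for k
  proof (induction k)
    case (Suc k)
    have "?a ^ Suc k - var UNIV ^ Suc k = ?a * (?a ^ k - var UNIV ^ k) + var UNIV ^ k * (?a - var UNIV)"
      by (simp add: algebra_simps)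
    moreover have "?a - var UNIV \<in> radical_ideal (hits P)" unfolding alpha_def by (rule poly_subst_star_sum)
    ultimately show ?case using Suc by (simp only: radical_ideal_add radical_ideal_mult)
  qed simp
  then have "monomial_functional (hits P) (?a ^ d) = monomial_functional (hits P) (var UNIV ^ d)"
    using radical_ideal_vanishes by (metis monomial_functional_diff eq_iff_diff_eq_0)
  also have "(var UNIV :: ('n set, real) mpoly) ^ k = monomial (single UNIV k)" for k
  proof (induction k)
    case (Suc k)
    have "single (UNIV :: 'n set) (Suc k) = single UNIV 1 + single UNIV k" by (simp add: single_add[symmetric])
    then show ?case using Suc by (simp add: monomial_add var_eq_monomial)
  qed simp
  finally show ?thesis
    using hits_loopless[OF matroid loopless] by (simp add: chow_functional_def poly_subst_power)
qed

section \<open>Residue classes and the degree map\<close>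

abbreviation "cls \<equiv> chow_class M"

lemma chow_class_eq: "cls p = {h + p | h. h \<in> I}"
  unfolding chow_class_def flat_ring_eq a_r_coset_def' by auto

lemma chow_class_eq_iff: "cls p = cls q \<longleftrightarrow> p - q \<in> I"
proof
  assume "cls p = cls q"
  moreover have "0 + p \<in> cls p" unfolding chow_class_eq using chow_ideal_0 by blast
  ultimately obtain h where "h \<in> I" "0 + p = h + q" unfolding chow_class_eq by blast
  then show "p - q \<in> I" by simp
next
  have sub: "cls p \<subseteq> cls q" if "p - q \<in> I" for p q
  proof
    fix x assume "x \<in> cls p"
    then obtain h where h: "h \<in> I" "x = h + p" unfolding chow_class_eq by blast
    then have "x = (h + (p - q)) + q" "h + (p - q) \<in> I" using chow_ideal_add[OF h(1) that] by simp_all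
    then show "x \<in> cls q" unfolding chow_class_eq by blast
  qed
  assume "p - q \<in> I"
  then show "cls p = cls q" using sub[of p q] sub[of q p] chow_ideal_uminus[of "p - q"] by simp
qed

lemma chow_class_add: "add (chow_ring M) (cls p) (cls q) = cls (p + q)"
proof -
  have "add (chow_ring M) (cls p) (cls q) = {a + b | a b. a \<in> cls p \<and> b \<in> cls q}"
    unfolding chow_ring_def FactRing_def flat_ring_eq by (auto simp: set_add_def')
  also have "\<dots> = cls (p + q)"
  proof (intro equalityI subsetI)
    fix x assume "x \<in> {a + b | a b. a \<in> cls p \<and> b \<in> cls q}"
    then obtain h k where "h \<in> I" "k \<in> I" "x = (h + p) + (k + q)" unfolding chow_class_eq by blast
    then have "x = (h + k) + (p + q)" "h + k \<in> I" by (simp_all add: chow_ideal_add ac_simps)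
    then show "x \<in> cls (p + q)" unfolding chow_class_eq by blast
  next
    fix x assume "x \<in> cls (p + q)"
    then obtain h where "h \<in> I" "x = (h + p) + (0 + q)" unfolding chow_class_eq by (auto simp: ac_simps)
    then show "x \<in> {a + b | a b. a \<in> cls p \<and> b \<in> cls q}" unfolding chow_class_eq using chow_ideal_0 by blast
  qed
  finally show ?thesis .
qed

lemma chow_class_mult:
  assumes "p \<in> polys_in V" "q \<in> polys_in V"
  shows "monoid.mult (chow_ring M) (cls p) (cls q) = cls (p * q)"
  using ideal.rcoset_mult_add[OF ideal_chow, of p q] assms
  by (simp add: chow_ring_def FactRing_def flat_ring_eq chow_class_def)

lemma chow_graded_eq: "chow_graded M d = cls ` {p \<in> polys_in V. homogeneous d p}"
  by (simp add: chow_graded_def flat_ring_eq)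

lemma homogeneous_alpha_power: "homogeneous d (const c * alpha ^ d)"
proof -
  have "homogeneous (d * 1) (alpha ^ d)" by (rule homogeneous_power) (simp only: alpha_def homogeneous_star_sum)
  then show ?thesis using homogeneous_mult[OF homogeneous_const[of c], of d "alpha ^ d"] by simp
qed

lemma alpha_power_in_polys: "const c * alpha ^ d \<in> polys_in V"
  by (intro polys_in_mult polys_in_power alpha_in_polys const_in_polys_in)

lemma top_degree_class:
  assumes "p \<in> polys_in V" "homogeneous d p"
  shows "cls p = cls (const (chow_functional p) * alpha ^ d)"
proof -
  obtain c where c: "p - const c * alpha ^ d \<in> I"
    using homogeneous_in_top_span[OF assms] unfolding top_span_def by blast
  then have "chow_functional p = c"
    using chow_functional_ideal[OF c]
    by (simp add: chow_functional_diff chow_functional_const_mult chow_functional_alpha_power)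
  then show ?thesis using c chow_class_eq_iff by simp
qed

text \<open>A top-degree class is a multiple of that of \<open>alpha ^ d\<close>, and the functional
  reads off the factor; this gives a bijection onto the reals. Any degree map is 1 on the class of
  \<open>alpha ^ d\<close>, which is that of every maximal chain, so there is only one.\<close>

lemma chow_degree_eq_functional:
  assumes "p \<in> polys_in V" "homogeneous d p"
  shows "chow_degree M (cls p) = chow_functional p"
proof -
  let ?H = "{p \<in> polys_in V. homogeneous d p}"
  \<comment> \<open>The choice of the representative is harmless because the functional vanishes on
    the ideal.\<close>
  define \<phi> where "\<phi> = restrict (\<lambda>a. chow_functional (SOME p. p \<in> ?H \<and> cls p = a)) (chow_graded M d)"
  have \<phi>: "\<phi> (cls p) = chow_functional p" if "p \<in> ?H" for p
  proof -
    have "(SOME q. q \<in> ?H \<and> cls q = cls p) \<in> ?H \<and> cls (SOME q. q \<in> ?H \<and> cls q = cls p) = cls p"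
      by (rule someI[of "\<lambda>q. q \<in> ?H \<and> cls q = cls p" p]) (use that in simp)
    then have "chow_functional ((SOME q. q \<in> ?H \<and> cls q = cls p) - p) = 0"
      by (intro chow_functional_ideal) (simp only: chow_class_eq_iff[symmetric])
    then have "chow_functional (SOME q. q \<in> ?H \<and> cls q = cls p) = chow_functional p"
      by (simp add: chow_functional_diff)
    moreover have "cls p \<in> chow_graded M d" unfolding chow_graded_eq using that by blast
    ultimately show ?thesis unfolding \<phi>_def by simp
  qed
  have alphaH: "const c * alpha ^ d \<in> ?H" for c by (simp add: alpha_power_in_polys homogeneous_alpha_power)
  have chainclass: "cls (\<Prod>G\<in>C. var G) = cls (const 1 * alpha ^ d)" if "subset.maxchain V C" for C
    using maxchain_monomial_eq_alpha_power[OF that] by (simp add: chow_class_eq_iff)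
  have \<phi>_const: "\<phi> (cls (const c * alpha ^ d)) = c" for c
    using \<phi>[OF alphaH[of c]] by (simp add: chow_functional_const_mult chow_functional_alpha_power)
  have deg: "is_degree_map M \<phi>"
    unfolding is_degree_map_def
  proof (intro conjI ballI allI impI)
    show "\<phi> \<in> extensional (chow_graded M d)" unfolding \<phi>_def by simp
    show "\<phi> (add (chow_ring M) a b) = \<phi> a + \<phi> b"
      if a: "a \<in> chow_graded M d" and b: "b \<in> chow_graded M d" for a b
    proof -
      obtain p where p: "p \<in> ?H" "a = cls p" using a unfolding chow_graded_eq by blast
      obtain q where q: "q \<in> ?H" "b = cls q" using b unfolding chow_graded_eq by blast
      note pq = p q
      have "p + q \<in> ?H" using pq by (simp add: polys_in_add homogeneous_add)
      then show ?thesis using \<phi> pq by (simp add: chow_class_add chow_functional_add)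
    qed
    show "\<phi> (monoid.mult (chow_ring M) (cls (const c)) a) = c * \<phi> a" if a: "a \<in> chow_graded M d" for c a
    proof -
      obtain p where p: "p \<in> ?H" "a = cls p" using a unfolding chow_graded_eq by blast
      then have "const c * p \<in> ?H"
        using homogeneous_mult[OF homogeneous_const[of c], of d p] by (simp add: polys_in_mult)
      moreover have "monoid.mult (chow_ring M) (cls (const c)) a = cls (const c * p)"
        using p by (simp add: chow_class_mult)
      ultimately show ?thesis using \<phi>[of "const c * p"] \<phi>[of p] p by (simp add: chow_functional_const_mult)
    qed
    show "bij_betw \<phi> (chow_graded M d) UNIV"
      unfolding bij_betw_def
    proof
      show "inj_on \<phi> (chow_graded M d)"
      proof (rule inj_onI)
        fix a b assume "a \<in> chow_graded M d" "b \<in> chow_graded M d" and eq: "\<phi> a = \<phi> b"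
        then obtain p q where pq: "p \<in> ?H" "a = cls p" "q \<in> ?H" "b = cls q"
          unfolding chow_graded_eq by (elim imageE)
        then have "chow_functional p = chow_functional q" using \<phi> eq by simp
        then show "a = b" using top_degree_class[of p] top_degree_class[of q] pq by simp
      qed
      have "c \<in> \<phi> ` chow_graded M d" for c
      proof (rule image_eqI)
        show "c = \<phi> (cls (const c * alpha ^ d))" by (simp only: \<phi>_const)
        show "cls (const c * alpha ^ d) \<in> chow_graded M d"
          unfolding chow_graded_eq by (rule imageI) (rule alphaH)
      qed
      then show "\<phi> ` chow_graded M d = UNIV" by blast
    qed
    show "\<phi> (cls (\<Prod>G\<in>C. var G)) = 1" if "subset.maxchain V C" for C
      using chainclass[OF that] \<phi>_const[of 1] by simp
  qed
  have uniq: "\<psi> = \<phi>" if \<psi>: "is_degree_map M \<psi>" for \<psi>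
  proof (rule extensionalityI)
    show "\<psi> \<in> extensional (chow_graded M d)" "\<phi> \<in> extensional (chow_graded M d)"
      using \<psi> deg unfolding is_degree_map_def by blast+
    fix a assume a: "a \<in> chow_graded M d"
    obtain p where p: "p \<in> ?H" "a = cls p" using a unfolding chow_graded_eq by blast
    \<comment> \<open>Some maximal chain is needed for the normalisation to say anything about
      \<open>\<psi>\<close>.\<close>
    obtain C where C: "subset.maxchain V C" using subset.Hausdorff by blast
    have one: "cls (const 1 * alpha ^ d) \<in> chow_graded M d" unfolding chow_graded_eq using alphaH by blast
    have "a = cls (const (chow_functional p) * alpha ^ d)" using top_degree_class p by simp
    also have "\<dots> = monoid.mult (chow_ring M) (cls (const (chow_functional p))) (cls (const 1 * alpha ^ d))"
      using chow_class_mult[OF const_in_polys_in[of "chow_functional p"] alpha_power_in_polys[of 1]] by simp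
    finally have "\<psi> a = chow_functional p * \<psi> (cls (const 1 * alpha ^ d))"
      using \<psi> one unfolding is_degree_map_def by metis
    also have "\<psi> (cls (const 1 * alpha ^ d)) = 1"
      using \<psi> C chainclass[OF C] unfolding is_degree_map_def by metis
    finally show "\<psi> a = \<phi> a" using \<phi>[OF p(1)] p(2) by simp
  qed
  have "chow_degree M = \<phi>" unfolding chow_degree_def using deg uniq by (rule the_equality)
  then show ?thesis using \<phi> assms by simp
qed

end

text \<open>Coefficients of a product are sums of products of coefficients. This serves both to
  track degrees in powers of the divisor and to compare two divisors modulo an ideal of
  coefficients.\<close>

lemma lookup_mult_closed:
  fixes p q :: "'a::monoid_add \<Rightarrow>\<^sub>0 'b::comm_semiring_1"
  assumes zero: "0 \<in> S" and add: "\<And>x y. x \<in> S \<Longrightarrow> y \<in> S \<Longrightarrow> x + y \<in> S"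
    and mult: "\<And>k m. lookup p k * lookup q m \<in> S"
  shows "lookup (p * q) n \<in> S"
proof -
  have sum: "sum f A \<in> S" if "\<And>x. x \<in> A \<Longrightarrow> f x \<in> S" for f :: "'c \<Rightarrow> 'b" and A
    using that by (induction A rule: infinite_finite_induct) (auto intro: zero add)
  have "p * q = (\<Sum>k\<in>keys p. \<Sum>m\<in>keys q. single (k + m) (lookup p k * lookup q m))"
    by (subst poly_mapping_eq_sum_single[of p], subst poly_mapping_eq_sum_single[of q]) (simp add: sum_product mult_single)
  then have "lookup (p * q) n = (\<Sum>k\<in>keys p. \<Sum>m\<in>keys q. lookup (single (k + m) (lookup p k * lookup q m)) n)"
    by (simp add: lookup_sum)
  also have "\<dots> \<in> S" using zero mult by (intro sum) (simp add: lookup_single when_def)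
  finally show ?thesis .
qed

subsection \<open>The volume polynomial\<close>

text \<open>
  Summing over all proper nonempty subsets instead of the flats makes the coefficients of the powers
  independent of the matroid; the terms of the non-flats are killed by \<open>chow_functional\<close>.
\<close>

definition generic_divisor :: "('n::finite set, ('n set, real) mpoly) mpoly" where
  "generic_divisor = (\<Sum>S\<in>UNIV - {{}, UNIV}. const (var S) * var S)"

lemma const_var_mult_var:
  "const (var S :: ('v, real) mpoly) * var S = single (single S 1) (var S)"
  by (simp add: const_def var_def[of S] mult_single)

context loopless_matroid
begin

lemma lookup_volume_polynomial:
  "lookup (volume_polynomial M) m = chow_functional (lookup (generic_divisor ^ d) m)"
proof -
  define W where "W = (\<Sum>F\<in>V. const (var F) * var F :: ('n set, ('n set, real) mpoly) mpoly)"
  \<comment> \<open>Coefficients of the \<open>k\<close>-th power lie in the degree \<open>k\<close>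
    part, so for \<open>k = d\<close> the degree map may be replaced by the functional.\<close>
  define H where "H k = {p :: ('n set, real) mpoly. p \<in> polys_in V \<and> homogeneous k p}" for k
  have W_in: "lookup W n \<in> H 1" for n
    unfolding W_def H_def const_var_mult_var lookup_sum
    by (intro CollectI conjI polys_in_sum homogeneous_sum)
      (auto simp: lookup_single when_def var_in_polys_in homogeneous_var[simplified])
  have pow: "lookup (W ^ k) n \<in> H k" for k n
  proof (induction k arbitrary: n)
    case 0
    then show ?case by (simp add: H_def lookup_one when_def)
  next
    case (Suc k)
    have "lookup W a * lookup (W ^ k) b \<in> H (Suc k)" for a b
      using W_in[of a] Suc[of b] homogeneous_mult[of 1 "lookup W a" k "lookup (W ^ k) b"]
      by (simp add: H_def polys_in_mult)
    then show ?case unfolding power_Suc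
      by (intro lookup_mult_closed) (auto simp: H_def polys_in_add homogeneous_add)
  qed
  \<comment> \<open>An ideal in all variables, not only those of flats: it is the preimage of the
    radical, and the variables of the non-flats belong to it.\<close>
  define J where "J = {p. poly_subst simplicial_form p \<in> radical_ideal (hits P)}"
  have J: "0 \<in> J" "\<And>x y. x \<in> J \<Longrightarrow> y \<in> J \<Longrightarrow> x + y \<in> J" "\<And>r x. x \<in> J \<Longrightarrow> r * x \<in> J"
    by (simp_all add: J_def poly_subst_add poly_subst_mult radical_ideal_add radical_ideal_mult)
  have J_sum: "sum f A \<in> J" if "\<And>x. x \<in> A \<Longrightarrow> f x \<in> J" for f :: "'n set \<Rightarrow> _" and A
    using that by (induction A rule: infinite_finite_induct) (auto intro: J)
  have diff: "lookup (generic_divisor - W) n \<in> J" for n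
  proof -
    have "generic_divisor - W = (\<Sum>S\<in>(UNIV - {{}, UNIV}) - V. const (var S) * var S)"
      unfolding generic_divisor_def W_def by (rule sum_diff[symmetric]) (auto simp: proper_flats_def)
    then have "lookup (generic_divisor - W) n =
        (\<Sum>S\<in>(UNIV - {{}, UNIV}) - V. lookup (single (single S 1) (var S)) n)"
      by (simp add: const_var_mult_var lookup_sum)
    also have "\<dots> \<in> J"
      by (rule J_sum) (auto simp: lookup_single when_def J(1) J_def poly_subst_var proper_flats_def
          intro!: simplicial_form_nonflat)
    finally show ?thesis .
  qed
  have "lookup (generic_divisor ^ k - W ^ k) n \<in> J" for k n
  proof (induction k arbitrary: n)
    case 0
    then show ?case by (simp add: J)
  next
    case (Suc k)
    have eq: "generic_divisor ^ Suc k - W ^ Suc k =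
        generic_divisor * (generic_divisor ^ k - W ^ k) + W ^ k * (generic_divisor - W)"
      by (simp add: algebra_simps)
    have "lookup (generic_divisor * (generic_divisor ^ k - W ^ k)) n \<in> J"
      "lookup (W ^ k * (generic_divisor - W)) n \<in> J"
      using Suc diff by (intro lookup_mult_closed J; blast)+
    then show ?case unfolding eq lookup_add by (rule J)
  qed
  then have "lookup (generic_divisor ^ d) m - lookup (W ^ d) m \<in> J" by (simp add: lookup_minus)
  then have "poly_subst simplicial_form (lookup (generic_divisor ^ d) m - lookup (W ^ d) m) \<in> radical_ideal (hits P)"
    by (simp add: J_def)
  then have "chow_functional (lookup (generic_divisor ^ d) m - lookup (W ^ d) m) = 0"
    unfolding chow_functional_def by (rule radical_ideal_vanishes)
  then have eq: "chow_functional (lookup (generic_divisor ^ d) m) = chow_functional (lookup (W ^ d) m)"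
    by (simp add: chow_functional_diff)
  \<comment> \<open>\<open>Poly_Mapping.map\<close> leaves zero coefficients zero whatever the
    mapped function does there; this agrees with the value of the functional at 0.\<close>
  have "lookup (volume_polynomial M) m = (chow_degree M (cls (lookup (W ^ d) m)) when lookup (W ^ d) m \<noteq> 0)"
    by (simp add: volume_polynomial_def W_def Poly_Mapping.map.rep_eq)
  also have "\<dots> = chow_functional (lookup (W ^ d) m)"
    using pow[of d m] chow_degree_eq_functional[of "lookup (W ^ d) m"] by (auto simp: H_def when_def)
  finally show ?thesis using eq by simp
qed

end

lemma lookup_neg_one_power_mult:
  "lookup ((-1) ^ k * p) m = (-1) ^ k * lookup (p :: ('v, real) mpoly) m"
proof -
  have "(-1) ^ k = (const ((-1) ^ k) :: ('v, real) mpoly)"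
    by (cases "even k") (simp_all add: const_def single_uminus)
  then show ?thesis by (simp add: lookup_const_mult)
qed

theorem proposition4p6:
  fixes M :: "'n::finite set set" and \<S> :: "(real ^ 'n) set set"
  assumes "matroid M" and "loopless M" and "matroid_subdivision M \<S>"
  shows "volume_polynomial M =
    (\<Sum>Q\<in>interior_faces (matroid_polytope M) \<S>.
       (-1) ^ nat (aff_dim (matroid_polytope M) - aff_dim Q) *
       volume_polynomial (matroid_of_polytope Q))"
proof (rule poly_mapping_eqI)
  fix m :: "'n set \<Rightarrow>\<^sub>0 nat"
  interpret M: loopless_matroid M using assms by (simp add: loopless_matroid_def)
  let ?\<F> = "interior_faces (matroid_polytope M) \<S>"
  let ?s = "\<lambda>Q. (-1) ^ nat (aff_dim (matroid_polytope M) - aff_dim Q) :: real"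
  \<comment> \<open>This polynomial depends on the matroid only through its rank, which the matroids
    of the interior faces share with \<open>M\<close>; so one and the same \<open>?c\<close> is
    evaluated for all of them.\<close>
  let ?c = "poly_subst simplicial_form (lookup (generic_divisor ^ top_degree M) m)"
  have face: "lookup (volume_polynomial (matroid_of_polytope Q)) m = monomial_functional (hits Q) ?c"
    if Q: "Q \<in> ?\<F>" for Q
  proof -
    obtain N where N: "matroid N" "loopless N" "Q = matroid_polytope N" "matroid_of_polytope Q = N"
      "top_degree N = top_degree M"
      using interior_face_matroid[OF assms Q] .
    interpret N: loopless_matroid N using N by (simp add: loopless_matroid_def)
    show ?thesis using N.lookup_volume_polynomial[of m] N by (simp add: N.chow_functional_def)
  qed
  have "lookup (volume_polynomial M) m = monomial_functional (hits (matroid_polytope M)) ?c"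
    by (simp add: M.lookup_volume_polynomial M.chow_functional_def)
  also have "\<dots> = (\<Sum>Q\<in>?\<F>. ?s Q * monomial_functional (hits Q) ?c)"
    by (rule monomial_functional_family_sum) (rule hits_subdivision[OF assms(3)])
  also have "\<dots> = lookup (\<Sum>Q\<in>?\<F>. (-1) ^ nat (aff_dim (matroid_polytope M) - aff_dim Q) *
       volume_polynomial (matroid_of_polytope Q)) m"
    by (simp add: lookup_sum lookup_neg_one_power_mult face)
  finally show "lookup (volume_polynomial M) m = lookup (\<Sum>Q\<in>?\<F>.
      (-1) ^ nat (aff_dim (matroid_polytope M) - aff_dim Q) * volume_polynomial (matroid_of_polytope Q)) m" .
qed

end
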